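(* Let $M$ be a closed cone in $\mathbb{R}^k$ containing a straight line. Then the inductive limit topology on $\mathcal U(M)$ is trivial (i.e., $\mathcal U(M)$ and $\varnothing$ are the only open sets).
   Context: A cone in $\mathbb{R}^k$ is a nonempty subset invariant under multiplication by positive reals. $|x|=\max_j|x_j|$ on $\mathbb{R}^k$. A cone $W$ has open projection if its image in the sphere $(\mathbb{R}^k\setminus\{0\})/\mathbb{R}_+$ is open (so $\{0\}$ has open, empty, projection). $W$ is a conic neighborhood of a cone $U$ if $W$ has open projection and $U\subset W$. A cone $U$ is proper if $\bar U\setminus\{0\}$ is contained in an open half-space $\{x: l(x)>0\}$, $l$ a linear functional. Put $\delta_U(x)=\inf_{x'\in U}|x-x'|$. For a cone $U$ and $A,B>0$, $S^{0,B}_{1,A}(U)$ is the Banach space of entire functions $f$ on $\mathbb{C}^k$ with finite norm $\sup_{z=x+iy\in\mathbb{C}^k}|f(z)|\exp(|x/A|-\delta_U(Bx)-|By|)$, and $S^0_1(U)=\bigcup_{A,B>0,\,W\supset U}S^{0,B}_{1,A}(W)$, where $W$ runs over all conic neighborhoods of $U$, with the inductive limit topology. $S'^{0}_1(U)$ is its continuous dual, with the strong topology. For closed cones $K'\subset K$, $\rho_{K',K}\colon S'^{0}_1(K')\to S'^{0}_1(K)$ is restriction of functionals to $S^0_1(K)\subset S^0_1(K')$. For a closed cone $M$, let $\mathcal P(M)$ be the set of all nonempty proper closed cones contained in $M$, ordered by inclusion. Then $\mathcal U(M)=\varinjlim_{K\in\mathcal P(M)}S'^{0}_1(K)$, the inductive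 limit over the partially ordered, not necessarily directed, set $\mathcal P(M)$: the quotient of $\bigoplus_{K\in\mathcal P(M)}S'^{0}_1(K)$ by the subspace spanned by all $\iota_{K'}u-\iota_K\rho_{K',K}u$ with $K'\subset K$ in $\mathcal P(M)$, $u\in S'^{0}_1(K')$, $\iota_K$ denoting the canonical embedding of the summand. The inductive limit topology is the quotient of the locally convex direct sum topology, i.e. the finest locally convex topology making all canonical mappings $S'^{0}_1(K)\to\mathcal U(M)$ continuous. *)

theory Defs
  imports "HOL-Analysis.Analysis" "HOL-Library.Function_Algebras"
begin

section \<open>Locally convex topologies on spaces of complex-valued functions\<close>

text \<open>
  Every vector space below (test functions, functionals, finite families of functionals) is
  realised as a complex subspace of a type of functions \<open>'x \<Rightarrow> complex\<close> with the pointwise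
  operations; a topology on it is an abstract topology whose topspace is that subspace.
  No Hausdorff condition is imposed.
\<close>

definition cscale :: "complex \<Rightarrow> ('x \<Rightarrow> complex) \<Rightarrow> 'x \<Rightarrow> complex" where
  "cscale c f = (\<lambda>x. c * f x)"

interpretation cfun: vector_space cscale
  by unfold_locales (auto simp: cscale_def fun_eq_iff algebra_simps)

definition convex_fun_set :: "('x \<Rightarrow> complex) set \<Rightarrow> bool" where
  "convex_fun_set C \<longleftrightarrow>
     (\<forall>f\<in>C. \<forall>g\<in>C. \<forall>t::real. 0 \<le> t \<and> t \<le> 1 \<longrightarrow>
        cscale (of_real (1 - t)) f + cscale (of_real t) g \<in> C)"

definition lc_topology :: "('x \<Rightarrow> complex) topology \<Rightarrow> bool" where
  "lc_topology T \<longleftrightarrow>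
     cfun.subspace (topspace T) \<and>
     continuous_map (prod_topology T T) T (\<lambda>(f, g). f + g) \<and>
     continuous_map (prod_topology euclidean T) T (\<lambda>(c, f). cscale c f) \<and>
     (\<forall>N. openin T N \<and> 0 \<in> N \<longrightarrow>
        (\<exists>C. openin T C \<and> 0 \<in> C \<and> C \<subseteq> N \<and> convex_fun_set C))"

text \<open>
  The finest locally convex topology on the subspace \<open>V\<close> making all maps \<open>h i\<close> continuous,
  obtained as the supremum of all such topologies; by the lemmas below the supremum is
  again of this kind whenever the \<open>h i\<close> map into \<open>V\<close>.
\<close>

definition lc_compatible ::
    "('x \<Rightarrow> complex) set \<Rightarrow> 'i set \<Rightarrow> ('i \<Rightarrow> 'y topology) \<Rightarrow> ('i \<Rightarrow> 'y \<Rightarrow> 'x \<Rightarrow> complex)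
      \<Rightarrow> ('x \<Rightarrow> complex) topology \<Rightarrow> bool" where
  "lc_compatible V I X h T \<longleftrightarrow>
     lc_topology T \<and> topspace T = V \<and> (\<forall>i\<in>I. continuous_map (X i) T (h i))"

definition finest_lc ::
    "('x \<Rightarrow> complex) set \<Rightarrow> 'i set \<Rightarrow> ('i \<Rightarrow> 'y topology) \<Rightarrow> ('i \<Rightarrow> 'y \<Rightarrow> 'x \<Rightarrow> complex)
      \<Rightarrow> ('x \<Rightarrow> complex) topology" where
  "finest_lc V I X h = topology_generated_by {G. \<exists>T. lc_compatible V I X h T \<and> openin T G}"

lemma finest_lc_finer:
  assumes "lc_compatible V I X h T" "openin T G"
  shows "openin (finest_lc V I X h) G"
  unfolding finest_lc_def by (rule topology_generated_by_Basis) (use assms in blast)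

lemma lc_compatible_indiscrete:
  assumes V: "cfun.subspace V" and h: "\<And>i. i \<in> I \<Longrightarrow> h i \<in> topspace (X i) \<rightarrow> V"
  defines "T \<equiv> topology (\<lambda>G. G = {} \<or> G = V)"
  shows "lc_compatible V I X h T"
proof -
  have "istopology (\<lambda>G. G = {} \<or> G = V)"
    unfolding istopology_def by (auto; blast)
  then have op: "openin T G \<longleftrightarrow> G = {} \<or> G = V" for G
    by (simp add: T_def)
  then have top: "topspace T = V"
    unfolding topspace_def by auto
  have cm: "continuous_map Y T g" if "g \<in> topspace Y \<rightarrow> V" for Y :: "'z topology" and g
  proof -
    have "{x \<in> topspace Y. g x \<in> V} = topspace Y" using that by auto
    then show ?thesis using that by (auto simp: continuous_map_def op top)
  qed
  have "continuous_map (prod_topology T T) T (\<lambda>(f, g). f + g)"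
    by (rule cm) (use V in \<open>auto simp: top intro: cfun.subspace_add\<close>)
  moreover have "continuous_map (prod_topology euclidean T) T (\<lambda>(c, f). cscale c f)"
    by (rule cm) (use V in \<open>auto simp: top intro: cfun.subspace_scale\<close>)
  moreover have "convex_fun_set V"
    using V by (auto simp: convex_fun_set_def intro!: cfun.subspace_add cfun.subspace_scale)
  ultimately have "lc_topology T"
    unfolding lc_topology_def using V by (auto simp: top op intro: exI[of _ V])
  moreover have "continuous_map (X i) T (h i)" if "i \<in> I" for i
    by (rule cm) (rule h[OF that])
  ultimately show ?thesis by (simp add: lc_compatible_def top)
qed

lemma lc_compatible_finest_lc:
  assumes V: "cfun.subspace V" and h: "\<And>i. i \<in> I \<Longrightarrow> h i \<in> topspace (X i) \<rightarrow> V"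
  shows "lc_compatible V I X h (finest_lc V I X h)"
proof -
  let ?B = "{G. \<exists>T. lc_compatible V I X h T \<and> openin T G}"
  let ?F = "finest_lc V I X h"
  define T0 where "T0 = topology (\<lambda>G. G = {} \<or> G = V)"
  have T0: "lc_compatible V I X h T0"
    unfolding T0_def using V h by (rule lc_compatible_indiscrete)
  then have "openin T0 V" using openin_topspace[of T0] by (simp add: lc_compatible_def)
  with T0 have "V \<in> ?B" by blast
  moreover have "G \<subseteq> V" if "G \<in> ?B" for G
    using that by (auto simp: lc_compatible_def dest: openin_subset)
  ultimately have UB: "\<Union>?B = V" by blast
  have top: "topspace ?F = V" by (simp add: finest_lc_def UB)
  have cm: "continuous_map Y ?F g"
    if "g \<in> topspace Y \<rightarrow> V"
      "\<And>T. lc_compatible V I X h T \<Longrightarrow> continuous_map Y T g"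
    for Y :: "'z topology" and g
    unfolding finest_lc_def
  proof (rule continuous_on_generated_topo)
    fix G assume "G \<in> ?B"
    then obtain T where "lc_compatible V I X h T" "openin T G" by auto
    then have "openin Y {x \<in> topspace Y. g x \<in> G}"
      using that(2) openin_continuous_map_preimage by blast
    then show "openin Y (g -` G \<inter> topspace Y)"
      by (simp add: vimage_def Int_def conj_commute)
  qed (use that UB in auto)
  have sub: "continuous_map ?F T id" if "lc_compatible V I X h T" for T
    unfolding continuous_map_def
  proof (intro conjI allI impI)
    have "topspace T = V" using that by (simp add: lc_compatible_def)
    then show "id \<in> topspace ?F \<rightarrow> topspace T" by (simp add: top)
    fix G assume G: "openin T G"
    then have "{x \<in> topspace ?F. id x \<in> G} = G"
      using openin_subset[OF G] \<open>topspace T = V\<close> by (auto simp: top)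
    then show "openin ?F {x \<in> topspace ?F. id x \<in> G}"
      using finest_lc_finer[OF that G] by simp
  qed
  have add: "continuous_map (prod_topology ?F ?F) ?F (\<lambda>(f, g). f + g)"
  proof (rule cm)
    fix T assume T: "lc_compatible V I X h T"
    have "continuous_map (prod_topology ?F ?F) (prod_topology T T) (\<lambda>(f, g). (id f, id g))"
      by (intro continuous_map_prod_top[THEN iffD2] disjI2 conjI sub T)
    then have "continuous_map (prod_topology ?F ?F) T ((\<lambda>(f, g). f + g) \<circ> (\<lambda>(f, g). (id f, id g)))"
      by (rule continuous_map_compose) (use T in \<open>simp add: lc_compatible_def lc_topology_def\<close>)
    then show "continuous_map (prod_topology ?F ?F) T (\<lambda>(f, g). f + g)"
      by (simp add: comp_def case_prod_unfold)
  qed (use V in \<open>auto simp: top intro: cfun.subspace_add\<close>)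
  have scale: "continuous_map (prod_topology euclidean ?F) ?F (\<lambda>(c, f). cscale c f)"
  proof (rule cm)
    fix T assume T: "lc_compatible V I X h T"
    have "continuous_map (prod_topology euclidean ?F) (prod_topology euclidean T)
        (\<lambda>(c, f). (id c, id f))"
      by (intro continuous_map_prod_top[THEN iffD2] disjI2 conjI sub T continuous_map_id)
    then have "continuous_map (prod_topology euclidean ?F) T
        ((\<lambda>(c, f). cscale c f) \<circ> (\<lambda>(c, f). (id c, id f)))"
      by (rule continuous_map_compose) (use T in \<open>simp add: lc_compatible_def lc_topology_def\<close>)
    then show "continuous_map (prod_topology euclidean ?F) T (\<lambda>(c, f). cscale c f)"
      by (simp add: comp_def case_prod_unfold)
  qed (use V in \<open>auto simp: top intro: cfun.subspace_scale\<close>)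
  have conv: "\<exists>C. openin ?F C \<and> 0 \<in> C \<and> C \<subseteq> N \<and> convex_fun_set C"
    if "openin ?F N" "0 \<in> N" for N
  proof -
    have "generate_topology_on ?B N"
      using that(1) unfolding finest_lc_def openin_topology_generated_by_iff .
    then show ?thesis using that(2)
    proof induction
      case (Int a b)
      then obtain C D where "openin ?F C \<and> 0 \<in> C \<and> C \<subseteq> a \<and> convex_fun_set C"
        "openin ?F D \<and> 0 \<in> D \<and> D \<subseteq> b \<and> convex_fun_set D" by (meson IntE)
      then show ?case
        by (intro exI[of _ "C \<inter> D"]) (auto simp: convex_fun_set_def zero_fun_def)
    next
      case (UN K)
      then obtain k where k: "k \<in> K" "0 \<in> k" by blast
      then obtain C where "openin ?F C \<and> 0 \<in> C \<and> C \<subseteq> k \<and> convex_fun_set C"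
        using UN.IH by meson
      then show ?case using k(1) by blast
    next
      case (Basis s)
      then obtain T where "lc_compatible V I X h T" "openin T s" by auto
      with Basis.prems show ?case
        using finest_lc_finer unfolding lc_compatible_def lc_topology_def by metis
    qed auto
  qed
  have maps: "continuous_map (X i) ?F (h i)" if "i \<in> I" for i
  proof (rule cm)
    show "continuous_map (X i) T (h i)" if "lc_compatible V I X h T" for T
      using that \<open>i \<in> I\<close> by (simp add: lc_compatible_def)
  qed (rule h[OF that])
  show ?thesis
    using add scale conv maps V by (simp add: lc_compatible_def lc_topology_def top)
qed

section \<open>The strong dual\<close>

text \<open>
  A functional on a subspace \<open>V\<close> is represented by the function on the whole type that
  vanishes outside \<open>V\<close>.
\<close>

definition cont_dual :: "('x \<Rightarrow> complex) topology \<Rightarrow> (('x \<Rightarrow> complex) \<Rightarrow> complex) set" where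
  "cont_dual T =
     {u. (\<forall>f. f \<notin> topspace T \<longrightarrow> u f = 0) \<and>
         (\<forall>f\<in>topspace T. \<forall>g\<in>topspace T. u (f + g) = u f + u g) \<and>
         (\<forall>c. \<forall>f\<in>topspace T. u (cscale c f) = c * u f) \<and>
         continuous_map T euclidean u}"

definition tvs_bounded :: "('x \<Rightarrow> complex) topology \<Rightarrow> ('x \<Rightarrow> complex) set \<Rightarrow> bool" where
  "tvs_bounded T B \<longleftrightarrow> B \<subseteq> topspace T \<and>
     (\<forall>N. openin T N \<and> 0 \<in> N \<longrightarrow> (\<exists>r>0. \<forall>c. r \<le> cmod c \<longrightarrow> B \<subseteq> cscale c ` N))"

text \<open>The topology of uniform convergence on bounded sets.\<close>

definition strong_dual :: "('x \<Rightarrow> complex) topology \<Rightarrow> (('x \<Rightarrow> complex) \<Rightarrow> complex) topology" where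
  "strong_dual T = topology (\<lambda>G. G \<subseteq> cont_dual T \<and>
     (\<forall>u\<in>G. \<exists>B \<epsilon>. tvs_bounded T B \<and> 0 < \<epsilon> \<and>
        {v \<in> cont_dual T. \<forall>f\<in>B. cmod (v f - u f) \<le> \<epsilon>} \<subseteq> G))"

lemma openin_strong_dual:
  "openin (strong_dual T) G \<longleftrightarrow> G \<subseteq> cont_dual T \<and>
     (\<forall>u\<in>G. \<exists>B \<epsilon>. tvs_bounded T B \<and> 0 < \<epsilon> \<and>
        {v \<in> cont_dual T. \<forall>f\<in>B. cmod (v f - u f) \<le> \<epsilon>} \<subseteq> G)"
  (is "_ \<longleftrightarrow> ?P G")
proof -
  have "istopology ?P"
    unfolding istopology_def
  proof (intro conjI allI impI)
    fix S S' assume S: "?P S" and S': "?P S'"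
    show "S \<inter> S' \<subseteq> cont_dual T" using S by auto
    show "\<forall>u\<in>S \<inter> S'. \<exists>B \<epsilon>. tvs_bounded T B \<and> 0 < \<epsilon> \<and>
        {v \<in> cont_dual T. \<forall>f\<in>B. cmod (v f - u f) \<le> \<epsilon>} \<subseteq> S \<inter> S'"
    proof
      fix u assume u: "u \<in> S \<inter> S'"
      obtain B \<epsilon> where 1: "tvs_bounded T B" "0 < \<epsilon>"
        "{v \<in> cont_dual T. \<forall>f\<in>B. cmod (v f - u f) \<le> \<epsilon>} \<subseteq> S" using S u by blast
      obtain B' \<epsilon>' where 2: "tvs_bounded T B'" "0 < \<epsilon>'"
        "{v \<in> cont_dual T. \<forall>f\<in>B'. cmod (v f - u f) \<le> \<epsilon>'} \<subseteq> S'" using S' u by blast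
      have "tvs_bounded T (B \<union> B')"
        unfolding tvs_bounded_def
      proof (intro conjI allI impI)
        show "B \<union> B' \<subseteq> topspace T" using 1 2 by (auto simp: tvs_bounded_def)
        fix N assume N: "openin T N \<and> 0 \<in> N"
        obtain r where r: "r > 0" "\<And>c. r \<le> cmod c \<Longrightarrow> B \<subseteq> cscale c ` N"
          using 1(1) N unfolding tvs_bounded_def by blast
        obtain r' where r': "r' > 0" "\<And>c. r' \<le> cmod c \<Longrightarrow> B' \<subseteq> cscale c ` N"
          using 2(1) N unfolding tvs_bounded_def by blast
        show "\<exists>r>0. \<forall>c. r \<le> cmod c \<longrightarrow> B \<union> B' \<subseteq> cscale c ` N"
          using r r' by (intro exI[of _ "max r r'"]) (auto dest!: subsetD)
      qed
      moreover have "{v \<in> cont_dual T. \<forall>f\<in>B \<union> B'. cmod (v f - u f) \<le> min \<epsilon> \<epsilon>'} \<subseteq> S \<inter> S'"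
        using 1(3) 2(3) by auto
      ultimately show "\<exists>B \<epsilon>. tvs_bounded T B \<and> 0 < \<epsilon> \<and>
        {v \<in> cont_dual T. \<forall>f\<in>B. cmod (v f - u f) \<le> \<epsilon>} \<subseteq> S \<inter> S'"
        using 1(2) 2(2) by (meson min_less_iff_conj)
    qed
  next
    fix \<K> assume K: "\<forall>K\<in>\<K>. ?P K"
    then show "\<Union>\<K> \<subseteq> cont_dual T" by blast
    show "\<forall>u\<in>\<Union>\<K>. \<exists>B \<epsilon>. tvs_bounded T B \<and> 0 < \<epsilon> \<and>
        {v \<in> cont_dual T. \<forall>f\<in>B. cmod (v f - u f) \<le> \<epsilon>} \<subseteq> \<Union>\<K>"
      using K by (meson UnionE Union_upper subset_trans)
  qed
  then show ?thesis unfolding strong_dual_def by simp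
qed

section \<open>Cones\<close>

text \<open>The library's \<^const>\<open>cone\<close> requires invariance under the factor 0 as well and allows the empty set.\<close>

definition pos_cone :: "(real^'n) set \<Rightarrow> bool" where
  "pos_cone U \<longleftrightarrow> U \<noteq> {} \<and> (\<forall>x\<in>U. \<forall>c>0. c *\<^sub>R x \<in> U)"

text \<open>
  The quotient of the punctured space by the positive reals is realised as the unit sphere,
  with \<^const>\<open>sgn\<close> as the quotient map.
\<close>

lemma sgn_quotient_map:
  "quotient_map (top_of_set (- {0 :: real^'n})) (top_of_set (sphere 0 1)) sgn"
proof (rule retraction_imp_quotient_map)
  have "continuous_on (- {0 :: real^'n}) sgn"
    by (auto simp: sgn_div_norm intro!: continuous_intros)
  then show "retraction_map (top_of_set (- {0 :: real^'n})) (top_of_set (sphere 0 1)) sgn"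
    unfolding retraction_map_def retraction_maps_def
    by (intro exI[of _ id]) (auto simp: norm_sgn sgn_div_norm)
qed

lemma sgn_eq_iff_same_ray:
  assumes "(x :: real^'n) \<noteq> 0" "y \<noteq> 0"
  shows "sgn x = sgn y \<longleftrightarrow> (\<exists>c>0. y = c *\<^sub>R x)"
proof
  assume "sgn x = sgn y"
  moreover have "y = norm y *\<^sub>R sgn y" using assms by (simp add: sgn_div_norm)
  ultimately have "y = norm y *\<^sub>R sgn x" by simp
  then have "y = (norm y / norm x) *\<^sub>R x"
    by (simp add: sgn_div_norm divide_inverse)
  then show "\<exists>c>0. y = c *\<^sub>R x" using assms by (metis divide_pos_pos zero_less_norm_iff)
qed (auto simp: sgn_scaleR)

definition open_projection :: "(real^'n) set \<Rightarrow> bool" where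
  "open_projection W \<longleftrightarrow> openin (top_of_set (sphere 0 1)) (sgn ` (W - {0}))"

definition conic_nbhd :: "(real^'n) set \<Rightarrow> (real^'n) set \<Rightarrow> bool" where
  "conic_nbhd W U \<longleftrightarrow> pos_cone W \<and> open_projection W \<and> U \<subseteq> W"

definition proper_cone :: "(real^'n) set \<Rightarrow> bool" where
  "proper_cone U \<longleftrightarrow> pos_cone U \<and> (\<exists>l::real^'n \<Rightarrow> real. linear l \<and> closure U - {0} \<subseteq> {x. l x > 0})"

definition contains_line :: "(real^'n) set \<Rightarrow> bool" where
  "contains_line M \<longleftrightarrow> (\<exists>a v. v \<noteq> 0 \<and> (\<forall>t. a + t *\<^sub>R v \<in> M))"

text \<open>The maximum norm on \<open>\<real>\<^sup>k\<close> is the library's \<^const>\<open>infnorm\<close>.\<close>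

definition cone_dist :: "(real^'n) set \<Rightarrow> real^'n \<Rightarrow> real" where
  "cone_dist U x = (INF x'\<in>U. infnorm (x - x'))"

section \<open>The test function spaces\<close>

type_synonym 'n testfun = "complex^'n \<Rightarrow> complex"
type_synonym 'n functional = "'n testfun \<Rightarrow> complex"

definition entire :: "('n::finite) testfun \<Rightarrow> bool" where
  "entire f \<longleftrightarrow> (\<forall>z. \<exists>L. (f has_derivative L) (at z) \<and> (\<forall>c w. L (c *s w) = c * L w))"

definition Re_vec :: "complex^'n \<Rightarrow> real^'n" where
  "Re_vec z = (\<chi> j. Re (z $ j))"

definition Im_vec :: "complex^'n \<Rightarrow> real^'n" where
  "Im_vec z = (\<chi> j. Im (z $ j))"

definition S_norm :: "real \<Rightarrow> real \<Rightarrow> (real^'n) set \<Rightarrow> ('n::finite) testfun \<Rightarrow> ennreal" where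
  "S_norm A B U f = (SUP z. ennreal (cmod (f z) *
     exp (infnorm ((1 / A) *\<^sub>R Re_vec z) - cone_dist U (B *\<^sub>R Re_vec z) - infnorm (B *\<^sub>R Im_vec z))))"

definition S_AB :: "real \<Rightarrow> real \<Rightarrow> (real^'n) set \<Rightarrow> ('n::finite) testfun set" where
  "S_AB A B U = {f. entire f \<and> S_norm A B U f < \<infinity>}"

definition S_AB_top :: "real \<Rightarrow> real \<Rightarrow> (real^'n) set \<Rightarrow> ('n::finite) testfun topology" where
  "S_AB_top A B U = Metric_space.mtopology (S_AB A B U) (\<lambda>f g. enn2real (S_norm A B U (f - g)))"

definition S_index :: "(real^'n) set \<Rightarrow> (real \<times> real \<times> (real^'n) set) set" where
  "S_index U = {(A, B, W). 0 < A \<and> 0 < B \<and> conic_nbhd W U}"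

definition S_space :: "(real^'n) set \<Rightarrow> ('n::finite) testfun set" where
  "S_space U = (\<Union>(A, B, W)\<in>S_index U. S_AB A B W)"

definition S_top :: "(real^'n) set \<Rightarrow> ('n::finite) testfun topology" where
  "S_top U = finest_lc (S_space U) (S_index U) (\<lambda>(A, B, W). S_AB_top A B W) (\<lambda>_ f. f)"

definition S_dual :: "(real^'n) set \<Rightarrow> ('n::finite) functional set" where
  "S_dual K = cont_dual (S_top K)"

definition S_dual_top :: "(real^'n) set \<Rightarrow> ('n::finite) functional topology" where
  "S_dual_top K = strong_dual (S_top K)"

text \<open>Restriction \<open>S_dual K' \<rightarrow> S_dual K\<close> for \<open>K' \<subseteq> K\<close>; the result does not depend on \<open>K'\<close>.\<close>

definition \<rho> :: "(real^'n) set \<Rightarrow> ('n::finite) functional \<Rightarrow> 'n functional" where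
  "\<rho> K u = (\<lambda>f. if f \<in> S_space K then u f else 0)"

section \<open>The inductive limit\<close>

definition \<P> :: "(real^'n) set \<Rightarrow> (real^'n) set set" where
  "\<P> M = {K. proper_cone K \<and> closed K \<and> K \<subseteq> M}"

text \<open>
  A family \<open>F\<close> of functionals indexed by cones is stored in uncurried form:
  its component at \<open>K\<close> is \<open>\<lambda>f. F (K, f)\<close>.
\<close>

type_synonym 'n family = "(real^'n) set \<times> 'n testfun \<Rightarrow> complex"

definition direct_sum :: "(real^'n) set \<Rightarrow> ('n::finite) family set" where
  "direct_sum M = {F. (\<forall>K\<in>\<P> M. (\<lambda>f. F (K, f)) \<in> S_dual K) \<and>
                (\<forall>K f. K \<notin> \<P> M \<longrightarrow> F (K, f) = 0) \<and>
                finite {K. \<exists>f. F (K, f) \<noteq> 0}}"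

definition \<iota> :: "(real^'n) set \<Rightarrow> ('n::finite) functional \<Rightarrow> 'n family" where
  "\<iota> K u = (\<lambda>(L, f). if L = K then u f else 0)"

definition direct_sum_top :: "(real^'n) set \<Rightarrow> ('n::finite) family topology" where
  "direct_sum_top M = finest_lc (direct_sum M) (\<P> M) S_dual_top \<iota>"

definition relations :: "(real^'n) set \<Rightarrow> ('n::finite) family set" where
  "relations M = cfun.span
     {\<iota> K' u - \<iota> K (\<rho> K u) | K' K u. K' \<in> \<P> M \<and> K \<in> \<P> M \<and> K' \<subseteq> K \<and> u \<in> S_dual K'}"

definition U_rel :: "(real^'n) set \<Rightarrow> (('n::finite) family \<times> 'n family) set" where
  "U_rel M = {(F, G). F \<in> direct_sum M \<and> G \<in> direct_sum M \<and> G - F \<in> relations M}"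

definition \<U> :: "(real^'n) set \<Rightarrow> ('n::finite) family set set" where
  "\<U> M = direct_sum M // U_rel M"

text \<open>The quotient topology of the locally convex direct sum topology.\<close>

definition \<U>_top :: "(real^'n) set \<Rightarrow> ('n::finite) family set topology" where
  "\<U>_top M = topology (\<lambda>G. G \<subseteq> \<U> M \<and> openin (direct_sum_top M) {F \<in> direct_sum M. U_rel M `` {F} \<in> G})"

lemma openin_\<U>_top:
  "openin (\<U>_top M) G \<longleftrightarrow> G \<subseteq> \<U> M \<and> openin (direct_sum_top M) {F \<in> direct_sum M. U_rel M `` {F} \<in> G}"
  (is "_ \<longleftrightarrow> ?P G")
proof -
  have "istopology ?P"
    unfolding istopology_def
  proof (intro conjI allI impI)
    fix S S' assume S: "?P S" and S': "?P S'"
    show "S \<inter> S' \<subseteq> \<U> M" using S by auto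
    have "{F \<in> direct_sum M. U_rel M `` {F} \<in> S \<inter> S'} =
        {F \<in> direct_sum M. U_rel M `` {F} \<in> S} \<inter> {F \<in> direct_sum M. U_rel M `` {F} \<in> S'}" by auto
    then show "openin (direct_sum_top M) {F \<in> direct_sum M. U_rel M `` {F} \<in> S \<inter> S'}"
      using S S' by auto
  next
    fix \<K> assume K: "\<forall>K\<in>\<K>. ?P K"
    then show "\<Union>\<K> \<subseteq> \<U> M" by blast
    have "{F \<in> direct_sum M. U_rel M `` {F} \<in> \<Union>\<K>} =
        (\<Union>K\<in>\<K>. {F \<in> direct_sum M. U_rel M `` {F} \<in> K})" by auto
    then show "openin (direct_sum_top M) {F \<in> direct_sum M. U_rel M `` {F} \<in> \<Union>\<K>}"
      using K by auto
  qed
  then show ?thesis unfolding \<U>_top_def by simp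
qed

end

theory Submission
  imports Defs "HOL-Complex_Analysis.Complex_Analysis"
begin

text \<open>
  Why the topology is trivial. A continuous functional on \<^term>\<open>\<U> M\<close> should be the same thing as a
  single test function that belongs to \<^term>\<open>S_space K\<close> for every \<^term>\<open>K \<in> \<P> M\<close>. If \<open>v\<close> is the
  direction of a line in \<open>M\<close>, such a function decays exponentially both along \<open>v\<close> and along \<open>- v\<close>,
  while it grows at most exponentially in the imaginary directions. Restricted to a complex line
  parallel to \<open>v\<close> it is an entire function \<open>G\<close> with
  \<open>|G s| \<le> C exp (b |Im s| - a |Re s|)\<close>, and such a function is zero by an argument of
  Phragmen-Lindeloef type (\<open>entire_zero_if_two_sided_decay\<close>). So there is no nonzero continuous
  functional, and a locally convex topology without nonzero continuous functionals is trivial.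

  The proof follows this idea but replaces the Hahn-Banach theorem and the reflexivity of the
  test spaces by a compactness argument with finitely many evaluations. Three facts carry it.

  \<^item> Bounded sets of the inductive limit \<^term>\<open>S_space K\<close> lie in multiples of one of the explicit
    balls \<open>decay_ball r K\<close> (\<open>bounded_in_S_top\<close>), so neighbourhoods in the strong dual are
    described by uniform smallness on such a ball.
  \<^item> Let \<open>f\<close>, \<open>g\<close>, \<open>h\<close> run through the balls of \<open>K\<close> and of the rays spanned by \<open>v\<close> and \<open>- v\<close>. If
    \<open>f - g\<close> and \<open>g - h\<close> are small on a large finite set, then \<open>u f\<close> is small for any given
    continuous \<open>u\<close>: otherwise Montel's theorem along complex lines would produce a common limit
    of the \<open>g\<close> and the \<open>h\<close>, which decays on both sides and hence vanishes
    (\<open>functional_small_if_close_on_finite_set\<close>).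
  \<^item> By separation in a finite-dimensional space the previous fact turns into an approximation
    statement (\<open>point_functional_approximation\<close>): there are combinations \<open>p\<close> and \<open>q\<close> of point
    evaluations such that \<open>u - p\<close> is small on the ball of \<open>K\<close>, \<open>p - q\<close> is small on the ball of the
    ray of \<open>v\<close>, and \<open>q\<close> is small on the ball of the ray of \<open>- v\<close>.

  Point evaluations are defined on all entire functions of exponential type, that is, on the test
  space of the cone \<open>{0}\<close>, which lies below every member of \<^term>\<open>\<P> M\<close>. Modulo the relations,
  \<open>u\<close> placed at \<open>K\<close> is therefore the sum of \<open>u - p\<close> placed at \<open>K\<close>, of \<open>p - q\<close> placed at the first
  ray and of \<open>q\<close> placed at the second one, and all three are small. Hence the relations are dense
  in the direct sum (\<open>relations_dense\<close>), which says that the quotient topology is trivial.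
\<close>

section \<open>Entire functions of one variable with two-sided exponential decay\<close>

text \<open>
  Dividing a high power of \<open>Q\<close> by \<open>z\<close> makes it small on large arcs, so that in the maximum
  principle only the boundary line counts, and the factor \<open>|z0|\<close> lost in this way disappears after
  taking roots.
\<close>

lemma bounded_half_plane_maximum_principle:
  fixes Q :: "complex \<Rightarrow> complex"
  assumes hol: "Q holomorphic_on {z. Re z > 0}"
    and bdd: "\<And>z. Re z \<ge> 1 \<Longrightarrow> cmod (Q z) \<le> M"
    and bdry: "\<And>z. Re z = 1 \<Longrightarrow> cmod (Q z) \<le> B"
    and "B > 0" and z0: "Re z0 \<ge> 1"
  shows "cmod (Q z0) \<le> B"
proof -
  have pow: "(cmod (Q z0) / B) ^ m \<le> cmod z0" for m
  proof -
    \<comment> \<open>On the arc of radius R the bound M ^ m / R is at most B ^ m.\<close>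
    define R where "R = max (cmod z0) ((M / B) ^ m)"
    define S where "S = {z. Re z \<ge> 1} \<inter> cball 0 R"
    have cl: "closed S" unfolding S_def by (intro closed_Int closed_halfspace_Re_ge closed_cball)
    have sub: "S \<subseteq> {z. Re z > 0}" by (auto simp: S_def)
    have hF: "(\<lambda>z. Q z ^ m / z) holomorphic_on {z. Re z > 0}"
      by (intro holomorphic_intros hol) auto
    have R1: "R \<ge> 1" using z0 complex_Re_le_cmod[of z0] by (simp add: R_def)
    have "norm (Q z0 ^ m / z0) \<le> B ^ m"
    proof (rule maximum_modulus_frontier[of "\<lambda>z. Q z ^ m / z" S])
      show "(\<lambda>z. Q z ^ m / z) holomorphic_on interior S"
        using hF sub interior_subset holomorphic_on_subset by (metis (lifting) subset_trans)
      show "continuous_on (closure S) (\<lambda>z. Q z ^ m / z)"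
        using hF sub cl by (metis closure_closed holomorphic_on_imp_continuous_on holomorphic_on_subset)
      show "bounded S" unfolding S_def by (intro bounded_Int) auto
      show "z0 \<in> S" using z0 by (auto simp: S_def R_def)
      fix z assume fr: "z \<in> frontier S"
      then have zS: "z \<in> S" using cl frontier_subset_closed by blast
      then have z1: "Re z \<ge> 1" "cmod z \<le> R" by (auto simp: S_def)
      have zn: "cmod z \<ge> 1" using complex_Re_le_cmod[of z] z1 by linarith
      have "Re z = 1 \<or> cmod z = R"
      proof (rule ccontr)
        assume "\<not> ?thesis"
        then have "z \<in> {z. Re z > 1} \<inter> ball 0 R" using z1 by auto
        moreover have "open ({z. Re z > 1} \<inter> ball 0 R)"
          by (intro open_Int open_halfspace_Re_gt open_ball)
        moreover have "{z. Re z > 1} \<inter> ball 0 R \<subseteq> S" by (auto simp: S_def)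
        ultimately have "z \<in> interior S" by (meson interiorI)
        then show False using fr by (simp add: frontier_def)
      qed
      then show "norm (Q z ^ m / z) \<le> B ^ m"
      proof
        assume "Re z = 1"
        then have "cmod (Q z) ^ m \<le> B ^ m" using bdry by (intro power_mono) auto
        then show ?thesis using zn
          by (simp add: norm_divide norm_power divide_le_eq)
             (metis \<open>B > 0\<close> less_eq_real_def mult_le_cancel_left1 order_trans zero_less_power not_le)
      next
        assume R: "cmod z = R"
        have "cmod (Q z) ^ m \<le> M ^ m" using bdd z1 by (intro power_mono) auto
        also have "\<dots> = (M / B) ^ m * B ^ m" using \<open>B > 0\<close> by (simp add: power_divide)
        also have "\<dots> \<le> R * B ^ m" using \<open>B > 0\<close> by (intro mult_right_mono) (auto simp: R_def)
        finally show ?thesis using R R1 by (simp add: norm_divide norm_power divide_le_eq mult.commute)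
      qed
    qed
    moreover have "cmod z0 > 0" using z0 by (auto simp: complex_eq_iff)
    ultimately have "cmod (Q z0) ^ m \<le> B ^ m * cmod z0"
      by (simp add: norm_divide norm_power divide_le_eq)
    then show ?thesis using \<open>B > 0\<close> by (simp add: power_divide divide_le_eq mult.commute)
  qed
  have "cmod (Q z0) / B \<le> 1"
  proof (rule ccontr)
    assume "\<not> ?thesis"
    then obtain m where "cmod z0 < (cmod (Q z0) / B) ^ m" using real_arch_pow[of "cmod (Q z0) / B" "cmod z0"] by auto
    with pow[of m] show False by linarith
  qed
  then show ?thesis using \<open>B > 0\<close> by simp
qed

text \<open>
  The product with \<open>exp (- t z Ln z)\<close>, where \<open>t = 2 a / pi\<close>, turns the decay in \<open>Im z\<close> into decay
  that is faster than exponential in \<open>Re z\<close>: in the right half-plane \<open>|Arg z| < pi / 2\<close>, so the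
  factor \<open>exp (t |Im z| |Arg z|)\<close> that comes in is compensated by \<open>exp (- a |Im z|)\<close>. The product
  remains bounded after multiplication by \<open>exp (N z)\<close>, for every \<open>N\<close>. On the line \<open>Re z = 1\<close> this multiplication costs
  \<open>exp N\<close>, while at a point with larger real part it gains \<open>exp (N Re z)\<close>; by the maximum
  principle the function vanishes there as \<open>N\<close> tends to infinity.
\<close>

lemma entire_zero_if_two_sided_decay_right:
  fixes H :: "complex \<Rightarrow> complex"
  assumes hol: "H holomorphic_on UNIV" and "a > 0" "b \<ge> 0"
    and bd: "\<And>z. cmod (H z) \<le> C * exp (b * \<bar>Re z\<bar> - a * \<bar>Im z\<bar>)"
    and z0: "Re z0 > 1"
  shows "H z0 = 0"
proof -
  define t where "t = 2 * a / pi"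
  have t: "t > 0" "t * (pi / 2) = a" using \<open>a > 0\<close> by (auto simp: t_def)
  have C0: "0 \<le> C" using order_trans[OF norm_ge_zero bd[of 0]] by simp
  define C' where "C' = C + 1"
  have C': "C' > 0" using C0 by (simp add: C'_def)
  have bd': "cmod (H z) \<le> C' * exp (b * \<bar>Re z\<bar> - a * \<bar>Im z\<bar>)" for z
    by (rule order_trans[OF bd]) (simp add: C'_def)
  define E where "E = (\<lambda>z. exp (- (of_real t * z * Ln z)))"
  have E: "cmod (E z) \<le> exp (a * \<bar>Im z\<bar> - t * Re z * ln (cmod z))" if "Re z \<ge> 1" for z
  proof -
    have nz: "z \<noteq> 0" using that by auto
    have "\<bar>Im (Ln z)\<bar> < pi / 2" using Re_Ln_pos_lt[OF nz] that by auto
    then have "\<bar>Im z * Im (Ln z)\<bar> \<le> \<bar>Im z\<bar> * (pi / 2)"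
      unfolding abs_mult by (intro mult_left_mono) auto
    then have "Im z * Im (Ln z) \<le> \<bar>Im z\<bar> * (pi / 2)" by linarith
    then have "t * (Im z * Im (Ln z)) \<le> t * (\<bar>Im z\<bar> * (pi / 2))" using t by simp
    also have "\<dots> = a * \<bar>Im z\<bar>" using t(2) by (simp add: algebra_simps)
    finally show ?thesis using nz by (simp add: E_def algebra_simps)
  qed
  have key: "cmod (H z0 * exp (of_nat N * z0) * E z0) \<le> C' * exp (b + N)" for N :: nat
  proof (rule bounded_half_plane_maximum_principle[where Q = "\<lambda>z. H z * exp (of_nat N * z) * E z"])
    define \<beta> where "\<beta> = b + N"
    have \<beta>: "\<beta> \<ge> 0" using \<open>b \<ge> 0\<close> by (simp add: \<beta>_def)
    have hH: "H holomorphic_on {z. Re z > 0}" using hol holomorphic_on_subset by blast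
    show "(\<lambda>z. H z * exp (of_nat N * z) * E z) holomorphic_on {z. Re z > 0}"
      unfolding E_def by (intro holomorphic_intros hH) (auto simp: complex_nonpos_Reals_iff)
    have gen: "cmod (H z * exp (of_nat N * z) * E z) \<le> C' * exp (\<beta> * Re z - t * Re z * ln (cmod z))"
      if "Re z \<ge> 1" for z
    proof -
      have "cmod (H z * exp (of_nat N * z) * E z)
          \<le> C' * exp (b * \<bar>Re z\<bar> - a * \<bar>Im z\<bar>) * exp (N * Re z) * exp (a * \<bar>Im z\<bar> - t * Re z * ln (cmod z))"
        unfolding norm_mult by (intro mult_mono bd' E that) (use C' in auto)
      also have "\<dots> = C' * exp (\<beta> * Re z - t * Re z * ln (cmod z))"
        using that by (simp add: \<beta>_def algebra_simps flip: exp_add)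
      finally show ?thesis .
    qed
    show "cmod (H z * exp (of_nat N * z) * E z) \<le> C' * exp (\<beta> * exp (\<beta> / t))" if z: "Re z \<ge> 1" for z
    proof -
      \<comment> \<open>The exponent is negative as soon as ln (Re z) exceeds \<open>\<beta> / t\<close>.\<close>
      have "\<beta> * Re z - t * Re z * ln (cmod z) \<le> \<beta> * exp (\<beta> / t)"
      proof (cases "Re z \<le> exp (\<beta> / t)")
        case True
        have "1 \<le> cmod z" using z complex_Re_le_cmod[of z] by linarith
        then have "0 \<le> t * Re z * ln (cmod z)" using t z by auto
        moreover have "\<beta> * Re z \<le> \<beta> * exp (\<beta> / t)" using True \<beta> by (intro mult_left_mono)
        ultimately show ?thesis by linarith
      next
        case False
        then have "exp (\<beta> / t) \<le> cmod z" using complex_Re_le_cmod[of z] by linarith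
        then have "\<beta> / t \<le> ln (cmod z)"
          by (metis exp_gt_zero ln_exp ln_mono)
        then have "\<beta> \<le> t * ln (cmod z)" using t by (simp add: field_simps)
        then have "Re z * \<beta> \<le> Re z * (t * ln (cmod z))" using z by (intro mult_left_mono) auto
        moreover have "0 \<le> \<beta> * exp (\<beta> / t)" using \<beta> by simp
        ultimately show ?thesis by (simp add: algebra_simps)
      qed
      then show ?thesis using order_trans[OF gen[OF z]] C' by simp
    qed
    show "cmod (H z * exp (of_nat N * z) * E z) \<le> C' * exp (b + N)" if z: "Re z = 1" for z
    proof -
      have "1 \<le> cmod z" using z complex_Re_le_cmod[of z] by linarith
      then have "0 \<le> t * ln (cmod z)" using t by auto
      then have "\<beta> * Re z - t * Re z * ln (cmod z) \<le> b + N" using z by (simp add: \<beta>_def)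
      then show ?thesis using order_trans[OF gen, of z] z C' by simp
    qed
    show "0 < C' * exp (b + N)" using C' by simp
    show "Re z0 \<ge> 1" using z0 by simp
  qed
  have "cmod (H z0 * E z0) \<le> C' * exp b * exp (1 - Re z0) ^ N" for N :: nat
  proof -
    have "cmod (H z0 * E z0) * exp (N * Re z0) \<le> C' * exp (b + N)"
      using key[of N] by (simp add: norm_mult mult_ac)
    also have "\<dots> = C' * exp b * exp (1 - Re z0) ^ N * exp (N * Re z0)"
      by (simp add: algebra_simps flip: exp_of_nat_mult exp_add)
    finally show ?thesis by simp
  qed
  moreover have "(\<lambda>N. C' * exp b * exp (1 - Re z0) ^ N) \<longlonglongrightarrow> C' * exp b * 0"
    by (intro tendsto_mult tendsto_const LIMSEQ_power_zero) (use z0 in simp)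
  ultimately have "cmod (H z0 * E z0) \<le> 0"
    by (intro LIMSEQ_le_const[of "\<lambda>N. C' * exp b * exp (1 - Re z0) ^ N"]) auto
  then show ?thesis by (simp add: E_def)
qed

text \<open>
  The hypothesis is stable under translation and rotation by \<open>\<i>\<close>, so every point can be moved to
  the point \<open>2\<close> of the half-plane treated above.
\<close>

lemma entire_zero_if_two_sided_decay:
  fixes G :: "complex \<Rightarrow> complex"
  assumes hol: "G holomorphic_on UNIV" and "a > 0" "b \<ge> 0"
    and bd: "\<And>s. cmod (G s) \<le> C * exp (b * \<bar>Im s\<bar> - a * \<bar>Re s\<bar>)"
  shows "G s0 = 0"
proof -
  define c where "c = 2 + \<i> * s0"
  define H where "H = (\<lambda>z. G (\<i> * (z - c)))"
  have C0: "0 \<le> C" using order_trans[OF norm_ge_zero bd[of 0]] by simp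
  have "H 2 = 0"
  proof (rule entire_zero_if_two_sided_decay_right[where H = H and a = a and b = b and C = "C * exp (b * \<bar>Re c\<bar> + a * \<bar>Im c\<bar>)"])
    show "H holomorphic_on UNIV"
    proof -
      have "(\<lambda>z. \<i> * (z - c)) holomorphic_on UNIV" by (intro holomorphic_intros)
      then have "G \<circ> (\<lambda>z. \<i> * (z - c)) holomorphic_on UNIV"
        by (rule holomorphic_on_compose_gen[OF _ hol]) auto
      then show ?thesis by (simp add: H_def o_def)
    qed
    fix z :: complex
    have "b * \<bar>Re z - Re c\<bar> \<le> b * (\<bar>Re z\<bar> + \<bar>Re c\<bar>)"
      by (intro mult_left_mono) (use \<open>b \<ge> 0\<close> in auto)
    moreover have "a * \<bar>Im z\<bar> \<le> a * (\<bar>Im c\<bar> + \<bar>Im c - Im z\<bar>)"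
      by (intro mult_left_mono) (use \<open>a > 0\<close> in auto)
    ultimately have "b * \<bar>Re z - Re c\<bar> - a * \<bar>Im c - Im z\<bar>
        \<le> (b * \<bar>Re c\<bar> + a * \<bar>Im c\<bar>) + (b * \<bar>Re z\<bar> - a * \<bar>Im z\<bar>)"
      by (simp add: algebra_simps)
    then have "C * exp (b * \<bar>Re z - Re c\<bar> - a * \<bar>Im c - Im z\<bar>)
        \<le> C * exp ((b * \<bar>Re c\<bar> + a * \<bar>Im c\<bar>) + (b * \<bar>Re z\<bar> - a * \<bar>Im z\<bar>))"
      using C0 by (intro mult_left_mono) auto
    then show "cmod (H z) \<le> C * exp (b * \<bar>Re c\<bar> + a * \<bar>Im c\<bar>) * exp (b * \<bar>Re z\<bar> - a * \<bar>Im z\<bar>)"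
      using bd[of "\<i> * (z - c)"] by (simp add: H_def abs_minus_commute mult.assoc flip: exp_add)
  qed (use \<open>a > 0\<close> \<open>b \<ge> 0\<close> in auto)
  moreover have "\<i> * (2 - c) = s0" by (simp add: c_def algebra_simps)
  ultimately show ?thesis by (simp add: H_def)
qed

section \<open>Entire functions of several variables along complex lines\<close>

lemma norm_vector_scale_complex: "norm (c *s (w::complex^'n)) = cmod c * norm w"
  by (simp add: norm_vec_def norm_mult L2_set_right_distrib)

lemma entire_slice:
  assumes "entire f"
  shows "(\<lambda>t. f (z + t *s w)) holomorphic_on UNIV"
proof -
  have "(\<lambda>t. f (z + t *s w)) field_differentiable at t" for t
  proof -
    obtain L where L: "(f has_derivative L) (at (z + t *s w))" "\<And>c w. L (c *s w) = c * L w"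
      using assms unfolding entire_def by metis
    have bl: "bounded_linear (\<lambda>t::complex. t *s w)"
      by (rule bounded_linear_intro[where K = "norm w"])
         (simp_all add: vec_eq_iff algebra_simps norm_vector_scale_complex)
    have "((\<lambda>t. z + t *s w) has_derivative (\<lambda>t. t *s w)) (at t)"
      using has_derivative_add[OF has_derivative_const bounded_linear.has_derivative[OF bl has_derivative_ident]]
      by simp
    from has_derivative_compose[OF this, of f L] L(1)
    have "((\<lambda>t. f (z + t *s w)) has_derivative (\<lambda>t. L w * t)) (at t)"
      by (simp add: L(2) mult.commute)
    then show ?thesis
      unfolding field_differentiable_def has_field_derivative_def by blast
  qed
  then show ?thesis by (simp add: holomorphic_on_def field_differentiable_at_within)
qed

lemma entire_diff:
  assumes "entire f" "entire g" shows "entire (\<lambda>z. f z - g z)"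
  unfolding entire_def
proof
  fix z
  obtain L where L: "(f has_derivative L) (at z)" "\<And>c w. L (c *s w) = c * L w"
    using assms unfolding entire_def by metis
  obtain L' where L': "(g has_derivative L') (at z)" "\<And>c w. L' (c *s w) = c * L' w"
    using assms unfolding entire_def by metis
  show "\<exists>L. ((\<lambda>z. f z - g z) has_derivative L) (at z) \<and> (\<forall>c w. L (c *s w) = c * L w)"
    by (rule exI[of _ "\<lambda>w. L w - L' w"])
       (use has_derivative_diff[OF L(1) L'(1)] in \<open>auto simp: algebra_simps L(2) L'(2)\<close>)
qed

lemma entire_add:
  assumes "entire f" "entire g" shows "entire (\<lambda>z. f z + g z)"
  unfolding entire_def
proof
  fix z
  obtain L where L: "(f has_derivative L) (at z)" "\<And>c w. L (c *s w) = c * L w"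
    using assms unfolding entire_def by metis
  obtain L' where L': "(g has_derivative L') (at z)" "\<And>c w. L' (c *s w) = c * L' w"
    using assms unfolding entire_def by metis
  show "\<exists>L. ((\<lambda>z. f z + g z) has_derivative L) (at z) \<and> (\<forall>c w. L (c *s w) = c * L w)"
    by (rule exI[of _ "\<lambda>w. L w + L' w"])
       (use has_derivative_add[OF L(1) L'(1)] in \<open>auto simp: algebra_simps L(2) L'(2)\<close>)
qed

lemma entire_cmult:
  assumes "entire f" shows "entire (\<lambda>z. c * f z)"
  unfolding entire_def
proof
  fix z
  obtain L where L: "(f has_derivative L) (at z)" "\<And>c w. L (c *s w) = c * L w"
    using assms unfolding entire_def by metis
  show "\<exists>L. ((\<lambda>z. c * f z) has_derivative L) (at z) \<and> (\<forall>c w. L (c *s w) = c * L w)"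
    by (rule exI[of _ "\<lambda>w. c * L w"])
       (use L in \<open>auto intro!: derivative_eq_intros simp: algebra_simps\<close>)
qed

lemma entire_zero: "entire (\<lambda>z. 0)"
  unfolding entire_def by (intro allI exI[of _ "\<lambda>w. 0"]) auto

text \<open>
  Cauchy's estimate on the complex line through the two points; this is the only equicontinuity
  that is needed in several variables.
\<close>

lemma entire_lipschitz_of_local_bound:
  assumes f: "entire f" and bd: "\<And>x. norm x \<le> r + 1 \<Longrightarrow> cmod (f x) \<le> B"
    and z: "norm z \<le> r" and w: "norm (w - z) \<le> 1/2"
  shows "cmod (f w - f z) \<le> 2 * B * norm (w - z)"
proof (cases "w = z")
  case False
  define d where "d = norm (w - z)"
  define e where "e = complex_of_real (1 / d) *s (w - z)"
  have d: "d > 0" "d \<le> 1/2" using False w by (auto simp: d_def)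
  have ne: "norm e = 1" using d unfolding e_def norm_vector_scale_complex d_def[symmetric] by (simp add: norm_divide)
  have we: "z + complex_of_real d *s e = w"
    using d by (simp add: e_def vec_eq_iff)
  define \<phi> where "\<phi> = (\<lambda>t. f (z + t *s e))"
  have hol: "\<phi> holomorphic_on UNIV" unfolding \<phi>_def using f by (rule entire_slice)
  have \<phi>: "cmod (\<phi> t) \<le> B" if "cmod t \<le> 1" for t
    unfolding \<phi>_def
  proof (rule bd)
    have "norm (z + t *s e) \<le> norm z + cmod t * norm e"
      using norm_triangle_ineq[of z "t *s e"] by (simp add: norm_vector_scale_complex)
    then show "norm (z + t *s e) \<le> r + 1" using z that ne by simp
  qed
  have der: "cmod (deriv \<phi> t) \<le> 2 * B" if t: "t \<in> cball 0 (1/2)" for t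
  proof -
    have "norm ((deriv ^^ 1) \<phi> t) \<le> fact 1 * B / (1/2) ^ 1"
    proof (rule Cauchy_inequality)
      fix x assume x: "cmod (t - x) = 1/2"
      have "cmod x \<le> cmod t + cmod (t - x)" by (metis norm_minus_commute norm_triangle_sub)
      then show "cmod (\<phi> x) \<le> B" using \<phi> t x by auto
    qed (use hol in \<open>auto intro: holomorphic_on_subset holomorphic_on_imp_continuous_on\<close>)
    then show ?thesis by simp
  qed
  have "cmod (\<phi> (of_real d) - \<phi> 0) \<le> 2 * B * cmod (of_real d - 0)"
  proof (rule field_differentiable_bound[of "cball 0 (1/2)" \<phi> "deriv \<phi>"])
    show "(\<phi> has_field_derivative deriv \<phi> t) (at t within cball 0 (1/2))" for t
      using holomorphic_derivI[OF hol open_UNIV UNIV_I] has_field_derivative_at_within by blast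
  qed (use der d in auto)
  then show ?thesis using we d by (simp add: \<phi>_def d_def)
qed auto

text \<open>
  A replacement for Vitali's theorem in several variables: by equicontinuity, convergence to zero
  on finitely many points that form a fine net of a ball controls the whole ball.
\<close>

lemma entire_dense_limit_imp_uniform_limit:
  fixes X :: "nat \<Rightarrow> ('n::finite) testfun"
  assumes ent: "\<And>m. entire (X m)"
    and bdd: "\<And>r. \<exists>B. \<forall>m x. norm x \<le> r \<longrightarrow> cmod (X m x) \<le> B"
    and dense: "\<And>S. open S \<Longrightarrow> S \<noteq> {} \<Longrightarrow> \<exists>d\<in>D. d \<in> S"
    and lim: "\<And>d. d \<in> D \<Longrightarrow> (\<lambda>m. X m d) \<longlonglongrightarrow> 0"
  shows "uniform_limit (cball 0 R) X (\<lambda>_. 0) sequentially"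
proof (rule uniform_limitI)
  fix e :: real assume e: "e > 0"
  obtain B where B: "\<And>m x. norm x \<le> (R + 1) + 1 \<Longrightarrow> cmod (X m x) \<le> B" using bdd by meson
  define B' where "B' = \<bar>B\<bar> + 1"
  have B': "B' > 0" "\<And>m x. norm x \<le> (R + 1) + 1 \<Longrightarrow> cmod (X m x) \<le> B'"
    using order_trans[OF B abs_ge_self[of B, THEN order_trans, of "\<bar>B\<bar> + 1"]] by (simp_all add: B'_def)
  define \<delta> where "\<delta> = min (1/2) (e / (4 * B'))"
  have \<delta>: "\<delta> > 0" "\<delta> \<le> 1/2" "2 * B' * \<delta> \<le> e / 2"
    using e B' by (auto simp: \<delta>_def field_simps min_def)
  have "cball (0::complex^'n) R \<subseteq> (\<Union>d\<in>D \<inter> cball 0 (R + 1). ball d \<delta>)"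
  proof
    fix x :: "complex^'n" assume x: "x \<in> cball 0 R"
    obtain d where d: "d \<in> D" "d \<in> ball x \<delta>" using dense[of "ball x \<delta>"] \<delta> by auto
    have "norm d \<le> norm x + norm (d - x)" by (metis norm_triangle_sub)
    then have "d \<in> cball 0 (R + 1)" using x d \<delta> by (auto simp: dist_norm norm_minus_commute)
    then show "x \<in> (\<Union>d\<in>D \<inter> cball 0 (R + 1). ball d \<delta>)" using d by (auto simp: dist_commute)
  qed
  then obtain F where F: "F \<subseteq> D \<inter> cball 0 (R + 1)" "finite F" "cball 0 R \<subseteq> (\<Union>d\<in>F. ball d \<delta>)"
    using compactE_image[OF compact_cball, where C = "D \<inter> cball 0 (R + 1)" and f = "\<lambda>d. ball d \<delta>"]
    by (metis open_ball)
  have "\<forall>d\<in>F. \<forall>\<^sub>F m in sequentially. cmod (X m d) < e / 2"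
  proof
    fix d assume "d \<in> F"
    then have "(\<lambda>m. X m d) \<longlonglongrightarrow> 0" using F lim by blast
    from tendstoD[OF this, of "e / 2"] e show "\<forall>\<^sub>F m in sequentially. cmod (X m d) < e / 2" by simp
  qed
  then have "\<forall>\<^sub>F m in sequentially. \<forall>d\<in>F. cmod (X m d) < e / 2"
    using F(2) by (simp add: eventually_ball_finite_distrib)
  then show "\<forall>\<^sub>F m in sequentially. \<forall>x\<in>cball 0 R. dist (X m x) 0 < e"
  proof eventually_elim
    case (elim m)
    show ?case
    proof
      fix x :: "complex^'n" assume "x \<in> cball 0 R"
      then obtain d where d: "d \<in> F" "norm (x - d) < \<delta>" using F by (force simp: dist_norm norm_minus_commute)
      have "cmod (X m x - X m d) \<le> 2 * B' * norm (x - d)"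
        by (rule entire_lipschitz_of_local_bound[OF ent B'(2)]) (use d F \<delta> in auto)
      also have "\<dots> \<le> 2 * B' * \<delta>" using d B' by (intro mult_left_mono) auto
      finally have "cmod (X m x - X m d) \<le> e / 2" using \<delta> by linarith
      moreover have "cmod (X m x) \<le> cmod (X m d) + cmod (X m x - X m d)" by (metis norm_triangle_sub)
      moreover have "cmod (X m d) < e / 2" using elim d by blast
      ultimately show "dist (X m x) 0 < e" by simp
    qed
  qed
qed

section \<open>Distance to a cone\<close>

lemma cone_dist_le: "x' \<in> K \<Longrightarrow> cone_dist K x \<le> infnorm (x - x')"
  unfolding cone_dist_def by (rule cINF_lower) (auto intro!: bdd_belowI[of _ 0] simp: infnorm_pos_le)

lemma cone_dist_greatest: "K \<noteq> {} \<Longrightarrow> (\<And>x'. x' \<in> K \<Longrightarrow> c \<le> infnorm (x - x')) \<Longrightarrow> c \<le> cone_dist K x"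
  unfolding cone_dist_def by (rule cINF_greatest)

lemma cone_dist_nonneg: "K \<noteq> {} \<Longrightarrow> 0 \<le> cone_dist K x"
  by (rule cone_dist_greatest) (auto simp: infnorm_pos_le)

lemma cone_dist_antimono: "K' \<noteq> {} \<Longrightarrow> K' \<subseteq> K \<Longrightarrow> cone_dist K x \<le> cone_dist K' x"
  by (rule cone_dist_greatest) (auto intro: cone_dist_le)

lemma cone_dist_triangle: "K \<noteq> {} \<Longrightarrow> cone_dist K x \<le> infnorm (x - y) + cone_dist K y"
proof -
  assume K: "K \<noteq> {}"
  have "cone_dist K x - infnorm (x - y) \<le> cone_dist K y"
  proof (rule cone_dist_greatest[OF K])
    fix x' assume x': "x' \<in> K"
    show "cone_dist K x - infnorm (x - y) \<le> infnorm (y - x')"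
      using cone_dist_le[OF x', of x] infnorm_triangle[of "x - y" "y - x'"] by simp
  qed
  then show ?thesis by simp
qed

lemma cone_dist_scale:
  assumes K: "pos_cone K" and c: "c > 0"
  shows "cone_dist K (c *\<^sub>R x) = c * cone_dist K x"
proof -
  have ne: "K \<noteq> {}" using K by (simp add: pos_cone_def)
  have le: "cone_dist K (c *\<^sub>R x) \<le> c * cone_dist K x" if c: "c > 0" for c x
  proof -
    have "cone_dist K (c *\<^sub>R x) / c \<le> cone_dist K x"
    proof (rule cone_dist_greatest[OF ne])
      fix x' assume "x' \<in> K"
      then have "c *\<^sub>R x' \<in> K" using K c by (simp add: pos_cone_def)
      then have "cone_dist K (c *\<^sub>R x) \<le> infnorm (c *\<^sub>R x - c *\<^sub>R x')" by (rule cone_dist_le)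
      also have "\<dots> = c * infnorm (x - x')" using c by (simp add: infnorm_mul flip: scaleR_diff_right)
      finally show "cone_dist K (c *\<^sub>R x) / c \<le> infnorm (x - x')" using c by (simp add: field_simps)
    qed
    then show ?thesis using c by (simp add: field_simps)
  qed
  have "cone_dist K ((1/c) *\<^sub>R (c *\<^sub>R x)) \<le> (1/c) * cone_dist K (c *\<^sub>R x)" using c by (intro le) auto
  then have "c * cone_dist K x \<le> cone_dist K (c *\<^sub>R x)" using c by (simp add: field_simps)
  with le[OF c] show ?thesis by (meson antisym)
qed

text \<open>
  The vertex is in the closure of the cone, although it need not belong to the cone.
\<close>

lemma cone_dist_le_infnorm:
  assumes K: "pos_cone K"
  shows "cone_dist K x \<le> infnorm x"
proof -
  obtain p where p: "p \<in> K" using K by (auto simp: pos_cone_def)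
  have "cone_dist K x - infnorm x \<le> e" if e: "e > 0" for e
  proof -
    define c where "c = e / (infnorm p + 1)"
    have np: "infnorm p + 1 > 0" using infnorm_pos_le[of p] by linarith
    have c: "c > 0" using e np by (simp add: c_def)
    then have "c *\<^sub>R p \<in> K" using K p by (auto simp: pos_cone_def)
    then have "cone_dist K x \<le> infnorm (x - c *\<^sub>R p)" by (rule cone_dist_le)
    also have "\<dots> \<le> infnorm x + c * infnorm p"
      using infnorm_triangle[of x "- (c *\<^sub>R p)"] c by (simp add: infnorm_neg infnorm_mul)
    also have "c * infnorm p \<le> c * (infnorm p + 1)" using c by simp
    also have "c * (infnorm p + 1) = e" using np by (simp add: c_def)
    finally show ?thesis by simp
  qed
  then have "cone_dist K x - infnorm x \<le> 0" by (rule field_le_epsilon[of _ 0, simplified])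
  then show ?thesis by simp
qed

section \<open>Real and imaginary parts\<close>

definition complex_vec :: "real^'n \<Rightarrow> complex^'n" where
  "complex_vec v = (\<chi> j. complex_of_real (v $ j))"

lemma Re_vec_line: "Re_vec (z + s *s complex_vec v) = Re_vec z + Re s *\<^sub>R v"
  and Im_vec_line: "Im_vec (z + s *s complex_vec v) = Im_vec z + Im s *\<^sub>R v"
  by (simp_all add: Re_vec_def Im_vec_def complex_vec_def vec_eq_iff)

lemma infnorm_Re_vec_le: "infnorm (Re_vec z) \<le> norm z"
  and infnorm_Im_vec_le: "infnorm (Im_vec z) \<le> norm z"
  by (rule order_trans[OF infnorm_le_norm],
      auto simp: norm_vec_def Re_vec_def Im_vec_def abs_Re_le_cmod abs_Im_le_cmod intro!: L2_set_mono)+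

lemma norm_le_infnorm_Re_Im:
  "norm (z::complex^'n) \<le> sqrt CARD('n) * (infnorm (Re_vec z) + infnorm (Im_vec z))"
proof -
  have "norm z \<le> norm (Re_vec z) + norm (Im_vec z)"
    unfolding norm_vec_def
    by (rule order_trans[OF L2_set_mono L2_set_triangle_ineq])
       (auto simp: Re_vec_def Im_vec_def cmod_le)
  moreover have "norm (Re_vec z) \<le> sqrt CARD('n) * infnorm (Re_vec z)"
    "norm (Im_vec z) \<le> sqrt CARD('n) * infnorm (Im_vec z)"
    using norm_le_infnorm[of "Re_vec z"] norm_le_infnorm[of "Im_vec z"] by auto
  ultimately show ?thesis by (simp add: algebra_simps)
qed

section \<open>Balls of test functions\<close>

text \<open>
  The weights of the test spaces involve conic neighbourhoods \<open>W\<close> of \<open>K\<close>. Up to a change of the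
  constants they can be replaced by the family below, which involves only \<open>K\<close> itself and one
  parameter; a larger \<open>r\<close> means a weaker requirement.
\<close>

definition decay :: "real \<Rightarrow> (real^'n) set \<Rightarrow> complex^'n \<Rightarrow> real" where
  "decay r K z = infnorm (Re_vec z) / r - r * cone_dist K (Re_vec z) - r * infnorm (Im_vec z)"

definition decay_ball :: "real \<Rightarrow> (real^'n) set \<Rightarrow> ('n::finite) testfun set" where
  "decay_ball r K = {f. entire f \<and> (\<forall>z. cmod (f z) \<le> exp (- decay r K z))}"

lemma decay_antimono:
  assumes "K \<noteq> {}" "0 < r" "r \<le> r'"
  shows "decay r' K z \<le> decay r K z"
proof -
  have "infnorm (Re_vec z) / r' \<le> infnorm (Re_vec z) / r"
    using assms by (intro divide_left_mono) (auto simp: infnorm_pos_le)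
  moreover have "r * cone_dist K (Re_vec z) \<le> r' * cone_dist K (Re_vec z)"
    using assms by (intro mult_right_mono cone_dist_nonneg) auto
  moreover have "r * infnorm (Im_vec z) \<le> r' * infnorm (Im_vec z)"
    using assms by (intro mult_right_mono infnorm_pos_le) auto
  ultimately show ?thesis by (simp add: decay_def)
qed

lemma decay_ball_mono:
  assumes "K \<noteq> {}" "0 < r" "r \<le> r'"
  shows "decay_ball r K \<subseteq> decay_ball r' K"
proof
  fix f assume f: "f \<in> decay_ball r K"
  have "cmod (f z) \<le> exp (- decay r' K z)" for z
    using f decay_antimono[OF assms, of z] unfolding decay_ball_def
    by (smt (verit, best) exp_le_cancel_iff mem_Collect_eq)
  then show "f \<in> decay_ball r' K" using f by (simp add: decay_ball_def)
qed

lemma decay_mono_cone: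
  assumes "K' \<noteq> {}" "K' \<subseteq> K" "0 < r"
  shows "decay r K' z \<le> decay r K z"
  using mult_left_mono[OF cone_dist_antimono[OF assms(1,2), of "Re_vec z"], of r] assms(3)
  by (simp add: decay_def)

lemma neg_decay_le:
  assumes K: "pos_cone K" and "0 < r" and z: "norm z \<le> R"
  shows "- decay r K z \<le> 2 * r * R"
proof -
  have "cone_dist K (Re_vec z) \<le> R" "infnorm (Im_vec z) \<le> R"
    using cone_dist_le_infnorm[OF K, of "Re_vec z"] infnorm_Re_vec_le[of z] infnorm_Im_vec_le[of z] z
    by linarith+
  then have "r * cone_dist K (Re_vec z) \<le> r * R" "r * infnorm (Im_vec z) \<le> r * R"
    using \<open>0 < r\<close> by (auto intro: mult_left_mono)
  moreover have "0 \<le> infnorm (Re_vec z) / r" using \<open>0 < r\<close> by (simp add: infnorm_pos_le)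
  ultimately show ?thesis by (simp add: decay_def)
qed

lemma decay_ball_locally_bounded:
  assumes "pos_cone K" and "0 < r" and "f \<in> decay_ball r K" and "norm z \<le> R"
  shows "cmod (f z) \<le> exp (2 * r * R)"
  using assms(3) neg_decay_le[OF assms(1,2,4)] unfolding decay_ball_def
  by (smt (verit, best) exp_le_cancel_iff mem_Collect_eq)

lemma decay_ball_bound_on_half_line:
  assumes ray: "\<And>t. 0 \<le> t \<Longrightarrow> t *\<^sub>R v \<in> K" and r: "0 < r" and f: "f \<in> decay_ball r K"
    and s: "0 \<le> Re s"
  shows "cmod (f (z + s *s complex_vec v)) \<le>
    exp (r * (infnorm (Re_vec z) + infnorm (Im_vec z)) + infnorm (Re_vec z) / r) *
    exp (r * infnorm v * \<bar>Im s\<bar> - infnorm v / r * \<bar>Re s\<bar>)"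
proof -
  let ?x = "Re_vec z" and ?y = "Im_vec z"
  have "cone_dist K (?x + Re s *\<^sub>R v) \<le> infnorm ?x"
    using cone_dist_le[OF ray[OF s], of "?x + Re s *\<^sub>R v"] by simp
  then have 1: "r * cone_dist K (?x + Re s *\<^sub>R v) \<le> r * infnorm ?x" using r by simp
  have "infnorm (?y + Im s *\<^sub>R v) \<le> infnorm ?y + \<bar>Im s\<bar> * infnorm v"
    using infnorm_triangle[of ?y "Im s *\<^sub>R v"] by (simp add: infnorm_mul)
  then have 2: "r * infnorm (?y + Im s *\<^sub>R v) \<le> r * (infnorm ?y + \<bar>Im s\<bar> * infnorm v)" using r by simp
  have "\<bar>Re s\<bar> * infnorm v \<le> infnorm (?x + Re s *\<^sub>R v) + infnorm ?x"
    using infnorm_triangle[of "?x + Re s *\<^sub>R v" "- ?x"] by (simp add: infnorm_mul infnorm_neg)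
  then have 3: "\<bar>Re s\<bar> * infnorm v / r \<le> (infnorm (?x + Re s *\<^sub>R v) + infnorm ?x) / r"
    using r by (simp add: divide_right_mono)
  have "- decay r K (z + s *s complex_vec v) \<le>
      (r * (infnorm ?x + infnorm ?y) + infnorm ?x / r) + (r * infnorm v * \<bar>Im s\<bar> - infnorm v / r * \<bar>Re s\<bar>)"
    using 1 2 3 by (simp add: decay_def Re_vec_line Im_vec_line algebra_simps add_divide_distrib)
  then show ?thesis
    using f unfolding decay_ball_def exp_add[symmetric]
    by (smt (verit, best) exp_le_cancel_iff mem_Collect_eq)
qed

text \<open>
  Along a complex line parallel to \<open>v\<close>, Montel's theorem gives a common limit of subsequences of
  \<open>g\<close> and \<open>h\<close>. It inherits the decay to the right from \<open>g\<close> and the decay to the left from \<open>h\<close>, and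
  is therefore zero.
\<close>

lemma opposite_rays_limit_zero:
  fixes g h :: "nat \<Rightarrow> ('n::finite) testfun"
  assumes K: "pos_cone K1" and v: "v \<noteq> 0" and r: "0 < r"
    and ray1: "\<And>t. 0 \<le> t \<Longrightarrow> t *\<^sub>R v \<in> K1" and ray2: "\<And>t. 0 \<le> t \<Longrightarrow> t *\<^sub>R (- v) \<in> K2"
    and g: "\<And>m. g m \<in> decay_ball r K1" and h: "\<And>m. h m \<in> decay_ball r K2"
    and diff: "\<And>z. (\<lambda>m. g m z - h m z) \<longlonglongrightarrow> 0"
  shows "(\<lambda>m. g m z) \<longlonglongrightarrow> 0"
proof (rule ccontr)
  assume "\<not> ?thesis"
  then obtain e where e: "e > 0" "\<not> (\<forall>\<^sub>F m in sequentially. cmod (g m z) < e)"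
    by (auto simp: tendsto_iff)
  then have "infinite {m. e \<le> cmod (g m z)}"
    by (simp add: not_eventually not_less frequently_cofinite flip: cofinite_eq_sequentially)
  then obtain q :: "nat \<Rightarrow> nat" where q: "strict_mono q" "\<And>m. e \<le> cmod (g (q m) z)"
    using infinite_enumerate by (metis (lifting) mem_Collect_eq)
  define F where "F = (\<lambda>m s. g (q m) (z + s *s complex_vec v))"
  define a where "a = infnorm v / r"
  define b where "b = r * infnorm v"
  define C where "C = exp (r * (infnorm (Re_vec z) + infnorm (Im_vec z)) + infnorm (Re_vec z) / r)"
  have ent: "entire (g m)" for m using g by (auto simp: decay_ball_def)
  obtain G p where G: "G holomorphic_on UNIV" and p: "strict_mono (p :: nat \<Rightarrow> nat)"
    and lim: "\<And>s. ((\<lambda>m. F (p m) s) \<longlongrightarrow> G s) sequentially"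
  proof (rule Montel[of UNIV "range F" F])
    show "h holomorphic_on UNIV" if "h \<in> range F" for h
      using that entire_slice[OF ent] by (auto simp: F_def)
    show "\<exists>B. \<forall>h\<in>range F. \<forall>s\<in>S. cmod (h s) \<le> B" if S: "compact S" for S
    proof -
      obtain R where R: "\<And>s. s \<in> S \<Longrightarrow> cmod s \<le> R"
        using compact_imp_bounded[OF S] bounded_iff by blast
      have "cmod (F m s) \<le> exp (2 * r * (norm z + R * norm (complex_vec v)))" if "s \<in> S" for m s
        unfolding F_def
      proof (rule decay_ball_locally_bounded[OF K r g])
        show "norm (z + s *s complex_vec v) \<le> norm z + R * norm (complex_vec v)"
          using norm_triangle_ineq[of z "s *s complex_vec v"]
            mult_right_mono[OF R[OF that] norm_ge_zero[of "complex_vec v"]]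
          by (simp add: norm_vector_scale_complex)
      qed
      then show ?thesis by blast
    qed
  qed auto
  have limg: "(\<lambda>m. g (q (p m)) (z + s *s complex_vec v)) \<longlonglongrightarrow> G s" for s
    using lim by (simp add: F_def)
  have limh: "(\<lambda>m. h (q (p m)) (z + s *s complex_vec v)) \<longlonglongrightarrow> G s" for s
  proof -
    have "(\<lambda>m. g (q (p m)) (z + s *s complex_vec v) - h (q (p m)) (z + s *s complex_vec v)) \<longlonglongrightarrow> 0"
      using LIMSEQ_subseq_LIMSEQ[OF diff strict_mono_o[OF q(1) p]] by (simp add: o_def)
    from tendsto_diff[OF limg[of s] this] show ?thesis by simp
  qed
  have "G 0 = 0"
  proof (rule entire_zero_if_two_sided_decay[OF G])
    show "a > 0" "b \<ge> 0" using r v by (auto simp: a_def b_def infnorm_pos_lt infnorm_pos_le)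
    fix s :: complex
    show "cmod (G s) \<le> C * exp (b * \<bar>Im s\<bar> - a * \<bar>Re s\<bar>)"
    proof (cases "0 \<le> Re s")
      case True
      have "cmod (g (q (p m)) (z + s *s complex_vec v)) \<le> C * exp (b * \<bar>Im s\<bar> - a * \<bar>Re s\<bar>)" for m
        unfolding C_def a_def b_def by (rule decay_ball_bound_on_half_line[OF ray1 r g True])
      then show ?thesis
        by (intro LIMSEQ_le_const2[OF tendsto_norm[OF limg]]) auto
    next
      case False
      have eq: "z + s *s complex_vec v = z + (- s) *s complex_vec (- v)"
        by (simp add: complex_vec_def vec_eq_iff)
      have "cmod (h (q (p m)) (z + s *s complex_vec v)) \<le> C * exp (b * \<bar>Im s\<bar> - a * \<bar>Re s\<bar>)" for m
        using decay_ball_bound_on_half_line[OF ray2 r h, of "- s" "q (p m)" z] False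
        unfolding eq by (simp add: C_def a_def b_def infnorm_neg)
      then show ?thesis
        by (intro LIMSEQ_le_const2[OF tendsto_norm[OF limh]]) auto
    qed
  qed
  moreover have "e \<le> cmod (G 0)"
    by (intro LIMSEQ_le_const[OF tendsto_norm[OF limg[of 0]]]) (use q in auto)
  ultimately show False using e by simp
qed

section \<open>Continuous seminorms for a finest locally convex topology\<close>

lemma convex_combination_eq:
  "cscale (of_real (1 - t)) f + cscale (of_real t) g = (\<lambda>x. f x + of_real t * (g x - f x))"
  by (auto simp: cscale_def fun_eq_iff algebra_simps)

text \<open>
  A seminorm whose composition with each \<open>h i\<close> is continuous defines by itself a locally convex
  topology that makes all \<open>h i\<close> continuous, so its balls are open in the finest such topology.
\<close>

lemma finest_lc_seminorm_ball_open:
  fixes p :: "('x \<Rightarrow> complex) \<Rightarrow> real"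
  assumes V: "cfun.subspace V" and h: "\<And>i. i \<in> I \<Longrightarrow> h i \<in> topspace (X i) \<rightarrow> V"
    and add: "\<And>f g. f \<in> V \<Longrightarrow> g \<in> V \<Longrightarrow> p (f + g) \<le> p f + p g"
    and scale: "\<And>c f. f \<in> V \<Longrightarrow> p (cscale c f) = cmod c * p f"
    and cont: "\<And>i x e. i \<in> I \<Longrightarrow> x \<in> topspace (X i) \<Longrightarrow> e > 0 \<Longrightarrow>
      \<exists>N. openin (X i) N \<and> x \<in> N \<and> (\<forall>y\<in>N. p (h i y - h i x) < e)"
    and f0: "f0 \<in> V"
  shows "openin (finest_lc V I X h) {f \<in> V. p (f - f0) < e}"
proof -
  let ?P = "\<lambda>G. G \<subseteq> V \<and> (\<forall>f\<in>G. \<exists>e>0. {g \<in> V. p (g - f) < e} \<subseteq> G)"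
  have V': "f \<in> V \<Longrightarrow> g \<in> V \<Longrightarrow> f + g \<in> V" "f \<in> V \<Longrightarrow> g \<in> V \<Longrightarrow> f - g \<in> V"
    "f \<in> V \<Longrightarrow> cscale c f \<in> V" for f g c
    using V by (auto intro: cfun.subspace_add cfun.subspace_diff cfun.subspace_scale)
  have p0: "p 0 = 0"
    using scale[OF cfun.subspace_0[OF V], of 0] by simp
  have minus: "p (f - g) = p (g - f)" if "f \<in> V" "g \<in> V" for f g
  proof -
    have "f - g = cscale (-1) (g - f)" by (auto simp: cscale_def fun_eq_iff)
    then show ?thesis using scale[of "g - f" "-1"] V' that by simp
  qed
  have pos: "0 \<le> p f" if "f \<in> V" for f
    using add[of f "- f"] minus[of f 0] p0 that V V'(2)[of 0 f] cfun.subspace_0[OF V] by simp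
  define T where "T = topology ?P"
  have "istopology ?P"
    unfolding istopology_def
  proof (intro conjI allI impI)
    fix S S' assume S: "?P S" and S': "?P S'"
    show "S \<inter> S' \<subseteq> V" using S by auto
    show "\<forall>f\<in>S \<inter> S'. \<exists>e>0. {g \<in> V. p (g - f) < e} \<subseteq> S \<inter> S'"
    proof
      fix f assume "f \<in> S \<inter> S'"
      then obtain e e' where "e > 0" "{g \<in> V. p (g - f) < e} \<subseteq> S" "e' > 0" "{g \<in> V. p (g - f) < e'} \<subseteq> S'"
        using S S' by blast
      then show "\<exists>e>0. {g \<in> V. p (g - f) < e} \<subseteq> S \<inter> S'"
        by (intro exI[of _ "min e e'"]) auto
    qed
  next
    fix \<K> assume "\<forall>K\<in>\<K>. ?P K"
    then show "\<Union>\<K> \<subseteq> V" "\<forall>f\<in>\<Union>\<K>. \<exists>e>0. {g \<in> V. p (g - f) < e} \<subseteq> \<Union>\<K>"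
      by (blast, meson UnionE Union_upper subset_trans)
  qed
  then have op: "openin T G \<longleftrightarrow> ?P G" for G by (simp add: T_def)
  have ball: "openin T {f \<in> V. p (f - f0) < e}" if f0: "f0 \<in> V" for f0 e
    unfolding op
  proof (intro conjI ballI)
    fix f assume f: "f \<in> {f \<in> V. p (f - f0) < e}"
    show "\<exists>e'>0. {g \<in> V. p (g - f) < e'} \<subseteq> {f \<in> V. p (f - f0) < e}"
    proof (intro exI conjI subsetI)
      show "e - p (f - f0) > 0" using f by simp
      fix g assume g: "g \<in> {g \<in> V. p (g - f) < e - p (f - f0)}"
      have "p ((g - f) + (f - f0)) \<le> p (g - f) + p (f - f0)"
        using f g f0 by (intro add V') auto
      then show "g \<in> {f \<in> V. p (f - f0) < e}" using g by simp
    qed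
  qed auto
  have top: "topspace T = V"
  proof
    show "topspace T \<subseteq> V" using openin_topspace[of T] unfolding op by blast
    have "openin T V" unfolding op by (auto intro: exI[of _ 1])
    then show "V \<subseteq> topspace T" by (rule openin_subset)
  qed
  have basic: "\<exists>e>0. {g \<in> V. p (g - f) < e} \<subseteq> G" if "openin T G" "f \<in> G" for f G
    using that unfolding op by blast
  have "lc_topology T"
    unfolding lc_topology_def
  proof (intro conjI allI impI)
    show "cfun.subspace (topspace T)" using V by (simp add: top)
    show "continuous_map (prod_topology T T) T (\<lambda>(f, g). f + g)"
      unfolding continuous_map_def
    proof (intro conjI allI impI)
      show "(\<lambda>(f, g). f + g) \<in> topspace (prod_topology T T) \<rightarrow> topspace T"
        using V' by (auto simp: top)
      fix G assume G: "openin T G"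
      show "openin (prod_topology T T) {x \<in> topspace (prod_topology T T). (case x of (f, g) \<Rightarrow> f + g) \<in> G}"
        unfolding openin_prod_topology_alt
      proof (intro allI impI)
        fix f g assume "(f, g) \<in> {x \<in> topspace (prod_topology T T). (case x of (f, g) \<Rightarrow> f + g) \<in> G}"
        then have fg: "f \<in> V" "g \<in> V" "f + g \<in> G" by (auto simp: top)
        obtain e where e: "e > 0" "{k \<in> V. p (k - (f + g)) < e} \<subseteq> G" using basic[OF G fg(3)] by blast
        show "\<exists>U W. openin T U \<and> openin T W \<and> f \<in> U \<and> g \<in> W \<and>
            U \<times> W \<subseteq> {x \<in> topspace (prod_topology T T). (case x of (f, g) \<Rightarrow> f + g) \<in> G}"
        proof (intro exI conjI subsetI)
          show "openin T {k \<in> V. p (k - f) < e / 2}" "openin T {k \<in> V. p (k - g) < e / 2}"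
            using fg by (blast intro: ball)+
          show "f \<in> {k \<in> V. p (k - f) < e / 2}" "g \<in> {k \<in> V. p (k - g) < e / 2}"
            using fg e p0 by auto
          fix x assume "x \<in> {k \<in> V. p (k - f) < e / 2} \<times> {k \<in> V. p (k - g) < e / 2}"
          then obtain f' g' where x: "x = (f', g')" "f' \<in> V" "g' \<in> V" "p (f' - f) < e / 2" "p (g' - g) < e / 2"
            by auto
          have "p ((f' - f) + (g' - g)) < e" using add[of "f' - f" "g' - g"] x fg V' by auto
          moreover have "(f' - f) + (g' - g) = f' + g' - (f + g)" by simp
          ultimately have "f' + g' \<in> G" using e x V' by auto
          then show "x \<in> {x \<in> topspace (prod_topology T T). (case x of (f, g) \<Rightarrow> f + g) \<in> G}"
            using x by (auto simp: top)
        qed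
      qed
    qed
    show "continuous_map (prod_topology euclidean T) T (\<lambda>(c, f). cscale c f)"
      unfolding continuous_map_def
    proof (intro conjI allI impI)
      show "(\<lambda>(c, f). cscale c f) \<in> topspace (prod_topology euclidean T) \<rightarrow> topspace T"
        using V' by (auto simp: top)
      fix G assume G: "openin T G"
      show "openin (prod_topology euclidean T)
          {x \<in> topspace (prod_topology euclidean T). (case x of (c, f) \<Rightarrow> cscale c f) \<in> G}"
        unfolding openin_prod_topology_alt
      proof (intro allI impI)
        fix c f assume "(c, f) \<in> {x \<in> topspace (prod_topology euclidean T). (case x of (c, f) \<Rightarrow> cscale c f) \<in> G}"
        then have cf: "f \<in> V" "cscale c f \<in> G" by (auto simp: top)
        obtain e where e: "e > 0" "{k \<in> V. p (k - cscale c f) < e} \<subseteq> G" using basic[OF G cf(2)] by blast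
        define \<delta> where "\<delta> = min 1 (e / (cmod c + 2 + p f))"
        have den: "cmod c + 2 + p f > 0" using pos[OF cf(1)] norm_ge_zero[of c] by linarith
        have \<delta>: "\<delta> > 0" "\<delta> \<le> 1" using e den by (auto simp: \<delta>_def)
        have "\<delta> \<le> e / (cmod c + 2 + p f)" by (simp add: \<delta>_def)
        then have "\<delta> * (cmod c + 2 + p f) \<le> e" using den by (simp only: pos_le_divide_eq)
        then have \<delta>e: "(cmod c + 1) * \<delta> + \<delta> * p f < e" using \<delta> by (simp add: algebra_simps)
        show "\<exists>U W. openin euclidean U \<and> openin T W \<and> c \<in> U \<and> f \<in> W \<and>
            U \<times> W \<subseteq> {x \<in> topspace (prod_topology euclidean T). (case x of (c, f) \<Rightarrow> cscale c f) \<in> G}"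
        proof (intro exI conjI subsetI)
          show "openin euclidean (ball c \<delta>)" by simp
          show "openin T {k \<in> V. p (k - f) < \<delta>}" using cf ball by auto
          show "c \<in> ball c \<delta>" "f \<in> {k \<in> V. p (k - f) < \<delta>}" using cf \<delta> p0 by auto
          fix x assume "x \<in> ball c \<delta> \<times> {k \<in> V. p (k - f) < \<delta>}"
          then obtain c' f' where x: "x = (c', f')" "f' \<in> V" "p (f' - f) < \<delta>" "cmod (c' - c) < \<delta>"
            by (auto simp: dist_norm norm_minus_commute)
          have "cmod c' \<le> cmod c + cmod (c' - c)" by (metis norm_triangle_sub)
          then have c': "cmod c' \<le> cmod c + 1" using x \<delta> by linarith
          have "cscale c' f' - cscale c f = cscale c' (f' - f) + cscale (c' - c) f"
            by (auto simp: cscale_def fun_eq_iff algebra_simps)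
          then have "p (cscale c' f' - cscale c f) \<le> cmod c' * p (f' - f) + cmod (c' - c) * p f"
            using add[of "cscale c' (f' - f)" "cscale (c' - c) f"] scale V' x cf by simp
          also have "\<dots> \<le> (cmod c + 1) * \<delta> + \<delta> * p f"
            using c' x pos cf V' \<delta> by (intro add_mono mult_mono) auto
          also have "\<dots> < e" by (rule \<delta>e)
          finally have "cscale c' f' \<in> G" using e x V' by auto
          then show "x \<in> {x \<in> topspace (prod_topology euclidean T). (case x of (c, f) \<Rightarrow> cscale c f) \<in> G}"
            using x by (auto simp: top)
        qed
      qed
    qed
    fix N assume N: "openin T N \<and> 0 \<in> N"
    then obtain e where e: "e > 0" "{g \<in> V. p (g - 0) < e} \<subseteq> N" using basic by blast
    show "\<exists>C. openin T C \<and> 0 \<in> C \<and> C \<subseteq> N \<and> convex_fun_set C"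
    proof (intro exI conjI)
      show "openin T {g \<in> V. p (g - 0) < e}" by (rule ball[OF cfun.subspace_0[OF V]])
      show "{g \<in> V. p (g - 0) < e} \<subseteq> N" by (rule e)
      show "0 \<in> {g \<in> V. p (g - 0) < e}" using e p0 cfun.subspace_0[OF V] by auto
      show "convex_fun_set {g \<in> V. p (g - 0) < e}"
        unfolding convex_fun_set_def
      proof (intro ballI allI impI)
        fix f g and t :: real
        assume f: "f \<in> {g \<in> V. p (g - 0) < e}" and g: "g \<in> {g \<in> V. p (g - 0) < e}" and t: "0 \<le> t \<and> t \<le> 1"
        have "p (cscale (of_real (1 - t)) f + cscale (of_real t) g) \<le> (1 - t) * p f + t * p g"
          using add[of "cscale (of_real (1 - t)) f" "cscale (of_real t) g"]
            scale[of f "of_real (1 - t)"] scale[of g "of_real t"] f g t V'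
          by (simp add: norm_of_real del: of_real_diff)
        also have "\<dots> < e"
          using convex_bound_lt[of "p f" e "p g" "1 - t" t] f g t by simp
        finally show "cscale (of_real (1 - t)) f + cscale (of_real t) g \<in> {g \<in> V. p (g - 0) < e}"
          using f g V' by simp
      qed
    qed
  qed
  moreover have "continuous_map (X i) T (h i)" if i: "i \<in> I" for i
    unfolding continuous_map_def
  proof (intro conjI allI impI)
    show "h i \<in> topspace (X i) \<rightarrow> topspace T" using h[OF i] by (simp add: top)
    fix G assume G: "openin T G"
    show "openin (X i) {x \<in> topspace (X i). h i x \<in> G}"
    proof (subst openin_subopen, intro ballI)
      fix x assume x: "x \<in> {x \<in> topspace (X i). h i x \<in> G}"
      obtain e where e: "e > 0" "{g \<in> V. p (g - h i x) < e} \<subseteq> G" using basic[OF G] x by blast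
      obtain N where N: "openin (X i) N" "x \<in> N" "\<forall>y\<in>N. p (h i y - h i x) < e"
        using cont[OF i, of x e] x e by blast
      then have "N \<subseteq> {x \<in> topspace (X i). h i x \<in> G}"
        using openin_subset[OF N(1)] h[OF i] e by blast
      then show "\<exists>N. openin (X i) N \<and> x \<in> N \<and> N \<subseteq> {x \<in> topspace (X i). h i x \<in> G}" using N by blast
    qed
  qed
  ultimately have "lc_compatible V I X h T" by (simp add: lc_compatible_def top)
  then show ?thesis using ball[OF f0] by (rule finest_lc_finer)
qed

section \<open>Separation in finite dimension\<close>

text \<open>
  Finite-dimensional separation. The hypothesis says that the absolutely convex set \<open>Y\<close> stays away
  from the point \<open>t\<close> with coordinate \<open>e'\<close> at \<open>i0\<close> and \<open>0\<close> elsewhere. An almost nearest point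
  \<open>x\<close> of \<open>Y\<close> yields a functional, the inner product with \<open>t - x\<close>, that separates \<open>t\<close> from \<open>Y\<close>;
  its coefficients, normalised at \<open>i0\<close>, give the combination. The dimension is the cardinality
  of a finite index set and not a type, because it depends on a finite set of points that is
  obtained only in the course of the proof.
\<close>

lemma approximate_combination:
  fixes Y :: "('i \<Rightarrow> complex) set"
  assumes I: "finite I" "i0 \<notin> I"
    and conv: "convex_fun_set Y" and bal: "\<And>c y. y \<in> Y \<Longrightarrow> cmod c = 1 \<Longrightarrow> cscale c y \<in> Y" and "0 \<in> Y"
    and bdd: "\<And>y i. y \<in> Y \<Longrightarrow> i \<in> insert i0 I \<Longrightarrow> cmod (y i) \<le> M"
    and small: "\<And>y. y \<in> Y \<Longrightarrow> (\<And>i. i \<in> I \<Longrightarrow> cmod (y i) \<le> \<eta>) \<Longrightarrow> cmod (y i0) \<le> e"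
    and "\<eta> > 0" "0 \<le> e" "e < e'"
  shows "\<exists>a. \<forall>y\<in>Y. cmod (y i0 - (\<Sum>i\<in>I. a i * y i)) \<le> e'"
proof -
  define J where "J = insert i0 I"
  have J: "finite J" using I by (simp add: J_def)
  define t where "t = (\<lambda>i. if i = i0 then complex_of_real e' else 0)"
  define ip where "ip = (\<lambda>p x :: 'i \<Rightarrow> complex. \<Sum>i\<in>J. Re (cnj (p i) * x i))"
  define N where "N = (\<lambda>x. ip (t - x) (t - x))"
  have ip_add: "ip p (x + y) = ip p x + ip p y" and ip_diff: "ip p (x - y) = ip p x - ip p y" for p x y
    by (simp_all add: ip_def algebra_simps sum.distrib sum_subtractf)
  have ip_sq: "ip x x = (\<Sum>i\<in>J. (cmod (x i))\<^sup>2)" for x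
    by (simp add: ip_def cmod_power2) (simp add: power2_eq_square)
  define \<delta> where "\<delta> = min ((e' - e)\<^sup>2) (\<eta>\<^sup>2)"
  have \<delta>0: "\<delta> > 0" using \<open>e < e'\<close> \<open>\<eta> > 0\<close> by (simp add: \<delta>_def)
  have \<delta>: "\<delta> \<le> N y" if y: "y \<in> Y" for y
  proof (cases "\<forall>i\<in>I. cmod (y i) \<le> \<eta>")
    case True
    then have "cmod (y i0) \<le> e" using small y by blast
    then have "e' - e \<le> cmod (of_real e' - y i0)"
      using norm_triangle_ineq2[of "of_real e'" "y i0"] \<open>0 \<le> e\<close> \<open>e < e'\<close> by simp
    then have "(e' - e)\<^sup>2 \<le> (cmod ((t - y) i0))\<^sup>2" using \<open>e < e'\<close> by (intro power_mono) (auto simp: t_def)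
    also have "\<dots> \<le> N y" unfolding N_def ip_sq using J by (intro member_le_sum) (auto simp: J_def)
    finally show ?thesis by (simp add: \<delta>_def)
  next
    case False
    then obtain i where i: "i \<in> I" "\<eta> < cmod (y i)" by auto
    have "i \<noteq> i0" using i I by blast
    then have "\<eta>\<^sup>2 \<le> (cmod ((t - y) i))\<^sup>2" using i \<open>\<eta> > 0\<close> by (intro power_mono) (auto simp: t_def)
    also have "\<dots> \<le> N y" unfolding N_def ip_sq using J i by (intro member_le_sum) (auto simp: J_def)
    finally show ?thesis by (simp add: \<delta>_def)
  qed
  define d where "d = (INF y\<in>Y. N y)"
  have bb: "bdd_below (N ` Y)" using \<delta> by (intro bdd_belowI[of _ \<delta>]) auto
  have d\<delta>: "\<delta> \<le> d" unfolding d_def using \<delta> \<open>0 \<in> Y\<close> by (intro cINF_greatest) auto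
  have d: "d > 0" using d\<delta> \<delta>0 by linarith
  define S where "S = real (card J) * (2 * M)\<^sup>2 + 1"
  have S: "S > 0" by (simp add: S_def add_nonneg_pos)
  \<comment> \<open>Step width towards y: the second-order term of the squared distance stays below d.\<close>
  define \<tau> where "\<tau> = min 1 (d / (2 * S))"
  have \<tau>: "0 < \<tau>" "\<tau> \<le> 1" "\<tau> * S < d" using d S by (auto simp: \<tau>_def min_def field_simps)
  have "(INF y\<in>Y. N y) < d + \<tau>\<^sup>2 * S" using \<tau> S by (simp add: d_def)
  then obtain x where x: "x \<in> Y" "N x < d + \<tau>\<^sup>2 * S"
    using cINF_less_iff[OF _ bb] \<open>0 \<in> Y\<close> by blast
  define p where "p = t - x"
  have Re: "ip p y < e' * Re (cnj (p i0))" if y: "y \<in> Y" for y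
  proof -
    have "(\<lambda>i. x i + of_real \<tau> * (y i - x i)) \<in> Y"
      using conv x y \<tau> unfolding convex_fun_set_def convex_combination_eq by auto
    then have "d \<le> N (\<lambda>i. x i + of_real \<tau> * (y i - x i))" unfolding d_def by (intro cINF_lower bb)
    also have "\<dots> = N x - 2 * \<tau> * ip p (y - x) + \<tau>\<^sup>2 * ip (y - x) (y - x)"
      unfolding N_def ip_def p_def
      by (simp add: algebra_simps power2_eq_square sum.distrib sum_subtractf sum_distrib_left)
    finally have 1: "d \<le> N x - 2 * \<tau> * ip p (y - x) + \<tau>\<^sup>2 * ip (y - x) (y - x)" .
    have "ip (y - x) (y - x) \<le> S"
    proof -
      have "cmod ((y - x) i) \<le> 2 * M" if "i \<in> J" for i
        using norm_triangle_ineq4[of "y i" "x i"] bdd[OF y] bdd[OF x(1)] that by (fastforce simp: J_def)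
      then have "ip (y - x) (y - x) \<le> (\<Sum>i\<in>J. (2 * M)\<^sup>2)"
        unfolding ip_sq by (intro sum_mono power_mono) auto
      then show ?thesis by (simp add: S_def)
    qed
    then have "\<tau>\<^sup>2 * ip (y - x) (y - x) \<le> \<tau>\<^sup>2 * S" by (intro mult_left_mono) auto
    with 1 have "2 * \<tau> * ip p (y - x) < 2 * \<tau> * (\<tau> * S)" using x by (simp add: power2_eq_square)
    then have "ip p (y - x) < d" using \<tau> by simp
    moreover have "d \<le> ip p (t - x)"
      using cINF_lower[OF bb x(1)] by (simp add: d_def N_def p_def)
    ultimately have "ip p y < ip p t" by (simp add: ip_diff)
    also have "ip p t = (\<Sum>i\<in>J. if i = i0 then e' * Re (cnj (p i0)) else 0)"
      unfolding ip_def by (intro sum.cong) (auto simp: t_def)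
    also have "\<dots> = e' * Re (cnj (p i0))" using J by (simp add: J_def)
    finally show ?thesis .
  qed
  define \<alpha> where "\<alpha> = cnj (p i0)"
  have "0 < e' * Re \<alpha>" using Re[OF \<open>0 \<in> Y\<close>] by (simp add: ip_def \<alpha>_def)
  then have \<alpha>0: "\<alpha> \<noteq> 0" by auto
  have bound: "cmod (\<Sum>i\<in>J. cnj (p i) * y i) \<le> e' * cmod \<alpha>" if y: "y \<in> Y" for y
  proof -
    define L where "L = (\<Sum>i\<in>J. cnj (p i) * y i)"
    define c where "c = (if L = 0 then 1 else cnj L / of_real (cmod L))"
    have c: "cmod c = 1" by (simp add: c_def norm_divide)
    have cL: "c * L = of_real (cmod L)"
      by (simp add: c_def complex_norm_square[symmetric] mult.commute power2_eq_square)
    have "ip p (cscale c y) = Re (\<Sum>i\<in>J. c * (cnj (p i) * y i))"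
      unfolding ip_def cscale_def Re_sum by (simp only: mult.left_commute)
    also have "\<dots> = Re (c * L)" by (simp add: L_def sum_distrib_left)
    finally have "cmod L < e' * Re \<alpha>" using Re[OF bal[OF y c]] cL by (simp add: \<alpha>_def)
    also have "\<dots> \<le> e' * cmod \<alpha>" using complex_Re_le_cmod \<open>0 \<le> e\<close> \<open>e < e'\<close> by (intro mult_left_mono) auto
    finally show ?thesis by (simp add: L_def)
  qed
  show ?thesis
  proof (intro exI ballI)
    fix y assume y: "y \<in> Y"
    have "(\<Sum>i\<in>J. cnj (p i) * y i) = \<alpha> * (y i0 - (\<Sum>i\<in>I. (- cnj (p i) / \<alpha>) * y i))"
      using I \<alpha>0 by (simp add: J_def \<alpha>_def algebra_simps sum_distrib_left sum_negf)
    then have "cmod \<alpha> * cmod (y i0 - (\<Sum>i\<in>I. (- cnj (p i) / \<alpha>) * y i)) \<le> e' * cmod \<alpha>"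
      using bound[OF y] by (simp add: norm_mult)
    then show "cmod (y i0 - (\<Sum>i\<in>I. (- cnj (p i) / \<alpha>) * y i)) \<le> e'"
      using \<alpha>0 by (simp add: mult.commute)
  qed
qed

section \<open>Comparison of weights\<close>

definition test_weight :: "real \<Rightarrow> real \<Rightarrow> (real^'n) set \<Rightarrow> complex^'n \<Rightarrow> real" where
  "test_weight A B W z =
     infnorm ((1 / A) *\<^sub>R Re_vec z) - cone_dist W (B *\<^sub>R Re_vec z) - infnorm (B *\<^sub>R Im_vec z)"

lemma test_weight_eq:
  assumes "A > 0" "B > 0" "pos_cone W"
  shows "test_weight A B W z = infnorm (Re_vec z) / A - B * cone_dist W (Re_vec z) - B * infnorm (Im_vec z)"
  using assms by (simp add: test_weight_def infnorm_mul cone_dist_scale)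

lemma continuous_on_cone_dist:
  assumes "K \<noteq> {}"
  shows "continuous_on S (cone_dist K)"
proof (rule lipschitz_on_continuous_on)
  show "1-lipschitz_on S (cone_dist K)"
  proof (rule lipschitz_onI)
    fix x y :: "real^'a"
    have "infnorm (x - y) \<le> norm (x - y)" by (rule infnorm_le_norm)
    then show "dist (cone_dist K x) (cone_dist K y) \<le> 1 * dist x y"
      using cone_dist_triangle[OF assms, of x y] cone_dist_triangle[OF assms, of y x]
      by (simp add: dist_real_def dist_norm infnorm_sub[of y x])
  qed simp
qed

lemma cone_dist_pos:
  fixes K :: "(real^'n) set"
  assumes "closed K" "K \<noteq> {}" "x \<notin> K"
  shows "cone_dist K x > 0"
proof -
  have "0 < infdist x K" using infdist_pos_not_in_closed assms by blast
  also have "infdist x K / sqrt CARD('n) \<le> cone_dist K x"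
  proof (rule cone_dist_greatest)
    fix x' assume "x' \<in> K"
    then have "infdist x K \<le> norm (x - x')" using infdist_le dist_norm by metis
    also have "\<dots> \<le> sqrt CARD('n) * infnorm (x - x')" using norm_le_infnorm[of "x - x'"] by simp
    finally show "infdist x K / sqrt CARD('n) \<le> infnorm (x - x')"
      by (simp add: field_simps)
  qed (use assms in auto)
  finally show ?thesis by (simp add: divide_less_eq)
qed

text \<open>
  Compactness of the part of the sphere that the open projection of \<open>W\<close> leaves out.
\<close>

lemma cone_dist_coercive_off_conic_nbhd:
  fixes K :: "(real^'n) set"
  assumes K: "closed K" "pos_cone K" and W: "conic_nbhd W K"
  shows "\<exists>c>0. \<forall>x. x \<notin> W \<longrightarrow> c * infnorm x \<le> cone_dist K x"
proof -
  let ?S = "sphere 0 1 - sgn ` (W - {0})"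
  have ne: "K \<noteq> {}" using K by (simp add: pos_cone_def)
  have op: "openin (top_of_set (sphere 0 1)) (sgn ` (W - {0}))"
    using W by (simp add: conic_nbhd_def open_projection_def)
  then have "closedin (top_of_set (sphere 0 1)) ?S"
    by (metis closedin_def openin_diff closedin_topspace topspace_euclidean_subtopology closedin_diff)
  then have comp: "compact ?S" using closedin_compact compact_sphere by blast
  have sgnW: "sgn x \<in> ?S" if "x \<notin> W" "x \<noteq> 0" for x
  proof -
    have "x \<in> W" if y: "y \<in> W" "y \<noteq> 0" "sgn x = sgn y" for y
    proof -
      obtain c where "c > 0" "x = c *\<^sub>R y" using sgn_eq_iff_same_ray[of y x] y \<open>x \<noteq> 0\<close> by auto
      then show ?thesis using W y by (simp add: conic_nbhd_def pos_cone_def)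
    qed
    then show ?thesis using that by (auto simp: norm_sgn)
  qed
  have posS: "0 < cone_dist K x" if "x \<in> ?S" for x
  proof (rule cone_dist_pos[OF K(1) ne])
    have "sgn x = x" "x \<noteq> 0" using that by (auto simp: sgn_div_norm)
    moreover have "K \<subseteq> W" using W by (simp add: conic_nbhd_def)
    ultimately show "x \<notin> K" using that by (force simp: image_iff)
  qed
  obtain c where c: "c > 0" "\<And>x. x \<in> ?S \<Longrightarrow> c \<le> cone_dist K x"
  proof (cases "?S = {}")
    case False
    then obtain x where "x \<in> ?S" "\<And>y. y \<in> ?S \<Longrightarrow> cone_dist K x \<le> cone_dist K y"
      using continuous_attains_inf[OF comp _ continuous_on_cone_dist[OF ne]] by metis
    then show ?thesis using that[of "cone_dist K x"] posS by blast
  next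
    case True
    show ?thesis using that[of 1] True by (metis empty_iff zero_less_one)
  qed
  have "c * infnorm x \<le> cone_dist K x" if x: "x \<notin> W" for x
  proof (cases "x = 0")
    case True
    then show ?thesis using cone_dist_nonneg[OF ne] by (simp add: infnorm_0)
  next
    case False
    have "c * infnorm x \<le> c * norm x" using c infnorm_le_norm by (intro mult_left_mono) auto
    also have "\<dots> \<le> cone_dist K (sgn x) * norm x" using c sgnW[OF x False] by (intro mult_right_mono) auto
    also have "\<dots> = cone_dist K (norm x *\<^sub>R sgn x)"
      using cone_dist_scale[OF K(2)] False by simp
    finally show ?thesis using False by (simp add: sgn_div_norm)
  qed
  with c show ?thesis by blast
qed

text \<open>
  Inside \<open>W\<close> the distance to \<open>W\<close> vanishes, and outside it the distance to \<open>K\<close> is comparable to the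
  norm.
\<close>

lemma decay_le_test_weight:
  assumes K: "closed K" "pos_cone K" and i: "(A, B, W) \<in> S_index K"
  shows "\<exists>r>0. \<forall>z. decay r K z \<le> test_weight A B W z"
proof -
  have AB: "A > 0" "B > 0" and W: "conic_nbhd W K" "pos_cone W"
    using i by (auto simp: S_index_def conic_nbhd_def)
  obtain c where c: "c > 0" "\<And>x. x \<notin> W \<Longrightarrow> c * infnorm x \<le> cone_dist K x"
    using cone_dist_coercive_off_conic_nbhd[OF K W(1)] by blast
  define r where "r = max A (max B (B / c))"
  have r: "r > 0" "A \<le> r" "B \<le> r" "B / c \<le> r" using AB by (auto simp: r_def)
  then have rc: "B \<le> r * c" using c by (simp add: divide_le_eq)
  have "decay r K z \<le> test_weight A B W z" for z
  proof -
    let ?x = "Re_vec z" and ?y = "Im_vec z"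
    have 1: "infnorm ?x / r \<le> infnorm ?x / A" using r AB by (intro divide_left_mono) (auto simp: infnorm_pos_le)
    have 2: "B * infnorm ?y \<le> r * infnorm ?y" using r by (intro mult_right_mono) (auto simp: infnorm_pos_le)
    have 3: "B * cone_dist W ?x \<le> r * cone_dist K ?x"
    proof (cases "?x \<in> W")
      case True
      have "cone_dist W ?x \<le> 0" using cone_dist_le[OF True, of ?x] by (simp add: infnorm_0)
      then have "B * cone_dist W ?x \<le> 0" using AB by (simp add: mult_le_0_iff)
      moreover have "0 \<le> r * cone_dist K ?x" using r K cone_dist_nonneg[of K] by (simp add: pos_cone_def)
      ultimately show ?thesis by linarith
    next
      case False
      have "B * cone_dist W ?x \<le> B * infnorm ?x"
        using cone_dist_le_infnorm[OF W(2)] AB by (intro mult_left_mono) auto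
      also have "\<dots> \<le> r * c * infnorm ?x" using rc by (intro mult_right_mono) (auto simp: infnorm_pos_le)
      also have "\<dots> = r * (c * infnorm ?x)" by simp
      also have "\<dots> \<le> r * cone_dist K ?x" using r c(2)[OF False] by (intro mult_left_mono) auto
      finally show ?thesis .
    qed
    show ?thesis using 1 2 3 by (simp add: decay_def test_weight_eq[OF AB W(2)])
  qed
  then show ?thesis using r by blast
qed

text \<open>
  The conic neighbourhood consists of \<open>K\<close> and of the points whose distance to
  \<open>K\<close> is less than a small multiple \<open>\<eta>\<close> of their norm. With
  \<open>r \<eta> = 1 / (4 r)\<close>, replacing \<open>K\<close> by this neighbourhood costs a
  quarter of the decay \<open>infnorm x / r\<close>. Halving the rate of decay therefore leaves
  another quarter, which is the gain \<open>c\<close> in the real directions; in the imaginary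
  directions it comes from \<open>B > r\<close>. Thanks to this gain, locally uniform convergence
  inside a ball implies convergence in a weaker norm.
\<close>

lemma test_weight_le_decay:
  fixes K :: "(real^'n) set"
  assumes K: "pos_cone K" and r: "r > 0"
  shows "\<exists>A B W c. (A, B, W) \<in> S_index K \<and> c > 0 \<and>
    (\<forall>z. test_weight A B W z \<le> decay r K z - c * (infnorm (Re_vec z) + infnorm (Im_vec z)))"
proof -
  define \<eta> where "\<eta> = 1 / (4 * r\<^sup>2)"
  have \<eta>: "\<eta> > 0" "r * \<eta> = 1 / (4 * r)" using r by (auto simp: \<eta>_def power2_eq_square)
  have ne: "K \<noteq> {}" using K by (simp add: pos_cone_def)
  define Om where "Om = {x. cone_dist K x < \<eta> * infnorm x}"
  define W where "W = K \<union> Om"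
  have oO: "open Om"
    unfolding Om_def by (intro open_Collect_less continuous_intros continuous_on_cone_dist ne)
  have WO: "W - {0} = Om"
  proof -
    have "x \<in> Om" if "x \<in> K" "x \<noteq> 0" for x
      using cone_dist_le[OF that(1), of x] that \<eta> by (simp add: Om_def infnorm_0 infnorm_pos_lt le_less_trans)
    moreover have "0 \<notin> Om" using cone_dist_nonneg[OF ne, of 0] by (simp add: Om_def infnorm_0)
    ultimately show ?thesis by (auto simp: W_def)
  qed
  have scO: "c *\<^sub>R x \<in> Om" if "x \<in> Om" "c > 0" for c x
    using that by (simp add: Om_def cone_dist_scale[OF K] infnorm_mul)
  have W: "pos_cone W" using K scO by (auto simp: W_def pos_cone_def)
  have "sgn ` Om = sphere 0 1 \<inter> Om"
  proof
    show "sgn ` Om \<subseteq> sphere 0 1 \<inter> Om"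
    proof
      fix y assume "y \<in> sgn ` Om"
      then obtain x where x: "x \<in> Om" "y = sgn x" by blast
      then have "x \<noteq> 0" using WO by blast
      then show "y \<in> sphere 0 1 \<inter> Om"
        using scO[OF x(1), of "inverse (norm x)"] x(2) by (simp add: norm_sgn) (simp add: sgn_div_norm)
    qed
    show "sphere 0 1 \<inter> Om \<subseteq> sgn ` Om" by (force simp: sgn_div_norm)
  qed
  then have "open_projection W"
    using oO by (auto simp: open_projection_def WO openin_open)
  then have "conic_nbhd W K" using W by (simp add: conic_nbhd_def W_def)
  define A where "A = 2 * r"
  define B where "B = r + 1 / (4 * r)"
  have AB: "A > 0" "B > 0" using r by (auto simp: A_def B_def add_pos_pos)
  have WK: "r * cone_dist K x \<le> B * cone_dist W x + infnorm x / (4 * r)" for x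
  proof -
    have "(r * cone_dist K x - infnorm x / (4 * r)) / B \<le> cone_dist W x"
    proof (rule cone_dist_greatest)
      show "W \<noteq> {}" using ne by (simp add: W_def)
      fix x' assume x': "x' \<in> W"
      have "cone_dist K x' \<le> \<eta> * infnorm x'"
      proof (cases "x' \<in> K")
        case True
        have "0 \<le> \<eta> * infnorm x'" using \<eta> by (simp add: infnorm_pos_le)
        then show ?thesis using cone_dist_le[OF True, of x'] by (simp add: infnorm_0)
      qed (use x' in \<open>auto simp: W_def Om_def\<close>)
      moreover have "infnorm x' \<le> infnorm x + infnorm (x - x')"
        using infnorm_triangle[of x "x' - x"] by (simp add: infnorm_sub[of x' x])
      ultimately have "cone_dist K x' \<le> \<eta> * (infnorm x + infnorm (x - x'))"
        using \<eta> by (meson less_imp_le mult_left_mono order_trans)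
      then have "cone_dist K x \<le> infnorm (x - x') + \<eta> * (infnorm x + infnorm (x - x'))"
        using cone_dist_triangle[OF ne, of x x'] by linarith
      then have "r * cone_dist K x \<le> r * (infnorm (x - x') + \<eta> * (infnorm x + infnorm (x - x')))"
        using r by (intro mult_left_mono) auto
      also have "\<dots> = r * infnorm (x - x') + (r * \<eta>) * (infnorm x + infnorm (x - x'))"
        by (simp add: algebra_simps)
      also have "\<dots> = B * infnorm (x - x') + infnorm x / (4 * r)"
        unfolding \<eta> B_def by (simp add: algebra_simps add_divide_distrib)
      finally show "(r * cone_dist K x - infnorm x / (4 * r)) / B \<le> infnorm (x - x')"
        using AB by (simp add: divide_le_eq mult.commute)
    qed
    then show ?thesis using AB by (simp add: divide_le_eq mult.commute)
  qed
  have "test_weight A B W z \<le> decay r K z - 1 / (4 * r) * (infnorm (Re_vec z) + infnorm (Im_vec z))" for z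
  proof -
    let ?x = "infnorm (Re_vec z)" and ?y = "infnorm (Im_vec z)"
    have "?x / r - ?x / A - ?x / (4 * r) = 1 / (4 * r) * ?x" using r by (simp add: A_def field_simps)
    moreover have "B * ?y - r * ?y = 1 / (4 * r) * ?y" by (simp add: B_def algebra_simps)
    ultimately show ?thesis
      using WK[of "Re_vec z"] by (simp add: decay_def test_weight_eq[OF AB W] distrib_left)
  qed
  moreover have "(A, B, W) \<in> S_index K" using AB \<open>conic_nbhd W K\<close> by (simp add: S_index_def)
  ultimately show ?thesis using r by (intro exI[of _ A] exI[of _ B] exI[of _ W] exI[of _ "1 / (4 * r)"]) auto
qed

section \<open>The test function spaces\<close>

lemma S_norm_eq: "S_norm A B W f = (SUP z. ennreal (cmod (f z) * exp (test_weight A B W z)))"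
  by (simp add: S_norm_def test_weight_def)

lemma S_norm_le:
  assumes "\<And>z. cmod (f z) * exp (test_weight A B W z) \<le> C" "0 \<le> C"
  shows "S_norm A B W f < \<infinity>" "enn2real (S_norm A B W f) \<le> C"
proof -
  have "S_norm A B W f \<le> ennreal C"
    unfolding S_norm_eq by (intro SUP_least ennreal_leI assms)
  then show "S_norm A B W f < \<infinity>" "enn2real (S_norm A B W f) \<le> C"
    using assms(2) by (auto simp: enn2real_leI le_less_trans)
qed

lemma S_norm_ge:
  assumes "f \<in> S_AB A B W"
  shows "cmod (f z) * exp (test_weight A B W z) \<le> enn2real (S_norm A B W f)"
proof -
  have fin: "S_norm A B W f < \<infinity>" using assms by (simp add: S_AB_def)
  have "ennreal (cmod (f z) * exp (test_weight A B W z)) \<le> S_norm A B W f"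
    unfolding S_norm_eq by (rule SUP_upper) simp
  then have "enn2real (ennreal (cmod (f z) * exp (test_weight A B W z))) \<le> enn2real (S_norm A B W f)"
    using fin by (intro enn2real_mono) auto
  then show ?thesis by simp
qed

lemma S_AB_I:
  assumes "entire f" "\<And>z. cmod (f z) * exp (test_weight A B W z) \<le> C"
  shows "f \<in> S_AB A B W"
proof -
  have "0 \<le> cmod (f 0) * exp (test_weight A B W 0)" by simp
  then have "0 \<le> C" using assms(2)[of 0] by linarith
  then show ?thesis using assms(1) S_norm_le(1)[OF assms(2)] by (simp add: S_AB_def)
qed

lemma S_AB_add:
  assumes "f \<in> S_AB A B W" "g \<in> S_AB A B W"
  shows "f + g \<in> S_AB A B W"
    "enn2real (S_norm A B W (f + g)) \<le> enn2real (S_norm A B W f) + enn2real (S_norm A B W g)"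
proof -
  have le: "cmod ((f + g) z) * exp (test_weight A B W z)
      \<le> enn2real (S_norm A B W f) + enn2real (S_norm A B W g)" for z
    using add_mono[OF S_norm_ge[OF assms(1), of z] S_norm_ge[OF assms(2), of z]]
      mult_right_mono[OF norm_triangle_ineq[of "f z" "g z"], of "exp (test_weight A B W z)"]
    by (simp add: algebra_simps)
  have "entire (f + g)" using assms entire_add by (auto simp: S_AB_def plus_fun_def)
  then show "f + g \<in> S_AB A B W" using le by (rule S_AB_I)
  show "enn2real (S_norm A B W (f + g)) \<le> enn2real (S_norm A B W f) + enn2real (S_norm A B W g)"
    by (rule S_norm_le(2)[OF le]) simp
qed

lemma S_AB_scale:
  assumes "f \<in> S_AB A B W"
  shows "cscale c f \<in> S_AB A B W" "enn2real (S_norm A B W (cscale c f)) \<le> cmod c * enn2real (S_norm A B W f)"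
proof -
  have le: "cmod (cscale c f z) * exp (test_weight A B W z) \<le> cmod c * enn2real (S_norm A B W f)" for z
    using mult_left_mono[OF S_norm_ge[OF assms, of z] norm_ge_zero[of c]]
    by (simp add: cscale_def norm_mult mult.assoc)
  have "entire (cscale c f)" using assms entire_cmult by (auto simp: S_AB_def cscale_def)
  then show "cscale c f \<in> S_AB A B W" using le by (rule S_AB_I)
  show "enn2real (S_norm A B W (cscale c f)) \<le> cmod c * enn2real (S_norm A B W f)"
    by (rule S_norm_le(2)[OF le]) simp
qed

lemma S_AB_zero: "0 \<in> S_AB A B W" "enn2real (S_norm A B W 0) = 0"
proof -
  show "0 \<in> S_AB A B W" by (rule S_AB_I[where C = 0]) (auto simp: zero_fun_def entire_zero)
  have "enn2real (S_norm A B W 0) \<le> 0" by (rule S_norm_le) auto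
  then show "enn2real (S_norm A B W 0) = 0" using enn2real_nonneg antisym by blast
qed

lemma S_AB_diff:
  assumes "f \<in> S_AB A B W" "g \<in> S_AB A B W" shows "f - g \<in> S_AB A B W"
proof -
  have eq: "f - g = f + cscale (-1) g" by (auto simp: cscale_def fun_eq_iff)
  show ?thesis unfolding eq by (rule S_AB_add(1)[OF assms(1) S_AB_scale(1)[OF assms(2)]])
qed

lemma Metric_space_S_AB: "Metric_space (S_AB A B W) (\<lambda>f g. enn2real (S_norm A B W (f - g)))"
proof
  fix f g h :: "'a testfun"
  show "0 \<le> enn2real (S_norm A B W (f - g))" by simp
  show "enn2real (S_norm A B W (f - g)) = enn2real (S_norm A B W (g - f))"
    by (simp add: S_norm_def norm_minus_commute)
  assume f: "f \<in> S_AB A B W" and g: "g \<in> S_AB A B W"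
  show "enn2real (S_norm A B W (f - g)) = 0 \<longleftrightarrow> f = g"
  proof
    assume 0: "enn2real (S_norm A B W (f - g)) = 0"
    have "cmod ((f - g) z) * exp (test_weight A B W z) \<le> 0" for z
      using S_norm_ge[OF S_AB_diff[OF f g], of z] 0 by simp
    then show "f = g" by (auto simp: fun_eq_iff mult_le_0_iff)
  qed (simp add: S_AB_zero)
  assume h: "h \<in> S_AB A B W"
  show "enn2real (S_norm A B W (f - h)) \<le> enn2real (S_norm A B W (f - g)) + enn2real (S_norm A B W (g - h))"
    using S_AB_add(2)[OF S_AB_diff[OF f g] S_AB_diff[OF g h]] by simp
qed

lemma topspace_S_AB_top: "topspace (S_AB_top A B W) = S_AB A B W"
  unfolding S_AB_top_def by (rule Metric_space.topspace_mtopology[OF Metric_space_S_AB])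

lemma S_AB_ball_open:
  assumes "f \<in> S_AB A B W" "e > 0"
  shows "\<exists>N. openin (S_AB_top A B W) N \<and> f \<in> N \<and> (\<forall>g\<in>N. g \<in> S_AB A B W \<and> enn2real (S_norm A B W (g - f)) < e)"
proof -
  interpret Metric_space "S_AB A B W" "\<lambda>f g. enn2real (S_norm A B W (f - g))" by (rule Metric_space_S_AB)
  have "g \<in> S_AB A B W \<and> enn2real (S_norm A B W (g - f)) < e" if "g \<in> mball f e" for g
    using that commute[of g f] unfolding in_mball by (simp only: simp_thms)
  then show ?thesis
    unfolding S_AB_top_def using openin_mball centre_in_mball_iff assms by blast
qed

text \<open>
  Without the conic neighbourhoods it is visible that the union of the steps is closed under
  addition and how the spaces for different cones compare.
\<close>

lemma S_space_eq:
  assumes K: "closed K" "pos_cone K"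
  shows "S_space K = {f. entire f \<and> (\<exists>r>0. \<exists>C. \<forall>z. cmod (f z) \<le> C * exp (- decay r K z))}"
proof (intro set_eqI iffI)
  fix f assume "f \<in> S_space K"
  then obtain A B W where i: "(A, B, W) \<in> S_index K" and f: "f \<in> S_AB A B W" by (auto simp: S_space_def)
  obtain r where r: "r > 0" "\<And>z. decay r K z \<le> test_weight A B W z"
    using decay_le_test_weight[OF K i] by blast
  have "cmod (f z) \<le> enn2real (S_norm A B W f) * exp (- decay r K z)" for z
  proof -
    have "cmod (f z) * exp (decay r K z) \<le> cmod (f z) * exp (test_weight A B W z)"
      using r by (intro mult_left_mono) auto
    also have "\<dots> \<le> enn2real (S_norm A B W f)" by (rule S_norm_ge[OF f])
    finally show ?thesis by (simp add: exp_minus field_simps)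
  qed
  then show "f \<in> {f. entire f \<and> (\<exists>r>0. \<exists>C. \<forall>z. cmod (f z) \<le> C * exp (- decay r K z))}"
    using f r by (auto simp: S_AB_def)
next
  fix f assume "f \<in> {f. entire f \<and> (\<exists>r>0. \<exists>C. \<forall>z. cmod (f z) \<le> C * exp (- decay r K z))}"
  then obtain r C where f: "entire f" "r > 0" "\<And>z. cmod (f z) \<le> C * exp (- decay r K z)" by auto
  obtain A B W c where i: "(A, B, W) \<in> S_index K" "c > 0"
    "\<And>z. test_weight A B W z \<le> decay r K z - c * (infnorm (Re_vec z) + infnorm (Im_vec z))"
    using test_weight_le_decay[OF K(2) f(2)] by blast
  have C: "0 \<le> C"
    using order_trans[OF norm_ge_zero f(3)[of 0]] by (simp add: zero_le_mult_iff)
  have "f \<in> S_AB A B W"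
  proof (rule S_AB_I[OF f(1)])
    fix z
    have "test_weight A B W z \<le> decay r K z"
    proof -
      have "0 \<le> infnorm (Re_vec z) + infnorm (Im_vec z)" by (intro add_nonneg_nonneg infnorm_pos_le)
      then have "0 \<le> c * (infnorm (Re_vec z) + infnorm (Im_vec z))" using i(2) by simp
      then show ?thesis using i(3)[of z] by linarith
    qed
    then have "cmod (f z) * exp (test_weight A B W z) \<le> C * exp (- decay r K z) * exp (decay r K z)"
      using f C by (intro mult_mono) auto
    also have "\<dots> = C" by (simp add: exp_minus)
    finally show "cmod (f z) * exp (test_weight A B W z) \<le> C" .
  qed
  then show "f \<in> S_space K" using i by (auto simp: S_space_def)
qed

lemma decay_ball_subset_S_space:
  assumes K: "closed K" "pos_cone K" and "r > 0"
  shows "decay_ball r K \<subseteq> S_space K"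
proof
  fix f assume "f \<in> decay_ball r K"
  then have "entire f" "\<forall>z. cmod (f z) \<le> 1 * exp (- decay r K z)" by (auto simp: decay_ball_def)
  then show "f \<in> S_space K" unfolding S_space_eq[OF K] using \<open>r > 0\<close> by blast
qed

lemma S_space_antimono:
  assumes "closed K" "pos_cone K" "closed K'" "pos_cone K'" "K' \<subseteq> K"
  shows "S_space K \<subseteq> (S_space K' :: ('n::finite) testfun set)"
proof
  fix f :: "'n testfun" assume "f \<in> S_space K"
  then obtain r C where f: "entire f" "r > 0" "\<And>z. cmod (f z) \<le> C * exp (- decay r K z)"
    by (auto simp: S_space_eq assms)
  have C: "0 \<le> C"
    using order_trans[OF norm_ge_zero f(3)[of 0]] by (simp add: zero_le_mult_iff)
  have "cmod (f z) \<le> C * exp (- decay r K' z)" for z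
  proof -
    have "decay r K' z \<le> decay r K z"
      using assms f by (intro decay_mono_cone) (auto simp: pos_cone_def)
    then have "C * exp (- decay r K z) \<le> C * exp (- decay r K' z)" using C by (intro mult_left_mono) auto
    with f(3)[of z] show ?thesis by linarith
  qed
  then show "f \<in> S_space K'" using f by (auto simp: S_space_eq assms)
qed

lemma subspace_S_space:
  assumes K: "closed K" "pos_cone K"
  shows "cfun.subspace (S_space K :: ('n::finite) testfun set)"
proof (rule cfun.subspaceI)
  show "0 \<in> (S_space K :: 'n testfun set)"
  proof -
    have "(\<lambda>z. 0) \<in> decay_ball 1 K" using entire_zero by (simp add: decay_ball_def)
    then show ?thesis using decay_ball_subset_S_space[OF K, of 1] by (auto simp: zero_fun_def)
  qed
next
  fix f :: "'n testfun" and c assume "f \<in> S_space K"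
  then obtain A B W where "(A, B, W) \<in> S_index K" "f \<in> S_AB A B W"
    by (auto simp: S_space_def)
  then show "cscale c f \<in> S_space K" using S_AB_scale(1) unfolding S_space_def by blast
next
  fix f g :: "'n testfun" assume "f \<in> S_space K" "g \<in> S_space K"
  then obtain r C r' C' where f: "entire f" "r > 0" "\<And>z. cmod (f z) \<le> C * exp (- decay r K z)"
    and g: "entire g" "r' > 0" "\<And>z. cmod (g z) \<le> C' * exp (- decay r' K z)"
    by (auto simp: S_space_eq K)
  have C: "0 \<le> C" "0 \<le> C'"
    using order_trans[OF norm_ge_zero f(3)[of 0]] order_trans[OF norm_ge_zero g(3)[of 0]]
    by (auto simp: zero_le_mult_iff)
  define s where "s = max r r'"
  have "cmod ((f + g) z) \<le> (C + C') * exp (- decay s K z)" for z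
  proof -
    have "decay s K z \<le> decay r K z" "decay s K z \<le> decay r' K z"
      using K f g by (auto intro!: decay_antimono simp: s_def pos_cone_def)
    then have "C * exp (- decay r K z) \<le> C * exp (- decay s K z)" "C' * exp (- decay r' K z) \<le> C' * exp (- decay s K z)"
      using C by (auto intro!: mult_left_mono)
    with f(3)[of z] g(3)[of z] norm_triangle_ineq[of "f z" "g z"] show ?thesis by (simp add: distrib_right)
  qed
  moreover have "entire (f + g)" using entire_add[OF f(1) g(1)] by (simp add: plus_fun_def)
  moreover have "s > 0" using f by (simp add: s_def)
  ultimately show "f + g \<in> S_space K" unfolding S_space_eq[OF K] by blast
qed

lemma lc_compatible_S_top:
  assumes K: "closed K" "pos_cone K"
  shows "lc_compatible (S_space K) (S_index K) (\<lambda>(A, B, W). S_AB_top A B W) (\<lambda>_ f. f) (S_top K)"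
  unfolding S_top_def
  by (rule lc_compatible_finest_lc[OF subspace_S_space[OF K]])
     (auto simp: topspace_S_AB_top S_space_def)

lemma topspace_S_top: "closed K \<Longrightarrow> pos_cone K \<Longrightarrow> topspace (S_top K) = S_space K"
  using lc_compatible_S_top by (auto simp: lc_compatible_def)

lemma S_top_seminorm_ball_open:
  fixes p :: "('n::finite) testfun \<Rightarrow> real"
  assumes K: "closed K" "pos_cone K"
    and add: "\<And>f g. f \<in> S_space K \<Longrightarrow> g \<in> S_space K \<Longrightarrow> p (f + g) \<le> p f + p g"
    and scale: "\<And>c f. f \<in> S_space K \<Longrightarrow> p (cscale c f) = cmod c * p f"
    and bd: "\<And>A B W. (A, B, W) \<in> S_index K \<Longrightarrow> \<exists>C. \<forall>f\<in>S_AB A B W. p f \<le> C * enn2real (S_norm A B W f)"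
    and f0: "f0 \<in> S_space K"
  shows "openin (S_top K) {f \<in> S_space K. p (f - f0) < e}"
  unfolding S_top_def
proof (rule finest_lc_seminorm_ball_open[OF subspace_S_space[OF K] _ add scale _ f0])
  show "(\<lambda>f. f) \<in> topspace (case i of (A, B, W) \<Rightarrow> S_AB_top A B W) \<rightarrow> S_space K" if "i \<in> S_index K" for i
    using that by (auto simp: topspace_S_AB_top S_space_def)
  fix i :: "real \<times> real \<times> (real^'n) set" and x :: "'n testfun" and e :: real
  assume i: "i \<in> S_index K" and x: "x \<in> topspace (case i of (A, B, W) \<Rightarrow> S_AB_top A B W)" and e: "e > 0"
  obtain A B W where ABW: "i = (A, B, W)" by (metis surj_pair)
  have x: "x \<in> S_AB A B W" using x by (simp add: ABW topspace_S_AB_top)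
  obtain C where C: "\<And>f. f \<in> S_AB A B W \<Longrightarrow> p f \<le> C * enn2real (S_norm A B W f)" using bd i ABW by blast
  have "0 < e / (\<bar>C\<bar> + 1)" using e by (simp add: add_nonneg_pos)
  then obtain N where N: "openin (S_AB_top A B W) N" "x \<in> N"
      "\<And>g. g \<in> N \<Longrightarrow> g \<in> S_AB A B W \<and> enn2real (S_norm A B W (g - x)) < e / (\<bar>C\<bar> + 1)"
    using S_AB_ball_open[OF x] by metis
  have "p (g - x) < e" if "g \<in> N" for g
  proof -
    let ?n = "enn2real (S_norm A B W (g - x))"
    have "p (g - x) \<le> C * ?n" using C[OF S_AB_diff] N(3)[OF that] x by blast
    also have "\<dots> \<le> (\<bar>C\<bar> + 1) * ?n" by (intro mult_right_mono) auto
    also have "\<dots> < e" using N(3)[OF that] by (simp add: field_simps)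
    finally show ?thesis .
  qed
  then show "\<exists>N. openin (case i of (A, B, W) \<Rightarrow> S_AB_top A B W) N \<and> x \<in> N \<and> (\<forall>y\<in>N. p (y - x) < e)"
    using N by (auto simp: ABW)
qed

section \<open>Functionals on the test function spaces\<close>

lemma S_dual_linear:
  assumes K: "closed K" "pos_cone K" and u: "u \<in> S_dual K" and f: "f \<in> S_space K" and g: "g \<in> S_space K"
  shows "u (f + g) = u f + u g" "u (cscale c f) = c * u f" "u 0 = 0" "u (f - g) = u f - u g"
proof -
  have lin: "\<And>f g. f \<in> S_space K \<Longrightarrow> g \<in> S_space K \<Longrightarrow> u (f + g) = u f + u g"
    "\<And>c f. f \<in> S_space K \<Longrightarrow> u (cscale c f) = c * u f"
    using u by (auto simp: S_dual_def cont_dual_def topspace_S_top[OF K])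
  show "u (f + g) = u f + u g" "u (cscale c f) = c * u f" using lin f g by auto
  show "u 0 = 0" using lin(2)[OF f, of 0] by simp
  have "u (f + cscale (-1) g) = u f + -1 * u g"
    using lin f g subspace_S_space[OF K] cfun.subspace_scale by metis
  moreover have "f + cscale (-1) g = f - g" by (auto simp: cscale_def fun_eq_iff)
  ultimately show "u (f - g) = u f - u g" by simp
qed

lemma S_dual_bounded_on_S_AB:
  assumes K: "closed K" "pos_cone K" and u: "u \<in> S_dual K" and i: "(A, B, W) \<in> S_index K"
  shows "\<exists>M\<ge>0. \<forall>f\<in>S_AB A B W. cmod (u f) \<le> M * enn2real (S_norm A B W f)"
proof -
  interpret Metric_space "S_AB A B W" "\<lambda>f g. enn2real (S_norm A B W (f - g))" by (rule Metric_space_S_AB)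
  have sub: "S_AB A B W \<subseteq> S_space K" using i by (auto simp: S_space_def)
  have "continuous_map (S_AB_top A B W) (S_top K) (\<lambda>f. f)"
    using lc_compatible_S_top[OF K] i by (auto simp: lc_compatible_def)
  moreover have "continuous_map (S_top K) euclidean u" using u by (simp add: S_dual_def cont_dual_def)
  ultimately have "continuous_map (S_AB_top A B W) euclidean u"
    using continuous_map_compose by (fastforce simp: o_def)
  then have "openin (S_AB_top A B W) {f \<in> S_AB A B W. u f \<in> ball 0 1}"
    using openin_continuous_map_preimage[of "S_AB_top A B W" euclidean u "ball 0 1"] by (simp add: topspace_S_AB_top)
  moreover have "u 0 = 0" using S_dual_linear(3)[OF K u] sub S_AB_zero(1) by blast
  ultimately obtain \<delta> where \<delta>: "\<delta> > 0" "mball 0 \<delta> \<subseteq> {f \<in> S_AB A B W. u f \<in> ball 0 1}"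
    using S_AB_zero(1)[of A B W] unfolding S_AB_top_def openin_mtopology by force
  have "cmod (u f) \<le> (2 / \<delta>) * enn2real (S_norm A B W f)" if f: "f \<in> S_AB A B W" for f
  proof (cases "enn2real (S_norm A B W f) = 0")
    case True
    then have "f = 0" using zero[OF f S_AB_zero(1)] by simp
    then show ?thesis using \<open>u 0 = 0\<close> by (simp add: S_AB_zero)
  next
    case False
    define n where "n = enn2real (S_norm A B W f)"
    have n: "n > 0" using False enn2real_nonneg[of "S_norm A B W f"] by (simp add: n_def less_le)
    define c where "c = complex_of_real (\<delta> / (2 * n))"
    have c: "cmod c = \<delta> / (2 * n)" using n \<delta> by (simp add: c_def norm_divide norm_mult)
    have "enn2real (S_norm A B W (cscale c f)) \<le> cmod c * n" unfolding n_def by (rule S_AB_scale(2)[OF f])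
    also have "cmod c * n < \<delta>" using n \<delta> c by simp
    finally have "cscale c f \<in> mball 0 \<delta>"
      using S_AB_scale(1)[OF f] S_AB_zero(1) commute[of 0 "cscale c f"]
      by (simp add: in_mball)
    then have "cmod (u (cscale c f)) < 1" using \<delta>(2) by auto
    moreover have "u (cscale c f) = c * u f" using S_dual_linear(2)[OF K u] sub f by blast
    ultimately have "\<delta> / (2 * n) * cmod (u f) < 1" using c by (simp add: norm_mult)
    then show ?thesis using n \<delta> by (simp add: n_def[symmetric] field_simps)
  qed
  then show ?thesis using \<delta>(1) by (intro exI[of _ "2 / \<delta>"]) auto
qed

lemma S_dual_bounded_on_decay_ball:
  assumes K: "closed K" "pos_cone K" and u: "u \<in> S_dual K" and r: "r > 0"
  shows "\<exists>M. \<forall>f\<in>decay_ball r K. cmod (u f) \<le> M"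
proof -
  obtain A B W c where i: "(A, B, W) \<in> S_index K" "c > 0"
    "\<And>z. test_weight A B W z \<le> decay r K z - c * (infnorm (Re_vec z) + infnorm (Im_vec z))"
    using test_weight_le_decay[OF K(2) r] by blast
  obtain M where M: "M \<ge> 0" "\<And>f. f \<in> S_AB A B W \<Longrightarrow> cmod (u f) \<le> M * enn2real (S_norm A B W f)"
    using S_dual_bounded_on_S_AB[OF K u i(1)] by blast
  have "cmod (u f) \<le> M" if f: "f \<in> decay_ball r K" for f
  proof -
    have le: "cmod (f z) * exp (test_weight A B W z) \<le> 1" for z
    proof -
      have "0 \<le> c * (infnorm (Re_vec z) + infnorm (Im_vec z))"
        using i(2) by (intro mult_nonneg_nonneg add_nonneg_nonneg infnorm_pos_le) auto
      then have "test_weight A B W z \<le> decay r K z" using i(3)[of z] by linarith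
      then have "cmod (f z) * exp (test_weight A B W z) \<le> exp (- decay r K z) * exp (decay r K z)"
        using f by (intro mult_mono) (auto simp: decay_ball_def)
      then show ?thesis by (simp flip: exp_add)
    qed
    have "f \<in> S_AB A B W" using f by (intro S_AB_I[OF _ le]) (auto simp: decay_ball_def)
    moreover have "M * enn2real (S_norm A B W f) \<le> M * 1"
      using M S_norm_le(2)[OF le] by (intro mult_left_mono) auto
    ultimately show ?thesis using M(2)[of f] by simp
  qed
  then show ?thesis by blast
qed

text \<open>
  The weight of the ball exceeds the weight of some step \<open>S_AB A B W\<close> by a multiple of the norm,
  so far away the functions are uniformly small in the norm of that step, and on a ball they are
  small by assumption.
\<close>

lemma S_dual_tendsto_zero:
  fixes f :: "nat \<Rightarrow> ('n::finite) testfun"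
  assumes K: "closed K" "pos_cone K" and u: "u \<in> S_dual K" and r: "r > 0"
    and f: "\<And>m. f m \<in> decay_ball r K" and lim: "\<And>R. uniform_limit (cball 0 R) f (\<lambda>_. 0) sequentially"
  shows "(\<lambda>m. u (f m)) \<longlonglongrightarrow> 0"
proof (rule tendstoI)
  fix e :: real assume e: "e > 0"
  obtain A B W c where i: "(A, B, W) \<in> S_index K" "c > 0"
    "\<And>z. test_weight A B W z \<le> decay r K z - c * (infnorm (Re_vec z) + infnorm (Im_vec z))"
    using test_weight_le_decay[OF K(2) r] by blast
  have AB: "A > 0" "B > 0" "pos_cone W" using i(1) by (auto simp: S_index_def conic_nbhd_def)
  obtain M where M: "M \<ge> 0" "\<And>f. f \<in> S_AB A B W \<Longrightarrow> cmod (u f) \<le> M * enn2real (S_norm A B W f)"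
    using S_dual_bounded_on_S_AB[OF K u i(1)] by blast
  define e' where "e' = e / (M + 1)"
  have e': "e' > 0" "M * e' < e" using e M by (auto simp: e'_def field_simps)
  define k where "k = sqrt (real CARD('n))"
  have k: "k > 0" by (simp add: k_def)
  \<comment> \<open>Outside the ball of radius R the surplus c * (...) of the weight exceeds - ln e'.\<close>
  define R where "R = \<bar>k * ln e' / c\<bar>"
  have far: "cmod (f m z) * exp (test_weight A B W z) \<le> e'" if z: "R < norm z" for m z
  proof -
    have "cmod (f m z) * exp (test_weight A B W z)
        \<le> exp (- decay r K z) * exp (decay r K z - c * (infnorm (Re_vec z) + infnorm (Im_vec z)))"
      using f[of m] i(3)[of z] by (intro mult_mono) (auto simp: decay_ball_def)
    also have "\<dots> = exp (- (c * (infnorm (Re_vec z) + infnorm (Im_vec z))))" by (simp flip: exp_add)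
    also have "\<dots> \<le> exp (ln e')"
    proof -
      have "norm z \<le> k * (infnorm (Re_vec z) + infnorm (Im_vec z))"
        using norm_le_infnorm_Re_Im[of z] by (simp add: k_def)
      then have "- (k * ln e' / c) < k * (infnorm (Re_vec z) + infnorm (Im_vec z))"
        using z abs_ge_minus_self[of "k * ln e' / c"] unfolding R_def by linarith
      then have "k * (- ln e') < k * (c * (infnorm (Re_vec z) + infnorm (Im_vec z)))"
        using i(2) by (simp add: field_simps)
      then have "- ln e' < c * (infnorm (Re_vec z) + infnorm (Im_vec z))"
        using k by (simp only: mult_less_cancel_left_pos)
      then show ?thesis by simp
    qed
    finally show ?thesis using e' by simp
  qed
  have w: "test_weight A B W z \<le> R / A" if "norm z \<le> R" for z
  proof -
    have "infnorm (Re_vec z) \<le> R" using infnorm_Re_vec_le[of z] that by linarith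
    then have "infnorm (Re_vec z) / A \<le> R / A" using AB by (simp add: divide_right_mono)
    moreover have "0 \<le> B * cone_dist W (Re_vec z)" "0 \<le> B * infnorm (Im_vec z)"
      using AB cone_dist_nonneg[of W] by (auto simp: pos_cone_def infnorm_pos_le)
    ultimately show ?thesis by (simp add: test_weight_eq[OF AB])
  qed
  have "\<forall>\<^sub>F m in sequentially. \<forall>z\<in>cball 0 R. dist (f m z) 0 < e' * exp (- (R / A))"
    using uniform_limitD[OF lim] e' by simp
  then show "\<forall>\<^sub>F m in sequentially. dist (u (f m)) 0 < e"
  proof eventually_elim
    case (elim m)
    have le: "cmod (f m z) * exp (test_weight A B W z) \<le> e'" for z
    proof (cases "norm z \<le> R")
      case True
      then have "cmod (f m z) * exp (test_weight A B W z) \<le> e' * exp (- (R / A)) * exp (R / A)"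
        using elim w[OF True] e' by (intro mult_mono) (auto simp: less_imp_le)
      then show ?thesis by (simp add: mult.assoc flip: exp_add)
    qed (use far in auto)
    have "f m \<in> S_AB A B W" using f[of m] by (intro S_AB_I[OF _ le]) (auto simp: decay_ball_def)
    moreover have "M * enn2real (S_norm A B W (f m)) \<le> M * e'"
      using M S_norm_le(2)[OF le] e' by (intro mult_left_mono) auto
    ultimately show "dist (u (f m)) 0 < e" using M(2)[of "f m"] e' by simp
  qed
qed

definition point_functional :: "(real^'n) set \<Rightarrow> (complex^'n) set \<Rightarrow> (complex^'n \<Rightarrow> complex) \<Rightarrow> ('n::finite) functional" where
  "point_functional K Z a = (\<lambda>f. if f \<in> S_space K then \<Sum>z\<in>Z. a z * f z else 0)"

lemma point_functional_in_S_dual: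
  fixes K :: "(real^'n::finite) set"
  assumes K: "closed K" "pos_cone K"
  shows "point_functional K Z a \<in> S_dual K"
proof -
  let ?u = "point_functional K Z a"
  have V: "f + g \<in> S_space K" "cscale c f \<in> S_space K" "f - g \<in> S_space K"
    if "f \<in> S_space K" "g \<in> S_space K" for f g :: "'n testfun" and c
    using that subspace_S_space[OF K] by (auto intro: cfun.subspace_add cfun.subspace_scale cfun.subspace_diff)
  have add: "?u (f + g) = ?u f + ?u g" if "f \<in> S_space K" "g \<in> S_space K" for f g
    using that V by (simp add: point_functional_def algebra_simps sum.distrib)
  have scale: "?u (cscale c f) = c * ?u f" if "f \<in> S_space K" for f c
    using that V(2)[OF that that] by (simp add: point_functional_def cscale_def algebra_simps sum_distrib_left)
  have diff: "?u (f - g) = ?u f - ?u g" if "f \<in> S_space K" "g \<in> S_space K" for f g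
    using that V by (simp add: point_functional_def algebra_simps sum_subtractf)
  have bd: "\<exists>C. \<forall>f\<in>S_AB A B W. cmod (?u f) \<le> C * enn2real (S_norm A B W f)" if i: "(A, B, W) \<in> S_index K" for A B W
  proof (intro exI ballI)
    fix f assume f: "f \<in> S_AB A B W"
    let ?n = "enn2real (S_norm A B W f)"
    have "f \<in> S_space K" using f i by (auto simp: S_space_def)
    then have "cmod (?u f) \<le> (\<Sum>z\<in>Z. cmod (a z) * cmod (f z))"
      by (simp add: point_functional_def norm_mult sum_norm_le)
    also have "\<dots> \<le> (\<Sum>z\<in>Z. cmod (a z) * (exp (- test_weight A B W z) * ?n))"
    proof (intro sum_mono mult_left_mono)
      fix z
      show "cmod (f z) \<le> exp (- test_weight A B W z) * ?n"
        using S_norm_ge[OF f, of z] by (simp add: exp_minus field_simps)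
    qed auto
    also have "\<dots> = (\<Sum>z\<in>Z. cmod (a z) * exp (- test_weight A B W z)) * ?n"
      by (simp add: sum_distrib_right mult.assoc)
    finally show "cmod (?u f) \<le> (\<Sum>z\<in>Z. cmod (a z) * exp (- test_weight A B W z)) * ?n" .
  qed
  have ball: "openin (S_top K) {f \<in> S_space K. cmod (?u (f - f0)) < e}" if "f0 \<in> S_space K" for f0 e
    using K that add scale bd
    by (intro S_top_seminorm_ball_open[where p = "\<lambda>f. cmod (?u f)"]) (auto simp: norm_triangle_ineq norm_mult)
  have "continuous_map (S_top K) euclidean ?u"
    unfolding continuous_map_def
  proof (intro conjI allI impI)
    fix G :: "complex set" assume G: "openin euclidean G"
    show "openin (S_top K) {f \<in> topspace (S_top K). ?u f \<in> G}"
    proof (subst openin_subopen, intro ballI)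
      fix f assume "f \<in> {f \<in> topspace (S_top K). ?u f \<in> G}"
      then have f: "f \<in> S_space K" "?u f \<in> G" by (auto simp: topspace_S_top[OF K])
      obtain e where e: "e > 0" "ball (?u f) e \<subseteq> G" using G f openE by auto
      have "{g \<in> S_space K. cmod (?u (g - f)) < e} \<subseteq> {f \<in> topspace (S_top K). ?u f \<in> G}"
        using e f diff by (auto simp: topspace_S_top[OF K] dist_norm norm_minus_commute)
      moreover have "f \<in> {g \<in> S_space K. cmod (?u (g - f)) < e}" using f e diff[OF f(1) f(1)] by simp
      ultimately show "\<exists>T. openin (S_top K) T \<and> f \<in> T \<and> T \<subseteq> {f \<in> topspace (S_top K). ?u f \<in> G}"
        using ball[OF f(1), of e] by blast
    qed
  qed auto
  then show ?thesis
    using add scale by (auto simp: S_dual_def cont_dual_def topspace_S_top[OF K]) (auto simp: point_functional_def)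
qed

text \<open>
  Regularity of the inductive limit. If \<open>D\<close> were not contained in a multiple of any ball, there would
  be \<open>F n \<in> D\<close> and points \<open>Z n\<close> at which \<open>F n\<close> violates the \<open>n\<close>-th bound. The supremum over \<open>n\<close> of
  the values at \<open>Z n\<close>, taken with the \<open>n\<close>-th weight, is a continuous seminorm because almost all of
  these weights are below the weight of any fixed step; but it is unbounded on \<open>D\<close>.
\<close>

lemma bounded_in_S_top:
  fixes K :: "(real^'n::finite) set"
  assumes K: "closed K" "pos_cone K" and bd: "tvs_bounded (S_top K) D"
  shows "\<exists>r\<ge>1. \<forall>f\<in>D. \<exists>g\<in>decay_ball r K. f = cscale (complex_of_real r) g"
proof -
  have ne: "K \<noteq> {}" using K by (simp add: pos_cone_def)
  have D: "D \<subseteq> S_space K" using bd by (simp add: tvs_bounded_def topspace_S_top[OF K])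
  have "\<exists>n. \<forall>f\<in>D. \<forall>z. cmod (f z) * exp (decay (Suc n) K z) \<le> Suc n"
  proof (rule ccontr)
    assume "\<not> ?thesis"
    then have "\<forall>n. \<exists>f z. f \<in> D \<and> Suc n < cmod (f z) * exp (decay (Suc n) K z)" by (meson not_le)
    then obtain F Z where FZ: "\<And>n. F n \<in> D" "\<And>n. Suc n < cmod (F n (Z n)) * exp (decay (Suc n) K (Z n))"
      by metis
    define q where "q = (\<lambda>f n. cmod (f (Z n)) * exp (decay (Suc n) K (Z n)))"
    define p where "p = (\<lambda>f::'n testfun. SUP n. q f n)"
    have q_bound: "\<exists>C. \<forall>f\<in>S_AB A B W. \<forall>n. q f n \<le> C * enn2real (S_norm A B W f)"
      if i: "(A, B, W) \<in> S_index K" for A B W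
    proof -
      obtain r where r: "r > 0" "\<And>z. decay r K z \<le> test_weight A B W z"
        using decay_le_test_weight[OF K i] by blast
      obtain n0 where n0: "r \<le> real n0" using real_arch_simple by blast
      define E where "E = (\<lambda>n. exp (decay (Suc n) K (Z n) - test_weight A B W (Z n)))"
      have E: "E n \<le> (\<Sum>n<n0. E n) + 1" for n
      proof (cases "n < n0")
        case True
        then have "E n \<le> (\<Sum>n<n0. E n)" by (intro member_le_sum) (auto simp: E_def)
        then show ?thesis by simp
      next
        case False
        then have "decay (Suc n) K (Z n) \<le> decay r K (Z n)" using n0 r ne by (intro decay_antimono) auto
        with r(2)[of "Z n"] have "E n \<le> 1" by (simp add: E_def)
        moreover have "0 \<le> (\<Sum>n<n0. E n)" by (intro sum_nonneg) (simp add: E_def)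
        ultimately show ?thesis by linarith
      qed
      have "q f n \<le> ((\<Sum>n<n0. E n) + 1) * enn2real (S_norm A B W f)" if f: "f \<in> S_AB A B W" for f n
      proof -
        have "q f n = E n * (cmod (f (Z n)) * exp (test_weight A B W (Z n)))"
          by (simp add: q_def E_def exp_diff)
        also have "\<dots> \<le> ((\<Sum>n<n0. E n) + 1) * enn2real (S_norm A B W f)"
          using E[of n] order_trans[OF _ E[of n], of 0] S_norm_ge[OF f, of "Z n"]
          by (intro mult_mono) (auto simp: E_def)
        finally show ?thesis .
      qed
      then show ?thesis by blast
    qed
    have bdd: "bdd_above (range (q f))" if f: "f \<in> S_space K" for f
    proof -
      obtain A B W where "(A, B, W) \<in> S_index K" "f \<in> S_AB A B W" using f by (auto simp: S_space_def)
      then obtain C where "\<And>n. q f n \<le> C * enn2real (S_norm A B W f)" using q_bound by blast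
      then show ?thesis by (intro bdd_aboveI) auto
    qed
    have p_le: "q f n \<le> p f" if "f \<in> S_space K" for f n
      unfolding p_def by (rule cSUP_upper[OF _ bdd[OF that]]) simp
    have p_least: "p f \<le> C" if "\<And>n. q f n \<le> C" for f C
      unfolding p_def by (rule cSUP_least) (use that in auto)
    have "openin (S_top K) {f \<in> S_space K. p (f - 0) < 1}"
    proof (rule S_top_seminorm_ball_open[OF K])
      fix f g :: "'n testfun" assume f: "f \<in> S_space K" and g: "g \<in> S_space K"
      show "p (f + g) \<le> p f + p g"
      proof (rule p_least)
        fix n
        have "q (f + g) n \<le> q f n + q g n"
          using mult_right_mono[OF norm_triangle_ineq[of "f (Z n)" "g (Z n)"], of "exp (decay (Suc n) K (Z n))"]
          by (simp add: q_def distrib_right)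
        then show "q (f + g) n \<le> p f + p g" using p_le[OF f, of n] p_le[OF g, of n] by linarith
      qed
    next
      fix c and f :: "'n testfun" assume f: "f \<in> S_space K"
      have qs: "q (cscale c f) n = cmod c * q f n" for n by (simp add: q_def cscale_def norm_mult)
      have cf: "cscale c f \<in> S_space K" using f subspace_S_space[OF K] by (auto intro: cfun.subspace_scale)
      show "p (cscale c f) = cmod c * p f"
      proof (rule antisym)
        show "p (cscale c f) \<le> cmod c * p f"
          by (rule p_least) (simp add: qs mult_left_mono p_le[OF f])
        show "cmod c * p f \<le> p (cscale c f)"
        proof (cases "c = 0")
          case True
          then show ?thesis using p_le[OF cf, of 0] by (simp add: q_def)
        next
          case False
          have "p f \<le> p (cscale c f) / cmod c"
            by (rule p_least) (use p_le[OF cf] False in \<open>simp add: qs field_simps\<close>)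
          then show ?thesis using False by (simp add: field_simps)
        qed
      qed
    next
      show "\<exists>C. \<forall>f\<in>S_AB A B W. p f \<le> C * enn2real (S_norm A B W f)" if "(A, B, W) \<in> S_index K" for A B W
        using q_bound[OF that] p_least by blast
      show "0 \<in> S_space K" by (rule cfun.subspace_0[OF subspace_S_space[OF K]])
    qed
    moreover have "p 0 \<le> 0" by (rule p_least) (simp add: q_def)
    then have "0 \<in> {f \<in> S_space K. p (f - 0) < 1}"
      using cfun.subspace_0[OF subspace_S_space[OF K]] by simp
    ultimately obtain R where R: "R > 0" "\<forall>c. R \<le> cmod c \<longrightarrow> D \<subseteq> cscale c ` {f \<in> S_space K. p (f - 0) < 1}"
      using bd unfolding tvs_bounded_def by meson
    have q_R: "q f n \<le> R" if f: "f \<in> D" for f n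
    proof -
      have "D \<subseteq> cscale (of_real R) ` {f \<in> S_space K. p (f - 0) < 1}" using R by simp
      then obtain g where g: "g \<in> S_space K" "p g < 1" "f = cscale (of_real R) g" using f by auto
      have "q f n = R * q g n" using R by (simp add: g q_def cscale_def norm_mult)
      also have "\<dots> \<le> R * 1" using p_le[OF g(1), of n] g(2) R by (intro mult_left_mono) auto
      finally show ?thesis by simp
    qed
    obtain n where "R \<le> real n" using real_arch_simple by blast
    then show False using FZ(2)[of n] q_R[OF FZ(1), of n n] by (simp add: q_def)
  qed
  then obtain n where n: "\<And>f z. f \<in> D \<Longrightarrow> cmod (f z) * exp (decay (Suc n) K z) \<le> Suc n" by blast
  define r where "r = real (Suc n)"
  have r: "r \<ge> 1" by (simp add: r_def)
  have "\<exists>g\<in>decay_ball r K. f = cscale (complex_of_real r) g" if f: "f \<in> D" for f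
  proof (intro bexI)
    show "f = cscale (complex_of_real r) (\<lambda>z. complex_of_real (1 / r) * f z)"
      using r by (auto simp: cscale_def)
    have "entire f" using D f by (auto simp: S_space_eq[OF K])
    moreover have "cmod (complex_of_real (1 / r) * f z) \<le> exp (- decay r K z)" for z
    proof -
      have "cmod (f z) * exp (decay r K z) \<le> r" using n[OF f] by (simp add: r_def)
      then show ?thesis using r by (simp add: norm_mult norm_divide exp_minus field_simps)
    qed
    ultimately show "(\<lambda>z. complex_of_real (1 / r) * f z) \<in> decay_ball r K"
      using entire_cmult[of f "complex_of_real (1 / r)"] unfolding decay_ball_def by blast
  qed
  then show ?thesis using r by blast
qed

section \<open>Approximation by point functionals\<close>

lemma decay_ball_combination:
  assumes "f \<in> decay_ball r K" "g \<in> decay_ball r K" "0 \<le> t" "t \<le> 1"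
  shows "cscale (of_real (1 - t)) f + cscale (of_real t) g \<in> decay_ball r K"
proof -
  have "cmod (of_real (1 - t) * f z + of_real t * g z) \<le> exp (- decay r K z)" for z
  proof -
    have "cmod (of_real (1 - t) * f z + of_real t * g z)
        \<le> cmod (of_real (1 - t) * f z) + cmod (of_real t * g z)"
      by (rule norm_triangle_ineq)
    also have "\<dots> = (1 - t) * cmod (f z) + t * cmod (g z)"
      unfolding norm_mult norm_of_real using assms(3,4) by simp
    also have "\<dots> \<le> exp (- decay r K z)"
      using assms by (intro convex_bound_le) (auto simp: decay_ball_def)
    finally show ?thesis .
  qed
  moreover have "entire (\<lambda>z. of_real (1 - t) * f z + of_real t * g z)"
    using assms by (intro entire_add entire_cmult) (auto simp: decay_ball_def)
  ultimately show ?thesis by (simp add: decay_ball_def cscale_def plus_fun_def)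
qed

lemma decay_ball_rotate: "f \<in> decay_ball r K \<Longrightarrow> cmod c = 1 \<Longrightarrow> cscale c f \<in> decay_ball r K"
  by (simp add: decay_ball_def cscale_def entire_cmult norm_mult)

lemma zero_in_decay_ball: "0 \<in> decay_ball r K"
  by (simp add: decay_ball_def zero_fun_def entire_zero)

text \<open>
  By equicontinuity the differences tend to zero everywhere. The two rays then force \<open>g\<close> to tend
  to zero, hence also \<open>f\<close>, and equicontinuity once more makes the convergence locally uniform.
\<close>

lemma three_balls_limit_zero:
  fixes f g h :: "nat \<Rightarrow> ('n::finite) testfun"
  assumes K: "pos_cone K" and Kp: "pos_cone Kp" and Km: "pos_cone Km" and v: "v \<noteq> 0" and r: "0 < r"
    and rayp: "\<And>t. 0 \<le> t \<Longrightarrow> t *\<^sub>R v \<in> Kp" and raym: "\<And>t. 0 \<le> t \<Longrightarrow> t *\<^sub>R (- v) \<in> Km"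
    and f: "\<And>m. f m \<in> decay_ball r K" and g: "\<And>m. g m \<in> decay_ball r Kp" and h: "\<And>m. h m \<in> decay_ball r Km"
    and dense: "\<And>S. open S \<Longrightarrow> S \<noteq> {} \<Longrightarrow> \<exists>d\<in>D. d \<in> S"
    and fg: "\<And>d. d \<in> D \<Longrightarrow> (\<lambda>m. f m d - g m d) \<longlonglongrightarrow> 0"
    and gh: "\<And>d. d \<in> D \<Longrightarrow> (\<lambda>m. g m d - h m d) \<longlonglongrightarrow> 0"
  shows "uniform_limit (cball 0 R) f (\<lambda>_. 0) sequentially"
proof -
  have diff: "(\<lambda>m. p m z - q m z) \<longlonglongrightarrow> 0"
    if P: "pos_cone P" and Q: "pos_cone Q" and p: "\<And>m. p m \<in> decay_ball r P" and q: "\<And>m. q m \<in> decay_ball r Q"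
      and D: "\<And>d. d \<in> D \<Longrightarrow> (\<lambda>m. p m d - q m d) \<longlonglongrightarrow> 0"
    for P Q :: "(real^'n) set" and p q :: "nat \<Rightarrow> 'n testfun" and z
  proof -
    have "uniform_limit (cball 0 (norm z)) (\<lambda>m z. p m z - q m z) (\<lambda>_. 0) sequentially"
    proof (rule entire_dense_limit_imp_uniform_limit[OF _ _ dense D])
      show "entire (\<lambda>z. p m z - q m z)" for m
        using p q by (intro entire_diff) (auto simp: decay_ball_def)
      show "\<exists>B. \<forall>m x. norm x \<le> s \<longrightarrow> cmod (p m x - q m x) \<le> B" for s
      proof (intro exI allI impI)
        fix m and x :: "complex^'n" assume x: "norm x \<le> s"
        show "cmod (p m x - q m x) \<le> exp (2 * r * s) + exp (2 * r * s)"
          using norm_triangle_ineq4[of "p m x" "q m x"]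
            decay_ball_locally_bounded[OF P r p x, of m] decay_ball_locally_bounded[OF Q r q x, of m] by linarith
      qed
    qed
    then show ?thesis by (rule tendsto_uniform_limitI) simp
  qed
  have glim: "(\<lambda>m. g m z) \<longlonglongrightarrow> 0" for z
    by (rule opposite_rays_limit_zero[OF Kp v r rayp raym g h diff[OF Kp Km g h gh]])
  have flim: "(\<lambda>m. f m z) \<longlonglongrightarrow> 0" for z
    using tendsto_add[OF diff[OF K Kp f g fg, of z] glim[of z]] by simp
  show ?thesis
  proof (rule entire_dense_limit_imp_uniform_limit[where D = UNIV])
    show "entire (f m)" for m using f by (auto simp: decay_ball_def)
    show "\<exists>B. \<forall>m x. norm x \<le> s \<longrightarrow> cmod (f m x) \<le> B" for s
      using decay_ball_locally_bounded[OF K r f] by blast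
  qed (use flim in auto)
qed

text \<open>
  If this failed for the first \<open>m\<close> points of a countable dense set and the tolerance
  \<open>1 / (m + 1)\<close>, for all \<open>m\<close>, the counterexamples would form sequences to which the preceding lemma
  applies, and \<open>u (f m)\<close> would tend to zero.
\<close>

lemma functional_small_if_close_on_finite_set:
  fixes K Kp Km :: "(real^'n::finite) set"
  assumes K: "closed K" "pos_cone K" and Kp: "pos_cone Kp" and Km: "pos_cone Km" and v: "v \<noteq> 0" and r: "0 < r"
    and rayp: "\<And>t. 0 \<le> t \<Longrightarrow> t *\<^sub>R v \<in> Kp" and raym: "\<And>t. 0 \<le> t \<Longrightarrow> t *\<^sub>R (- v) \<in> Km"
    and u: "u \<in> S_dual K" and e: "0 < e"
  shows "\<exists>Z \<eta>. finite Z \<and> 0 < \<eta> \<and> (\<forall>f\<in>decay_ball r K. \<forall>g\<in>decay_ball r Kp. \<forall>h\<in>decay_ball r Km.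
    (\<forall>z\<in>Z. cmod (f z - g z) \<le> \<eta> \<and> cmod (g z - h z) \<le> \<eta>) \<longrightarrow> cmod (u f) \<le> e)"
proof (rule ccontr)
  assume neg: "\<not> ?thesis"
  obtain D :: "(complex^'n) set" where D: "countable D" "\<And>S. open S \<Longrightarrow> S \<noteq> {} \<Longrightarrow> \<exists>d\<in>D. d \<in> S"
    using countable_dense_setE by blast
  then have Dne: "D \<noteq> {}" using open_UNIV by blast
  define d where "d = from_nat_into D"
  have rd: "range d = D" using D(1) Dne by (simp add: d_def)
  have "\<exists>f g h. f \<in> decay_ball r K \<and> g \<in> decay_ball r Kp \<and> h \<in> decay_ball r Km \<and>
      (\<forall>z\<in>d ` {..m}. cmod (f z - g z) \<le> inverse (Suc m) \<and> cmod (g z - h z) \<le> inverse (Suc m)) \<and> e < cmod (u f)"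
    for m
  proof -
    have "finite (d ` {..m})" "0 < inverse (real (Suc m))" by auto
    then show ?thesis using neg by (metis not_le)
  qed
  then obtain f g h where fgh: "\<And>m. f m \<in> decay_ball r K" "\<And>m. g m \<in> decay_ball r Kp" "\<And>m. h m \<in> decay_ball r Km"
    and close: "\<And>m z. z \<in> d ` {..m} \<Longrightarrow> cmod (f m z - g m z) \<le> inverse (Suc m) \<and> cmod (g m z - h m z) \<le> inverse (Suc m)"
    and big: "\<And>m. e < cmod (u (f m))"
    by metis
  have "(\<lambda>m. f m z - g m z) \<longlonglongrightarrow> 0 \<and> (\<lambda>m. g m z - h m z) \<longlonglongrightarrow> 0" if "z \<in> D" for z
  proof -
    obtain n where n: "z = d n" using \<open>z \<in> D\<close> rd by blast
    have "cmod (f m z - g m z) \<le> inverse (Suc m) \<and> cmod (g m z - h m z) \<le> inverse (Suc m)" if "n \<le> m" for m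
      using close[of z m] n that by blast
    then show ?thesis
      by (intro conjI; intro Lim_null_comparison[OF _ LIMSEQ_inverse_real_of_nat] eventually_sequentiallyI[of n]) auto
  qed
  then have "uniform_limit (cball 0 R) f (\<lambda>_. 0) sequentially" for R
    by (intro three_balls_limit_zero[where f = f and g = g and h = h, OF K(2) Kp Km v r rayp raym fgh D(2)]) auto
  then have "(\<lambda>m. u (f m)) \<longlonglongrightarrow> 0" by (intro S_dual_tendsto_zero[OF K u r fgh(1)]) auto
  then have "\<forall>\<^sub>F m in sequentially. cmod (u (f m)) < e" using tendstoD[OF _ e] by fastforce
  then show False using big by (meson eventually_sequentially less_asym order_refl)
qed

lemma point_functional_approximation:
  fixes K Kp Km :: "(real^'n::finite) set"
  assumes K: "closed K" "pos_cone K" and Kp: "pos_cone Kp" and Km: "pos_cone Km" and v: "v \<noteq> 0" and r: "0 < r"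
    and rayp: "\<And>t. 0 \<le> t \<Longrightarrow> t *\<^sub>R v \<in> Kp" and raym: "\<And>t. 0 \<le> t \<Longrightarrow> t *\<^sub>R (- v) \<in> Km"
    and u: "u \<in> S_dual K" and e: "0 < e"
  obtains Z a b where "finite Z" "\<And>f. f \<in> decay_ball r K \<Longrightarrow> cmod (u f - (\<Sum>z\<in>Z. a z * f z)) \<le> e"
    "\<And>g. g \<in> decay_ball r Kp \<Longrightarrow> cmod (\<Sum>z\<in>Z. (a z - b z) * g z) \<le> e"
    "\<And>h. h \<in> decay_ball r Km \<Longrightarrow> cmod (\<Sum>z\<in>Z. b z * h z) \<le> e"
proof -
  obtain Z \<eta> where Z: "finite Z" "0 < \<eta>" and small: "\<And>f g h. f \<in> decay_ball r K \<Longrightarrow> g \<in> decay_ball r Kp \<Longrightarrow>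
    h \<in> decay_ball r Km \<Longrightarrow> (\<And>z. z \<in> Z \<Longrightarrow> cmod (f z - g z) \<le> \<eta> \<and> cmod (g z - h z) \<le> \<eta>) \<Longrightarrow> cmod (u f) \<le> e / 2"
    using functional_small_if_close_on_finite_set[OF K Kp Km v r rayp raym u half_gt_zero[OF e]] by metis
  obtain Mu where Mu: "\<And>f. f \<in> decay_ball r K \<Longrightarrow> cmod (u f) \<le> Mu"
    using S_dual_bounded_on_decay_ball[OF K u r] by blast
  obtain R where R: "\<And>z. z \<in> Z \<Longrightarrow> norm z \<le> R"
    using finite_imp_bounded[OF Z(1)] by (auto simp: bounded_iff)
  have sub: "decay_ball r K \<subseteq> S_space K" by (rule decay_ball_subset_S_space[OF K r])
  define y where "y = (\<lambda>(f :: 'n testfun) g h i. case i of None \<Rightarrow> u f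
    | Some (z, s) \<Rightarrow> if s then f z - g z else g z - h z)"
  \<comment> \<open>The coordinate None carries u f, the coordinates (z, True) and (z, False) carry the differences at z.\<close>
  define Y where "Y = {y f g h | f g h. f \<in> decay_ball r K \<and> g \<in> decay_ball r Kp \<and> h \<in> decay_ball r Km}"
  have y_simps: "y f g h None = u f" "y f g h (Some (z, True)) = f z - g z" "y f g h (Some (z, False)) = g z - h z"
    for f g h z by (simp_all add: y_def)
  have y_add: "y (f + f') (g + g') (h + h') = y f g h + y f' g' h'"
    if "f \<in> S_space K" "f' \<in> S_space K" for f f' g g' h h'
    using S_dual_linear(1)[OF K u that] by (auto simp: y_def fun_eq_iff split: option.split)
  have y_scale: "y (cscale c f) (cscale c g) (cscale c h) = cscale c (y f g h)" if "f \<in> S_space K" for c f g h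
    using S_dual_linear(2)[OF K u that that, of c]
    by (auto simp: y_def fun_eq_iff cscale_def algebra_simps split: option.split)
  have scS: "cscale c f \<in> S_space K" if "f \<in> S_space K" for c f
    using that subspace_S_space[OF K] by (auto intro: cfun.subspace_scale)
  have u0: "u 0 = 0" using S_dual_linear(3)[OF K u] sub zero_in_decay_ball by blast
  let ?I = "Some ` (Z \<times> UNIV)"
  have "\<exists>c. \<forall>x\<in>Y. cmod (x None - (\<Sum>i\<in>?I. c i * x i)) \<le> e"
  proof (rule approximate_combination[where \<eta> = \<eta> and e = "e / 2" and M = "\<bar>Mu\<bar> + 2 * exp (2 * r * R)"])
    show "convex_fun_set Y"
      unfolding convex_fun_set_def
    proof (intro ballI allI impI)
      fix x x' and t :: real assume "x \<in> Y" "x' \<in> Y" and t: "0 \<le> t \<and> t \<le> 1"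
      then obtain f g h f' g' h' where x: "x = y f g h" "f \<in> decay_ball r K" "g \<in> decay_ball r Kp" "h \<in> decay_ball r Km"
        and x': "x' = y f' g' h'" "f' \<in> decay_ball r K" "g' \<in> decay_ball r Kp" "h' \<in> decay_ball r Km"
        unfolding Y_def by blast
      let ?c = "\<lambda>f f'. cscale (of_real (1 - t)) f + cscale (of_real t) f'"
      have fS: "f \<in> S_space K" "f' \<in> S_space K" using sub x(2) x'(2) by auto
      have "?c x x' = y (?c f f') (?c g g') (?c h h')"
        unfolding x(1) x'(1) y_add[OF scS[OF fS(1)] scS[OF fS(2)]] y_scale[OF fS(1)] y_scale[OF fS(2)] ..
      moreover have "?c f f' \<in> decay_ball r K" "?c g g' \<in> decay_ball r Kp" "?c h h' \<in> decay_ball r Km"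
        using x x' t by (auto intro!: decay_ball_combination simp del: of_real_diff)
      ultimately show "?c x x' \<in> Y" unfolding Y_def by blast
    qed
    show "cscale c x \<in> Y" if "x \<in> Y" and c: "cmod c = 1" for c x
    proof -
      obtain f g h where x: "x = y f g h" "f \<in> decay_ball r K" "g \<in> decay_ball r Kp" "h \<in> decay_ball r Km"
        using \<open>x \<in> Y\<close> unfolding Y_def by blast
      have "cscale c x = y (cscale c f) (cscale c g) (cscale c h)"
        using y_scale sub x by auto
      then show ?thesis unfolding Y_def using x decay_ball_rotate c by blast
    qed
    have "y 0 0 0 = 0" by (auto simp: y_def fun_eq_iff u0 split: option.split)
    then show "0 \<in> Y" unfolding Y_def using zero_in_decay_ball by (metis (mono_tags, lifting) mem_Collect_eq)
    show "cmod (x i) \<le> \<bar>Mu\<bar> + 2 * exp (2 * r * R)" if "x \<in> Y" and i: "i \<in> insert None ?I" for x i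
    proof -
      obtain f g h where x: "x = y f g h" "f \<in> decay_ball r K" "g \<in> decay_ball r Kp" "h \<in> decay_ball r Km"
        using \<open>x \<in> Y\<close> unfolding Y_def by blast
      show ?thesis
      proof (cases i)
        case None
        then have "cmod (x i) \<le> Mu" using Mu[OF x(2)] by (simp add: x y_simps)
        moreover have "0 \<le> exp (2 * r * R)" by simp
        ultimately show ?thesis by linarith
      next
        case (Some zs)
        then obtain z s where zs: "i = Some (z, s)" "z \<in> Z" using i by auto
        have "cmod (f z) \<le> exp (2 * r * R)" "cmod (g z) \<le> exp (2 * r * R)" "cmod (h z) \<le> exp (2 * r * R)"
          using decay_ball_locally_bounded[OF _ r _ R[OF zs(2)]] x K Kp Km by auto
        moreover have "cmod (x i) \<le> max (cmod (f z) + cmod (g z)) (cmod (g z) + cmod (h z))"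
          using norm_triangle_ineq4[of "f z" "g z"] norm_triangle_ineq4[of "g z" "h z"]
          by (cases s) (auto simp: x zs y_simps)
        ultimately show ?thesis by linarith
      qed
    qed
    show "cmod (x None) \<le> e / 2" if "x \<in> Y" and i: "\<And>i. i \<in> ?I \<Longrightarrow> cmod (x i) \<le> \<eta>" for x
    proof -
      obtain f g h where x: "x = y f g h" "f \<in> decay_ball r K" "g \<in> decay_ball r Kp" "h \<in> decay_ball r Km"
        using \<open>x \<in> Y\<close> unfolding Y_def by blast
      have "cmod (f z - g z) \<le> \<eta> \<and> cmod (g z - h z) \<le> \<eta>" if "z \<in> Z" for z
        using i[of "Some (z, True)"] i[of "Some (z, False)"] that by (simp add: x y_simps)
      then have "cmod (u f) \<le> e / 2" using small x by blast
      then show ?thesis by (simp add: x y_simps)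
    qed
  qed (use Z e in auto)
  then obtain c where c: "\<And>x. x \<in> Y \<Longrightarrow> cmod (x None - (\<Sum>i\<in>?I. c i * x i)) \<le> e" by blast
  define a where "a = (\<lambda>z. c (Some (z, True)))"
  define b where "b = (\<lambda>z. c (Some (z, False)))"
  have sum: "(\<Sum>i\<in>?I. c i * y f g h i) = (\<Sum>z\<in>Z. a z * (f z - g z) + b z * (g z - h z))" for f g h
  proof -
    have "(\<Sum>i\<in>?I. c i * y f g h i) = (\<Sum>zs\<in>Z \<times> UNIV. c (Some zs) * y f g h (Some zs))"
      by (subst sum.reindex) (auto simp: inj_on_def)
    also have "\<dots> = (\<Sum>z\<in>Z. \<Sum>s\<in>UNIV. c (Some (z, s)) * y f g h (Some (z, s)))"
      by (simp add: sum.cartesian_product)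
    also have "\<dots> = (\<Sum>z\<in>Z. a z * (f z - g z) + b z * (g z - h z))"
      by (simp add: UNIV_bool y_simps a_def b_def add.commute)
    finally show ?thesis .
  qed
  have main: "cmod (u f - (\<Sum>z\<in>Z. a z * (f z - g z) + b z * (g z - h z))) \<le> e"
    if "f \<in> decay_ball r K" "g \<in> decay_ball r Kp" "h \<in> decay_ball r Km" for f g h
  proof -
    have "y f g h \<in> Y" using that unfolding Y_def by blast
    from c[OF this] show ?thesis by (simp add: sum y_simps)
  qed
  show ?thesis
  \<comment> \<open>Two of the three functions may be taken to be zero, which separates the three estimates.\<close>
  proof (rule that[OF Z(1)])
    show "cmod (u f - (\<Sum>z\<in>Z. a z * f z)) \<le> e" if "f \<in> decay_ball r K" for f
      using main[OF that zero_in_decay_ball zero_in_decay_ball] by simp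
    show "cmod (\<Sum>z\<in>Z. (a z - b z) * g z) \<le> e" if "g \<in> decay_ball r Kp" for g
    proof -
      have "(\<Sum>z\<in>Z. (a z - b z) * g z) = - (\<Sum>z\<in>Z. a z * (0 - g z) + b z * (g z - 0))"
        by (simp add: sum_negf[symmetric] algebra_simps)
      then show ?thesis using main[OF zero_in_decay_ball that zero_in_decay_ball] u0 by simp
    qed
    show "cmod (\<Sum>z\<in>Z. b z * h z) \<le> e" if "h \<in> decay_ball r Km" for h
      using main[OF zero_in_decay_ball zero_in_decay_ball that] u0 by (simp add: sum_negf)
  qed
qed

section \<open>The direct sum\<close>

lemma \<P>_iff: "K \<in> \<P> M \<Longrightarrow> closed K \<and> pos_cone K"
  by (simp add: \<P>_def proper_cone_def)

text \<open>
  This is what makes the cone \<open>{0}\<close> a lower bound of all closed cones, so that point functionals can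
  be moved from any cone to any other.
\<close>

lemma closed_cone_zero:
  assumes "closed K" "pos_cone K"
  shows "0 \<in> K"
proof (rule ccontr)
  assume "0 \<notin> K"
  then have "0 < cone_dist K 0" using cone_dist_pos[OF assms(1)] assms(2) by (simp add: pos_cone_def)
  then show False using cone_dist_le_infnorm[OF assms(2), of 0] by (simp add: infnorm_0)
qed

lemma zero_cone_in_\<P>:
  assumes "0 \<in> M"
  shows "{0} \<in> \<P> M"
  using assms linear_zero by (auto simp: \<P>_def proper_cone_def pos_cone_def intro!: exI[of _ "\<lambda>x. 0"])

definition ray :: "real^'n \<Rightarrow> (real^'n) set" where
  "ray v = {t *\<^sub>R v | t. 0 \<le> t}"

lemma ray_in_\<P>:
  assumes v: "v \<noteq> 0" and M: "ray v \<subseteq> M"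
  shows "ray v \<in> \<P> M"
proof -
  have "closed ((\<lambda>t. t *\<^sub>R v) ` {0..})"
    by (rule closed_injective_linear_image)
       (use v in \<open>auto intro: bounded_linear.linear bounded_linear_scaleR_left injI\<close>)
  moreover have "(\<lambda>t. t *\<^sub>R v) ` {0..} = ray v" by (auto simp: ray_def)
  ultimately have cl: "closed (ray v)" by simp
  have pc: "pos_cone (ray v)"
    unfolding pos_cone_def
  proof (intro conjI ballI allI impI)
    show "ray v \<noteq> {}" by (auto simp: ray_def)
    fix x and c :: real assume "x \<in> ray v" and c: "c > 0"
    then obtain t where t: "x = t *\<^sub>R v" "0 \<le> t" by (auto simp: ray_def)
    have "c *\<^sub>R x = (c * t) *\<^sub>R v" "0 \<le> c * t" using t c by auto
    then show "c *\<^sub>R x \<in> ray v" unfolding ray_def by blast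
  qed
  have "linear (\<lambda>x. x \<bullet> v)" by (simp add: linear_iff inner_add_left)
  moreover have "ray v - {0} \<subseteq> {x. x \<bullet> v > 0}"
    using v by (auto simp: ray_def zero_less_mult_iff)
  ultimately show ?thesis using cl pc M by (auto simp: \<P>_def proper_cone_def)
qed

text \<open>
  The points \<open>(a + t v) / n\<close> with \<open>t = s n\<close> tend to \<open>s v\<close>.
\<close>

lemma line_direction_in_closed_cone:
  fixes M :: "(real^'n) set"
  assumes "pos_cone M" "closed M" "contains_line M"
  obtains v where "v \<noteq> 0" "ray v \<subseteq> M" "ray (- v) \<subseteq> M"
proof -
  obtain a v where v: "v \<noteq> 0" "\<And>t. a + t *\<^sub>R v \<in> M" using assms(3) by (auto simp: contains_line_def)
  have "s *\<^sub>R v \<in> M" for s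
  proof (rule closed_sequentially[OF assms(2)])
    fix n
    have "inverse (real (Suc n)) *\<^sub>R (a + (s * real (Suc n)) *\<^sub>R v) \<in> M"
      using assms(1) v(2) by (simp add: pos_cone_def)
    then show "inverse (real (Suc n)) *\<^sub>R a + s *\<^sub>R v \<in> M"
      by (simp add: scaleR_add_right field_simps del: of_nat_Suc)
  next
    have "(\<lambda>n. inverse (real (Suc n)) *\<^sub>R a + s *\<^sub>R v) \<longlonglongrightarrow> 0 *\<^sub>R a + s *\<^sub>R v"
      by (intro tendsto_intros LIMSEQ_inverse_real_of_nat)
    then show "(\<lambda>n. inverse (real (Suc n)) *\<^sub>R a + s *\<^sub>R v) \<longlonglongrightarrow> s *\<^sub>R v" by simp
  qed
  then have "ray v \<subseteq> M" "ray (- v) \<subseteq> M"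
    by (auto simp: ray_def simp flip: scaleR_minus_left)
  with v(1) show ?thesis by (rule that)
qed

lemma subspace_cont_dual: "cfun.subspace (cont_dual T)"
proof (rule cfun.subspaceI)
  show "0 \<in> cont_dual T" by (auto simp: cont_dual_def zero_fun_def)
next
  fix u v assume "u \<in> cont_dual T" "v \<in> cont_dual T"
  then show "u + v \<in> cont_dual T"
    by (auto simp: cont_dual_def plus_fun_def algebra_simps intro!: continuous_map_add)
next
  fix c u assume u: "u \<in> cont_dual T"
  have "continuous_map T euclidean ((\<lambda>w. c * w) \<circ> u)"
    by (rule continuous_map_compose[of _ euclidean])
       (use u in \<open>auto simp: cont_dual_def continuous_map_iff_continuous2 intro!: continuous_intros\<close>)
  then show "cscale c u \<in> cont_dual T"
    using u by (auto simp: cont_dual_def cscale_def o_def algebra_simps)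
qed

lemma subspace_S_dual: "cfun.subspace (S_dual K)"
  unfolding S_dual_def by (rule subspace_cont_dual)

lemma topspace_S_dual_top: "topspace (S_dual_top K) = S_dual K"
proof
  show "topspace (S_dual_top K) \<subseteq> S_dual K"
    using openin_topspace[of "S_dual_top K"] unfolding S_dual_top_def openin_strong_dual S_dual_def by blast
  have "tvs_bounded (S_top K) {}" by (auto simp: tvs_bounded_def intro: exI[of _ 1])
  then have "openin (S_dual_top K) (S_dual K)"
    unfolding S_dual_top_def openin_strong_dual S_dual_def
    by (intro conjI ballI exI[of _ "{}"] exI[of _ "1::real"]) auto
  then show "S_dual K \<subseteq> topspace (S_dual_top K)" by (rule openin_subset)
qed

lemma subspace_direct_sum: "cfun.subspace (direct_sum M)"
proof (rule cfun.subspaceI)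
  have "(\<lambda>f. 0) \<in> S_dual K" for K :: "(real^'a) set"
    using cfun.subspace_0[OF subspace_S_dual] by (simp add: zero_fun_def)
  then show "0 \<in> direct_sum M" by (auto simp: direct_sum_def)
next
  fix F G :: "'a family" assume F: "F \<in> direct_sum M" and G: "G \<in> direct_sum M"
  have "(\<lambda>f. (F + G) (K, f)) \<in> S_dual K" if "K \<in> \<P> M" for K
    using cfun.subspace_add[OF subspace_S_dual, of "\<lambda>f. F (K, f)" K "\<lambda>f. G (K, f)"] F G that
    by (simp add: direct_sum_def plus_fun_def)
  moreover have "finite {K. \<exists>f. (F + G) (K, f) \<noteq> 0}"
    by (rule finite_subset[of _ "{K. \<exists>f. F (K, f) \<noteq> 0} \<union> {K. \<exists>f. G (K, f) \<noteq> 0}"])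
       (use F G in \<open>auto simp: direct_sum_def\<close>)
  ultimately show "F + G \<in> direct_sum M" using F G by (auto simp: direct_sum_def)
next
  fix c and F :: "'a family" assume F: "F \<in> direct_sum M"
  have "(\<lambda>f. cscale c F (K, f)) \<in> S_dual K" if "K \<in> \<P> M" for K
    using cfun.subspace_scale[OF subspace_S_dual, of "\<lambda>f. F (K, f)" K c] F that
    by (simp add: direct_sum_def cscale_def)
  moreover have "finite {K. \<exists>f. cscale c F (K, f) \<noteq> 0}"
    by (rule finite_subset[of _ "{K. \<exists>f. F (K, f) \<noteq> 0}"])
       (use F in \<open>auto simp: direct_sum_def cscale_def\<close>)
  ultimately show "cscale c F \<in> direct_sum M" using F by (auto simp: direct_sum_def cscale_def)
qed

lemma \<iota>_in_direct_sum:
  assumes "K \<in> \<P> M" "u \<in> S_dual K"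
  shows "\<iota> K u \<in> direct_sum M"
proof -
  have "(\<lambda>f. \<iota> K u (L, f)) \<in> S_dual L" for L
    using assms cfun.subspace_0[OF subspace_S_dual] by (cases "L = K") (auto simp: \<iota>_def zero_fun_def)
  moreover have "finite {L. \<exists>f. \<iota> K u (L, f) \<noteq> 0}"
    by (rule finite_subset[of _ "{K}"]) (auto simp: \<iota>_def)
  ultimately show ?thesis using assms by (auto simp: direct_sum_def \<iota>_def)
qed

lemma \<iota>_add: "\<iota> K (u + v) = \<iota> K u + \<iota> K v"
  and \<iota>_diff: "\<iota> K (u - v) = \<iota> K u - \<iota> K v"
  by (auto simp: \<iota>_def fun_eq_iff)

lemma lc_compatible_direct_sum_top:
  "lc_compatible (direct_sum M) (\<P> M) S_dual_top \<iota> (direct_sum_top M)"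
  unfolding direct_sum_top_def
  by (rule lc_compatible_finest_lc[OF subspace_direct_sum]) (auto simp: topspace_S_dual_top \<iota>_in_direct_sum)

lemma topspace_direct_sum_top: "topspace (direct_sum_top M) = direct_sum M"
  using lc_compatible_direct_sum_top by (auto simp: lc_compatible_def)

lemma direct_sum_top_halving:
  assumes N: "openin (direct_sum_top M) N" "0 \<in> N"
  shows "\<exists>N'. openin (direct_sum_top M) N' \<and> 0 \<in> N' \<and> (\<forall>F\<in>N'. \<forall>G\<in>N'. F + G \<in> N)"
proof -
  let ?T = "direct_sum_top M"
  let ?S = "{x \<in> topspace (prod_topology ?T ?T). (case x of (F, G) \<Rightarrow> F + G) \<in> N}"
  have "continuous_map (prod_topology ?T ?T) ?T (\<lambda>(F, G). F + G)"
    using lc_compatible_direct_sum_top by (auto simp: lc_compatible_def lc_topology_def)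
  then have "openin (prod_topology ?T ?T) ?S"
    using N(1) by (rule openin_continuous_map_preimage)
  moreover have "(0, 0) \<in> ?S"
    using N(2) cfun.subspace_0[OF subspace_direct_sum] by (simp add: topspace_direct_sum_top)
  ultimately obtain U V where UV: "openin ?T U" "openin ?T V" "0 \<in> U" "0 \<in> V" "U \<times> V \<subseteq> ?S"
    unfolding openin_prod_topology_alt by meson
  show ?thesis
  proof (intro exI conjI ballI)
    show "openin ?T (U \<inter> V)" "0 \<in> U \<inter> V" using UV by auto
    show "F + G \<in> N" if "F \<in> U \<inter> V" "G \<in> U \<inter> V" for F G
      using UV(5) that by auto
  qed
qed

lemma direct_sum_top_translate:
  assumes N: "openin (direct_sum_top M) N" and F0: "F0 \<in> direct_sum M"
  shows "openin (direct_sum_top M) {F \<in> direct_sum M. F0 + F \<in> N}"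
proof -
  let ?T = "direct_sum_top M"
  have "continuous_map ?T (prod_topology ?T ?T) (\<lambda>F. (F0, F))"
    using F0 by (intro continuous_map_pairedI) (auto simp: topspace_direct_sum_top)
  moreover have "continuous_map (prod_topology ?T ?T) ?T (\<lambda>(F, G). F + G)"
    using lc_compatible_direct_sum_top by (auto simp: lc_compatible_def lc_topology_def)
  ultimately have "continuous_map ?T ?T ((\<lambda>(F, G). F + G) \<circ> (\<lambda>F. (F0, F)))"
    by (rule continuous_map_compose)
  from openin_continuous_map_preimage[OF this N] show ?thesis
    by (simp add: topspace_direct_sum_top)
qed

text \<open>
  The neighbourhoods of zero in the direct sum, seen from the summand \<open>K\<close>. The radius \<open>r'\<close> may be
  enlarged, so that several summands can be treated with a common radius.
\<close>

lemma \<iota>_small: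
  fixes K M :: "(real^'n::finite) set"
  assumes N: "openin (direct_sum_top M) N" "0 \<in> N" and K: "K \<in> \<P> M"
  shows "\<exists>r\<ge>1. \<exists>\<delta>>0. \<forall>r'\<ge>r. \<forall>v\<in>S_dual K. (\<forall>f\<in>decay_ball r' K. cmod (v f) \<le> \<delta>) \<longrightarrow> \<iota> K v \<in> N"
proof -
  have cK: "closed K" "pos_cone K" using \<P>_iff[OF K] by auto
  have "continuous_map (S_dual_top K) (direct_sum_top M) (\<iota> K)"
    using lc_compatible_direct_sum_top K by (auto simp: lc_compatible_def)
  from openin_continuous_map_preimage[OF this N(1)]
  have "openin (S_dual_top K) {u \<in> S_dual K. \<iota> K u \<in> N}" by (simp add: topspace_S_dual_top)
  moreover have "\<iota> K 0 = 0" by (auto simp: \<iota>_def fun_eq_iff)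
  then have "0 \<in> {u \<in> S_dual K. \<iota> K u \<in> N}" using N(2) cfun.subspace_0[OF subspace_S_dual] by simp
  ultimately obtain B \<epsilon> where B: "tvs_bounded (S_top K) B" "0 < \<epsilon>"
    "{v \<in> S_dual K. \<forall>f\<in>B. cmod (v f - 0 f) \<le> \<epsilon>} \<subseteq> {u \<in> S_dual K. \<iota> K u \<in> N}"
    unfolding S_dual_top_def openin_strong_dual S_dual_def by meson
  obtain r where r: "r \<ge> 1" "\<And>f. f \<in> B \<Longrightarrow> \<exists>g\<in>decay_ball r K. f = cscale (complex_of_real r) g"
    using bounded_in_S_top[OF cK B(1)] by blast
  show ?thesis
  proof (intro exI conjI allI impI ballI)
    show "r \<ge> 1" "\<epsilon> / r > 0" using r B(2) by auto
    fix r' v assume r': "r' \<ge> r" and v: "v \<in> S_dual K" "\<forall>f\<in>decay_ball r' K. cmod (v f) \<le> \<epsilon> / r"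
    have "cmod (v f) \<le> \<epsilon>" if "f \<in> B" for f
    proof -
      obtain g where g: "g \<in> decay_ball r K" "f = cscale (complex_of_real r) g" using r(2)[OF \<open>f \<in> B\<close>] by blast
      then have gS: "g \<in> S_space K" using decay_ball_subset_S_space[OF cK, of r] r by auto
      have "g \<in> decay_ball r' K" using g r r' decay_ball_mono[of K r r'] cK by (auto simp: pos_cone_def)
      then have "cmod (v g) \<le> \<epsilon> / r" using v by blast
      moreover have "v f = r * v g" using S_dual_linear(2)[OF cK v(1) gS gS] g by simp
      ultimately show ?thesis using r by (simp add: norm_mult field_simps)
    qed
    then show "\<iota> K v \<in> N" using B(3) v(1) by auto
  qed
qed

section \<open>The closure of the relations\<close>

definition closure_of_relations :: "(real^'n) set \<Rightarrow> ('n::finite) family set" where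
  "closure_of_relations M = {D \<in> direct_sum M.
     \<forall>N. openin (direct_sum_top M) N \<and> 0 \<in> N \<longrightarrow> (\<exists>R\<in>relations M. D - R \<in> N)}"

lemma subspace_relations: "cfun.subspace (relations M)"
  unfolding relations_def by (rule cfun.subspace_span)

lemma closure_of_relations_zero: "0 \<in> closure_of_relations M"
  using cfun.subspace_0[OF subspace_direct_sum] cfun.subspace_0[OF subspace_relations]
  by (auto simp: closure_of_relations_def intro!: bexI[of _ 0])

lemma closure_of_relations_add:
  assumes "D \<in> closure_of_relations M" "E \<in> closure_of_relations M"
  shows "D + E \<in> closure_of_relations M"
  unfolding closure_of_relations_def
proof (intro CollectI conjI allI impI)
  show "D + E \<in> direct_sum M"
    using assms cfun.subspace_add[OF subspace_direct_sum] by (auto simp: closure_of_relations_def)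
  fix N assume N: "openin (direct_sum_top M) N \<and> 0 \<in> N"
  then obtain N' where N': "openin (direct_sum_top M) N'" "0 \<in> N'" "\<And>F G. F \<in> N' \<Longrightarrow> G \<in> N' \<Longrightarrow> F + G \<in> N"
    using direct_sum_top_halving by meson
  then obtain R S where RS: "R \<in> relations M" "S \<in> relations M" "D - R \<in> N'" "E - S \<in> N'"
    using assms unfolding closure_of_relations_def by blast
  have "(D - R) + (E - S) \<in> N" using N'(3) RS by blast
  moreover have "(D - R) + (E - S) = D + E - (R + S)" by simp
  ultimately have "D + E - (R + S) \<in> N" by simp
  then show "\<exists>R\<in>relations M. D + E - R \<in> N"
    using cfun.subspace_add[OF subspace_relations RS(1,2)] by blast
qed

text \<open>
  A point functional on \<open>K\<close> is the restriction of the same point functional on the largest test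
  space, that of \<open>{0}\<close>.
\<close>

lemma \<iota>_point_functional_relation:
  fixes M :: "(real^'n::finite) set"
  assumes K: "K \<in> \<P> M"
  shows "\<iota> {0} (point_functional {0} Z a) - \<iota> K (point_functional K Z a) \<in> relations M"
proof -
  have cK: "closed K" "pos_cone K" using \<P>_iff[OF K] by auto
  have K0: "0 \<in> K" using closed_cone_zero cK by blast
  have "0 \<in> M" using K K0 by (auto simp: \<P>_def)
  then have P0: "{0} \<in> \<P> M" by (rule zero_cone_in_\<P>)
  have c0: "closed {0::real^'n}" "pos_cone {0::real^'n}" using \<P>_iff[OF P0] by auto
  have "S_space K \<subseteq> (S_space {0} :: 'n testfun set)" by (rule S_space_antimono[OF cK c0]) (use K0 in simp)
  then have eq: "point_functional K Z a = \<rho> K (point_functional {0} Z a)"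
    by (auto simp: \<rho>_def point_functional_def fun_eq_iff)
  have "{0} \<subseteq> K" using K0 by simp
  then show ?thesis
    unfolding relations_def eq using P0 K point_functional_in_S_dual[OF c0]
    by (intro cfun.span_base) blast
qed

text \<open>
  With \<open>p\<close> and \<open>q\<close> the point functionals with coefficients \<open>a\<close> and \<open>b\<close>, and writing every
  functional at the cone where it is placed, \<open>u\<close> equals \<open>(u - p)\<close> at \<open>K\<close> plus \<open>(p - q)\<close> at the ray
  of \<open>v\<close> plus \<open>q\<close> at the ray of \<open>- v\<close>, up to the relation \<open>R\<close>. The three terms are small by
  the approximation with point functionals.
\<close>

lemma \<iota>_in_closure_of_relations:
  fixes M :: "(real^'n::finite) set"
  assumes v: "v \<noteq> 0" "ray v \<subseteq> M" "ray (- v) \<subseteq> M" and K: "K \<in> \<P> M" and u: "u \<in> S_dual K"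
  shows "\<iota> K u \<in> closure_of_relations M"
  unfolding closure_of_relations_def
proof (intro CollectI conjI allI impI)
  show "\<iota> K u \<in> direct_sum M" using K u by (rule \<iota>_in_direct_sum)
  fix N assume "openin (direct_sum_top M) N \<and> 0 \<in> N"
  then obtain N' where N': "openin (direct_sum_top M) N'" "0 \<in> N'" "\<And>F G. F \<in> N' \<Longrightarrow> G \<in> N' \<Longrightarrow> F + G \<in> N"
    using direct_sum_top_halving by meson
  obtain N'' where N'': "openin (direct_sum_top M) N''" "0 \<in> N''" "\<And>F G. F \<in> N'' \<Longrightarrow> G \<in> N'' \<Longrightarrow> F + G \<in> N'"
    using direct_sum_top_halving[OF N'(1,2)] by meson
  let ?Kp = "ray v" and ?Km = "ray (- v)"
  have P: "?Kp \<in> \<P> M" "?Km \<in> \<P> M" using v ray_in_\<P>[of v M] ray_in_\<P>[of "- v" M] by auto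
  have cK: "closed K" "pos_cone K" "closed ?Kp" "pos_cone ?Kp" "closed ?Km" "pos_cone ?Km"
    using \<P>_iff K P by auto
  obtain r1 \<delta>1 where 1: "r1 \<ge> 1" "\<delta>1 > 0"
    "\<And>r' w. r' \<ge> r1 \<Longrightarrow> w \<in> S_dual K \<Longrightarrow> (\<And>f. f \<in> decay_ball r' K \<Longrightarrow> cmod (w f) \<le> \<delta>1) \<Longrightarrow> \<iota> K w \<in> N''"
    using \<iota>_small[OF N''(1,2) K] by meson
  obtain r2 \<delta>2 where 2: "r2 \<ge> 1" "\<delta>2 > 0"
    "\<And>r' w. r' \<ge> r2 \<Longrightarrow> w \<in> S_dual ?Kp \<Longrightarrow> (\<And>f. f \<in> decay_ball r' ?Kp \<Longrightarrow> cmod (w f) \<le> \<delta>2) \<Longrightarrow> \<iota> ?Kp w \<in> N''"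
    using \<iota>_small[OF N''(1,2) P(1)] by meson
  obtain r3 \<delta>3 where 3: "r3 \<ge> 1" "\<delta>3 > 0"
    "\<And>r' w. r' \<ge> r3 \<Longrightarrow> w \<in> S_dual ?Km \<Longrightarrow> (\<And>f. f \<in> decay_ball r' ?Km \<Longrightarrow> cmod (w f) \<le> \<delta>3) \<Longrightarrow> \<iota> ?Km w \<in> N''"
    using \<iota>_small[OF N''(1,2) P(2)] by meson
  define r where "r = max r1 (max r2 r3)"
  define e where "e = min \<delta>1 (min \<delta>2 \<delta>3)"
  have r: "r > 0" "r \<ge> r1" "r \<ge> r2" "r \<ge> r3" and e: "e > 0" "e \<le> \<delta>1" "e \<le> \<delta>2" "e \<le> \<delta>3"
    using 1 2 3 by (auto simp: r_def e_def)
  have rp: "t *\<^sub>R v \<in> ?Kp" and rm: "t *\<^sub>R (- v) \<in> ?Km" if "0 \<le> t" for t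
    using that by (auto simp: ray_def simp del: scaleR_minus_right)
  obtain Z a b where Z: "finite Z"
    and ua: "\<And>f. f \<in> decay_ball r K \<Longrightarrow> cmod (u f - (\<Sum>z\<in>Z. a z * f z)) \<le> e"
    and ab: "\<And>g. g \<in> decay_ball r ?Kp \<Longrightarrow> cmod (\<Sum>z\<in>Z. (a z - b z) * g z) \<le> e"
    and bb: "\<And>h. h \<in> decay_ball r ?Km \<Longrightarrow> cmod (\<Sum>z\<in>Z. b z * h z) \<le> e"
    by (rule point_functional_approximation[OF cK(1,2,4,6) v(1) r(1) rp rm u e(1)], assumption, assumption, rule that)
  let ?p = "\<lambda>K. point_functional K Z"
  have w1: "u - ?p K a \<in> S_dual K"
    by (rule cfun.subspace_diff[OF subspace_S_dual u point_functional_in_S_dual[OF cK(1,2)]])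
  have i1: "\<iota> K (u - ?p K a) \<in> N''"
  proof (rule 1(3)[OF r(2) w1])
    fix f assume f: "f \<in> decay_ball r K"
    then have "f \<in> S_space K" using decay_ball_subset_S_space[OF cK(1,2) r(1)] by blast
    then show "cmod ((u - ?p K a) f) \<le> \<delta>1" using ua[OF f] e by (simp add: point_functional_def)
  qed
  have i2: "\<iota> ?Kp (?p ?Kp (\<lambda>z. a z - b z)) \<in> N''"
  proof (rule 2(3)[OF r(3) point_functional_in_S_dual[OF cK(3,4)]])
    fix f assume f: "f \<in> decay_ball r ?Kp"
    then show "cmod (?p ?Kp (\<lambda>z. a z - b z) f) \<le> \<delta>2" using ab[OF f] e 2 by (simp add: point_functional_def)
  qed
  have i3: "\<iota> ?Km (?p ?Km b) \<in> N''"
  proof (rule 3(3)[OF r(4) point_functional_in_S_dual[OF cK(5,6)]])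
    fix f assume f: "f \<in> decay_ball r ?Km"
    then show "cmod (?p ?Km b f) \<le> \<delta>3" using bb[OF f] e 3 by (simp add: point_functional_def)
  qed
  \<comment> \<open>Two halvings give room for four summands; zero serves as the fourth.\<close>
  have i4: "0 + \<iota> K (u - ?p K a) \<in> N'" by (rule N''(3)[OF N''(2) i1])
  have in_N: "\<iota> K (u - ?p K a) + (\<iota> ?Kp (?p ?Kp (\<lambda>z. a z - b z)) + \<iota> ?Km (?p ?Km b)) \<in> N"
    using N'(3)[OF i4 N''(3)[OF i2 i3]] by simp
  define R where "R = (\<iota> {0} (?p {0} (\<lambda>z. a z - b z)) - \<iota> ?Kp (?p ?Kp (\<lambda>z. a z - b z)))
    + (\<iota> {0} (?p {0} b) - \<iota> ?Km (?p ?Km b)) - (\<iota> {0} (?p {0} a) - \<iota> K (?p K a))"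
  have "R \<in> relations M"
    unfolding R_def
    by (intro cfun.subspace_add[OF subspace_relations] cfun.subspace_diff[OF subspace_relations]
        \<iota>_point_functional_relation K P)
  have "?p {0} a = ?p {0} (\<lambda>z. a z - b z) + ?p {0} b"
    by (auto simp: point_functional_def fun_eq_iff algebra_simps simp flip: sum.distrib)
  then have "\<iota> {0} (?p {0} a) = \<iota> {0} (?p {0} (\<lambda>z. a z - b z)) + \<iota> {0} (?p {0} b)"
    by (simp add: \<iota>_add)
  then have "R = \<iota> K (?p K a) - \<iota> ?Kp (?p ?Kp (\<lambda>z. a z - b z)) - \<iota> ?Km (?p ?Km b)"
    unfolding R_def by simp
  then have "\<iota> K u - R = \<iota> K (u - ?p K a) + (\<iota> ?Kp (?p ?Kp (\<lambda>z. a z - b z)) + \<iota> ?Km (?p ?Km b))"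
    by (simp add: \<iota>_diff)
  then show "\<exists>R\<in>relations M. \<iota> K u - R \<in> N"
    using in_N \<open>R \<in> relations M\<close> by (intro bexI[of _ R]) (simp_all only:)
qed

lemma relations_dense:
  fixes M :: "(real^'n::finite) set"
  assumes v: "v \<noteq> 0" "ray v \<subseteq> M" "ray (- v) \<subseteq> M" and D: "D \<in> direct_sum M"
  shows "D \<in> closure_of_relations M"
proof -
  have "D \<in> closure_of_relations M" if "finite S" "D \<in> direct_sum M" "{K. \<exists>f. D (K, f) \<noteq> 0} \<subseteq> S" for S D
    using that
  proof (induction S arbitrary: D rule: finite_induct)
    case empty
    then have "D = 0" by (auto simp: fun_eq_iff)
    then show ?case using closure_of_relations_zero by (simp only:)
  next
    case (insert K S)
    show ?case
    proof (cases "K \<in> \<P> M")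
      case False
      then have "{K. \<exists>f. D (K, f) \<noteq> 0} \<subseteq> S" using insert.prems by (auto simp: direct_sum_def)
      then show ?thesis using insert.IH insert.prems by blast
    next
      case True
      define u where "u = (\<lambda>f. D (K, f))"
      have u: "u \<in> S_dual K" using True insert.prems by (simp add: u_def direct_sum_def)
      have "D - \<iota> K u \<in> closure_of_relations M"
      proof (rule insert.IH)
        show "D - \<iota> K u \<in> direct_sum M"
          using cfun.subspace_diff[OF subspace_direct_sum insert.prems(1) \<iota>_in_direct_sum[OF True u]] .
        show "{L. \<exists>f. (D - \<iota> K u) (L, f) \<noteq> 0} \<subseteq> S"
          using insert.prems(2) by (auto simp: \<iota>_def u_def split: if_splits)
      qed
      from closure_of_relations_add[OF this \<iota>_in_closure_of_relations[OF v True u]]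
      show ?thesis by simp
    qed
  qed
  then show ?thesis using D by (auto simp: direct_sum_def)
qed

theorem lemma3p5:
  fixes M :: "(real^'n::finite) set"
  assumes "pos_cone M" and "closed M" and "contains_line M"
  shows "\<forall>G. openin (\<U>_top M) G \<longleftrightarrow> G = {} \<or> G = \<U> M"
proof (intro allI iffI)
  fix G assume G: "openin (\<U>_top M) G"
  let ?P = "{F \<in> direct_sum M. U_rel M `` {F} \<in> G}"
  have GU: "G \<subseteq> \<U> M" and oP: "openin (direct_sum_top M) ?P"
    using G unfolding openin_\<U>_top by auto
  obtain v where v: "v \<noteq> 0" "ray v \<subseteq> M" "ray (- v) \<subseteq> M"
    using line_direction_in_closed_cone[OF assms] .
  show "G = {} \<or> G = \<U> M"
  proof (cases "G = {}")
    case False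
    then obtain F0 where F0: "F0 \<in> direct_sum M" "U_rel M `` {F0} \<in> G"
      using GU unfolding \<U>_def by (auto elim!: quotientE)
    have "U_rel M `` {F} \<in> G" if F: "F \<in> direct_sum M" for F
    proof -
      \<comment> \<open>Up to a relation, the difference is so small that F lies in the same open saturated set as F0.\<close>
      have "F - F0 \<in> closure_of_relations M"
        using relations_dense[OF v] cfun.subspace_diff[OF subspace_direct_sum F F0(1)] by blast
      moreover have "openin (direct_sum_top M) {E \<in> direct_sum M. F0 + E \<in> ?P}"
        using oP F0(1) by (rule direct_sum_top_translate)
      moreover have "0 \<in> {E \<in> direct_sum M. F0 + E \<in> ?P}"
        using F0 cfun.subspace_0[OF subspace_direct_sum] by simp
      ultimately obtain R where R: "R \<in> relations M" "F - F0 - R \<in> {E \<in> direct_sum M. F0 + E \<in> ?P}"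
        unfolding closure_of_relations_def by blast
      then have FR: "F - R \<in> direct_sum M" "U_rel M `` {F - R} \<in> G" by auto
      have "E - (F - R) \<in> relations M \<longleftrightarrow> E - F \<in> relations M" for E
      proof
        assume "E - (F - R) \<in> relations M"
        from cfun.subspace_diff[OF subspace_relations this R(1)] show "E - F \<in> relations M" by simp
      next
        assume "E - F \<in> relations M"
        from cfun.subspace_add[OF subspace_relations this R(1)] show "E - (F - R) \<in> relations M"
          by (simp add: algebra_simps)
      qed
      then have "U_rel M `` {F - R} = U_rel M `` {F}" using F FR(1) by (auto simp: U_rel_def)
      then show ?thesis using FR(2) by simp
    qed
    then show ?thesis using GU by (auto simp: \<U>_def elim!: quotientE)
  qed auto
next
  fix G assume "G = {} \<or> G = \<U> M"
  then show "openin (\<U>_top M) G"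
  proof
    assume G: "G = \<U> M"
    have "{F \<in> direct_sum M. U_rel M `` {F} \<in> \<U> M} = direct_sum M" by (auto simp: \<U>_def quotientI)
    then show ?thesis
      using openin_topspace[of "direct_sum_top M"] by (simp add: G openin_\<U>_top topspace_direct_sum_top)
  qed auto
qed

end
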